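(* Let $d\ge1$, $2<p<\infty$, $1<r,q<\infty$, and $s\in\mathbb{R}$. If $\mathcal{F}\colon L^p(\mathbb{R}^d)\to\dot F^{r,q}_s(\mathbb{R}^d)$ is bounded, then $s=d(1/p-1/r')$. Moreover, in that case $r\ge p$, and if $r>p$, then $\dot W^p_{d(2/p-1)}\subsetneq\dot F^{r,q}_s$. In particular, if $\mathcal{F}\colon L^p(\mathbb{R}^d)\to\dot W^r_s(\mathbb{R}^d)$ is bounded, then $\dot W^p_{d(2/p-1)}\subseteq\dot W^r_s$, with equality if and only if $r=p$ and $s=d(2/p-1)$.
   Context: All function spaces are over $\mathbb{R}^d$; $r'=r/(r-1)$. $\mathcal{S}$ is the Schwartz space on $\mathbb{R}^d$, $\mathcal{S}'$ the tempered distributions, $\mathcal{P}$ the space of polynomials; $[f]$ denotes the class of $f\in\mathcal{S}'$ in $\mathcal{S}'/\mathcal{P}$. The Fourier transform is $\hat f(\xi)=\mathcal{F}f(\xi)=\int_{\mathbb{R}^d}f(x)e^{-2\pi i x\cdot\xi}\,dx$ on $\mathcal{S}$, extended to $\mathcal{S}'$ by $\langle\hat f,g\rangle=\langle f,\hat g\rangle$. Fix $\varphi\in\mathcal{S}$ with $\hat\varphi$ radially decreasing, $\hat\varphi(\xi)=1$ for $|\xi|\le1$, $\hat\varphi(\xi)=0$ for $|\xi|\ge2$. Define $\varphi_k$, $k\in\mathbb{Z}$, by $\hat\varphi_0(\xi)=\hat\varphi(\xi/2)-\hat\varphi(\xi)$ and $\hat\varphi_k(\xi)=\hat\varphi_0(2^{-k}\xi)$.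 For $1<r,q<\infty$ and $s\in\mathbb{R}$, the homogeneous Triebel–Lizorkin space is $\dot F^{r,q}_s=\{[f]\in\mathcal{S}'/\mathcal{P}:\|f\|_{\dot F^{r,q}_s}<\infty\}$ with norm $\|f\|_{\dot F^{r,q}_s}=\left\|\left(\sum_{k\in\mathbb{Z}}|2^{ks}(\varphi_k*f)|^q\right)^{1/q}\right\|_{L^r}$ (different choices of $\varphi$ give equivalent norms), and the homogeneous Sobolev space is $\dot W^r_s=\dot F^{r,2}_s$. Boundedness of $\mathcal{F}\colon L^p\to\dot F^{r,q}_s$ means that there is $C>0$ with $[\hat f]\in\dot F^{r,q}_s$ and $\|\hat f\|_{\dot F^{r,q}_s}\le C\|f\|_{L^p}$ for all $f\in L^p$. Inclusions between these spaces are as subsets of $\mathcal{S}'/\mathcal{P}$. *)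

theory Defs
  imports "HOL-Analysis.Analysis"
begin

definition partial_deriv :: "'a::euclidean_space \<Rightarrow> ('a \<Rightarrow> complex) \<Rightarrow> 'a \<Rightarrow> complex" where
  "partial_deriv b f = (\<lambda>x. frechet_derivative f (at x) b)"

text \<open>The list \<open>[b1, ..., bm]\<close> of basis vectors stands for the iterated partial derivative
  \<open>D_b1 (... (D_bm f))\<close>.\<close>

definition partial_derivs :: "'a::euclidean_space list \<Rightarrow> ('a \<Rightarrow> complex) \<Rightarrow> 'a \<Rightarrow> complex" where
  "partial_derivs bs f = foldr partial_deriv bs f"

definition smooth_fun :: "('a::euclidean_space \<Rightarrow> complex) \<Rightarrow> bool" where
  "smooth_fun f \<longleftrightarrow>
     (\<forall>bs. set bs \<subseteq> Basis \<longrightarrow> (\<forall>x. partial_derivs bs f differentiable (at x)))"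

definition schwartz :: "('a::euclidean_space \<Rightarrow> complex) set" where
  "schwartz = {f. smooth_fun f \<and>
     (\<forall>bs N. set bs \<subseteq> Basis \<longrightarrow>
        bounded (range (\<lambda>x. (1 + norm x) ^ N *\<^sub>R partial_derivs bs f x)))}"

definition schwartz_seminorm ::
  "nat \<Rightarrow> 'a::euclidean_space list \<Rightarrow> ('a \<Rightarrow> complex) \<Rightarrow> real" where
  "schwartz_seminorm N bs f = (SUP x. (1 + norm x) ^ N * norm (partial_derivs bs f x))"

text \<open>A distribution is a functional on \<^const>\<open>schwartz\<close>; it is extended by \<open>0\<close> to all other
  functions, so that two distributions are equal iff they agree on \<^const>\<open>schwartz\<close>.
  Continuity in the Schwartz topology is domination by finitely many seminorms.\<close>

definition tempered :: "(('a::euclidean_space \<Rightarrow> complex) \<Rightarrow> complex) set" where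
  "tempered = {u.
     (\<forall>g\<in>schwartz. \<forall>h\<in>schwartz. u (\<lambda>x. g x + h x) = u g + u h) \<and>
     (\<forall>g\<in>schwartz. \<forall>a. u (\<lambda>x. a * g x) = a * u g) \<and>
     (\<exists>C N. \<forall>g\<in>schwartz.
        cmod (u g) \<le> C * (\<Sum>bs\<in>{bs. set bs \<subseteq> Basis \<and> length bs \<le> N}. schwartz_seminorm N bs g)) \<and>
     (\<forall>g. g \<notin> schwartz \<longrightarrow> u g = 0)}"

definition dist_of_fun ::
  "('a::euclidean_space \<Rightarrow> complex) \<Rightarrow> ('a \<Rightarrow> complex) \<Rightarrow> complex" where
  "dist_of_fun f = (\<lambda>g. if g \<in> schwartz then (LINT x|lebesgue. f x * g x) else 0)"

definition poly_rel ::
  "((('a::euclidean_space \<Rightarrow> complex) \<Rightarrow> complex) \<times> (('a \<Rightarrow> complex) \<Rightarrow> complex)) set" where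
  "poly_rel = {(u, v). u \<in> tempered \<and> v \<in> tempered \<and>
     (\<exists>P. polynomial_function P \<and> (\<lambda>g. u g - v g) = dist_of_fun P)}"

text \<open>The class \<open>[u]\<close> in the quotient \<open>tempered // poly_rel\<close>, i.e. in S'/P.\<close>

definition poly_class ::
  "(('a::euclidean_space \<Rightarrow> complex) \<Rightarrow> complex) \<Rightarrow> (('a \<Rightarrow> complex) \<Rightarrow> complex) set" where
  "poly_class u = poly_rel `` {u}"

definition fourier :: "('a::euclidean_space \<Rightarrow> complex) \<Rightarrow> 'a \<Rightarrow> complex" where
  "fourier f \<xi> = (LINT x|lebesgue. f x * exp (- 2 * of_real pi * \<i> * of_real (x \<bullet> \<xi>)))"

definition fourier_dist ::
  "(('a::euclidean_space \<Rightarrow> complex) \<Rightarrow> complex) \<Rightarrow> ('a \<Rightarrow> complex) \<Rightarrow> complex" where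
  "fourier_dist u = (\<lambda>g. if g \<in> schwartz then u (fourier g) else 0)"

definition conv_dist ::
  "('a::euclidean_space \<Rightarrow> complex) \<Rightarrow> (('a \<Rightarrow> complex) \<Rightarrow> complex) \<Rightarrow> 'a \<Rightarrow> complex" where
  "conv_dist \<psi> u x = u (\<lambda>y. \<psi> (x - y))"

text \<open>The third condition says that the Fourier transform of \<open>\<phi>\<close> is real-valued, radial and
  nonincreasing in \<open>|\<xi>|\<close> (radiality is the case \<open>norm \<xi> = norm \<eta>\<close>).\<close>

definition lp_generator :: "('a::euclidean_space \<Rightarrow> complex) \<Rightarrow> bool" where
  "lp_generator \<phi> \<longleftrightarrow> \<phi> \<in> schwartz \<and>
     (\<forall>\<xi>. fourier \<phi> \<xi> \<in> \<real>) \<and>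
     (\<forall>\<xi> \<eta>. norm \<xi> \<le> norm \<eta> \<longrightarrow> Re (fourier \<phi> \<eta>) \<le> Re (fourier \<phi> \<xi>)) \<and>
     (\<forall>\<xi>. norm \<xi> \<le> 1 \<longrightarrow> fourier \<phi> \<xi> = 1) \<and>
     (\<forall>\<xi>. norm \<xi> \<ge> 2 \<longrightarrow> fourier \<phi> \<xi> = 0)"

definition lp_base :: "('a::euclidean_space \<Rightarrow> complex) \<Rightarrow> 'a \<Rightarrow> complex" where
  "lp_base \<phi> = (THE \<psi>. \<psi> \<in> schwartz \<and>
     (\<forall>\<xi>. fourier \<psi> \<xi> = fourier \<phi> (\<xi> /\<^sub>R 2) - fourier \<phi> \<xi>))"

definition lp_piece :: "('a::euclidean_space \<Rightarrow> complex) \<Rightarrow> int \<Rightarrow> 'a \<Rightarrow> complex" where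
  "lp_piece \<phi> k = (THE \<psi>. \<psi> \<in> schwartz \<and>
     (\<forall>\<xi>. fourier \<psi> \<xi> = fourier (lp_base \<phi>) ((2 powi (- k)) *\<^sub>R \<xi>)))"

definition Lp_space :: "real \<Rightarrow> ('a::euclidean_space \<Rightarrow> complex) set" where
  "Lp_space p = {f. f \<in> borel_measurable lebesgue \<and> integrable lebesgue (\<lambda>x. cmod (f x) powr p)}"

definition Lp_norm :: "real \<Rightarrow> ('a::euclidean_space \<Rightarrow> complex) \<Rightarrow> real" where
  "Lp_norm p f = (LINT x|lebesgue. cmod (f x) powr p) powr (1 / p)"

text \<open>Powers of extended nonnegative numbers, only used with exponent \<open>a > 0\<close>.\<close>

definition epowr :: "ennreal \<Rightarrow> real \<Rightarrow> ennreal" where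
  "epowr x a = (if x = \<infinity> then \<infinity> else ennreal (enn2real x powr a))"

definition TL_norm ::
  "('a::euclidean_space \<Rightarrow> complex) \<Rightarrow> real \<Rightarrow> real \<Rightarrow> real \<Rightarrow> (('a \<Rightarrow> complex) \<Rightarrow> complex) \<Rightarrow> ennreal"
where
  "TL_norm \<phi> r q s u =
     epowr (\<integral>\<^sup>+ x. epowr (epowr
         (\<Sum>\<^sub>\<infinity>k\<in>(UNIV :: int set).
            ennreal (cmod (of_real (2 powr (real_of_int k * s)) * conv_dist (lp_piece \<phi> k) u x) powr q))
         (1 / q)) r \<partial>lebesgue) (1 / r)"

definition TL_space ::
  "('a::euclidean_space \<Rightarrow> complex) \<Rightarrow> real \<Rightarrow> real \<Rightarrow> real \<Rightarrow> (('a \<Rightarrow> complex) \<Rightarrow> complex) set set"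
where
  "TL_space \<phi> r q s = {poly_class u | u. u \<in> tempered \<and> TL_norm \<phi> r q s u < \<infinity>}"

definition Sobolev_space ::
  "('a::euclidean_space \<Rightarrow> complex) \<Rightarrow> real \<Rightarrow> real \<Rightarrow> (('a \<Rightarrow> complex) \<Rightarrow> complex) set set"
where
  "Sobolev_space \<phi> r s = TL_space \<phi> r 2 s"

definition fourier_bounded ::
  "('a::euclidean_space \<Rightarrow> complex) \<Rightarrow> real \<Rightarrow> real \<Rightarrow> real \<Rightarrow> real \<Rightarrow> bool" where
  "fourier_bounded \<phi> p r q s \<longleftrightarrow> (\<exists>C>0. \<forall>f\<in>Lp_space p.
     poly_class (fourier_dist (dist_of_fun f)) \<in> TL_space \<phi> r q s \<and>
     TL_norm \<phi> r q s (fourier_dist (dist_of_fun f)) \<le> ennreal (C * Lp_norm p f))"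

definition conj_exponent :: "real \<Rightarrow> real" where
  "conj_exponent r = r / (r - 1)"

end

theory Submission
  imports Defs "HOL-Probability.Characteristic_Functions" "HOL-Probability.Sinc_Integral"
begin

text \<open>For \<open>f\<close> in \<open>L\<^sup>p\<close> the \<open>k\<close>-th Littlewood-Paley block of the Fourier transform of \<open>f\<close> is the
  Fourier transform of \<open>f\<close> localised to the annulus \<open>|t| ~ 2\<^sup>k\<close>. Dilating an indicator of an annulus
  forces the value of \<open>s\<close>. Testing on \<open>|t| powr (-d/p)\<close> restricted to \<open>1 \<le> |t| < 2\<^sup>N\<close> makes the
  blocks \<open>L\<^sup>r\<close>-normalised bumps living at the scales \<open>2\<^sup>-\<^sup>k\<close>; restricting each block to its own dyadic
  set gives \<open>N\<^sup>1\<^sup>/\<^sup>r \<le> C N\<^sup>1\<^sup>/\<^sup>p\<close>, hence \<open>r \<ge> p\<close>. The inclusion is Jawerth's embedding, which holds for every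
  \<open>q\<close>: at a point \<open>x\<close> the \<open>k\<close>-th block is bounded both through the pointwise supremum of the weighted
  blocks and, by Bernstein's inequality, through its \<open>L\<^sup>p\<close> norm, and summing the minimum of the
  two geometric bounds interpolates between them. It is strict because a lacunary sum of frequency
  blocks, with coefficients in \<open>\<ell>\<^sup>t\<close> for all \<open>t > p\<close> but not in \<open>\<ell>\<^sup>p\<close>, lies only in the larger space.\<close>

section \<open>Integration on Euclidean space and Schwartz functions\<close>

text \<open>The obstacle is that \<open>u\<close> is an abstract functional on Schwartz functions
  while its blocks must be estimated pointwise. Bernstein's inequality therefore rests on a
  reproducing formula for \<open>\<Delta> k u\<close>, and its proof has to move \<open>u\<close>
  under an integral. The pieces are specified only by their Fourier transforms, through definite
  descriptions; uniqueness for the Fourier transform, proved with Gaussians, identifies them and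
  takes the place of an inversion formula. Each Fourier transform that must itself serve as a test
  function has compact support, so its decay comes from the support and not from integration by
  parts. Once boundedness has fixed \<open>s = d * (1/p + 1/r - 1)\<close>, one has
  \<open>s - d/r = d * (2/p - 1) - d/p\<close>, so both spaces lie on one line of the Sobolev
  scaling; the inclusion and its strictness are then statements about the spaces alone. The lacunary
  element cannot be embedded from the exponent \<open>p\<close>, where its norm diverges
  harmonically, so the embedding is applied to it from an exponent strictly between \<open>p\<close>
  and \<open>r\<close>.\<close>

lemma
  fixes f :: "'a::euclidean_space \<Rightarrow> 'b::{banach, second_countable_topology}"
  assumes [measurable]: "f \<in> borel_measurable borel" and c: "c \<noteq> 0"
  shows lborel_integrable_affine_iff:
      "integrable lborel (\<lambda>x. f (t + c *\<^sub>R x)) \<longleftrightarrow> integrable lborel f"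
    and lborel_integral_affine:
      "(\<integral>x. f x \<partial>lborel) = \<bar>c\<bar> ^ DIM('a) *\<^sub>R (\<integral>x. f (t + c *\<^sub>R x) \<partial>lborel)"
proof -
  have scaleR_iff: "integrable lborel (\<lambda>x. k *\<^sub>R g x) \<longleftrightarrow> integrable lborel g"
    if "k \<noteq> 0" for k :: real and g :: "'a \<Rightarrow> 'b"
    using that integrable_scaleR_right[of "inverse k" lborel "\<lambda>x. k *\<^sub>R g x"] by auto
  show "integrable lborel (\<lambda>x. f (t + c *\<^sub>R x)) \<longleftrightarrow> integrable lborel f"
    using c by (subst (2) lborel_affine[OF c, of t])
      (simp add: integrable_density integrable_distr_eq scaleR_iff)
  show "(\<integral>x. f x \<partial>lborel) = \<bar>c\<bar> ^ DIM('a) *\<^sub>R (\<integral>x. f (t + c *\<^sub>R x) \<partial>lborel)"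
    by (subst lborel_affine[OF c, of t]) (simp add: integral_density integral_distr)
qed

lemma nn_integral_lborel_affine:
  fixes f :: "'a::euclidean_space \<Rightarrow> ennreal"
  assumes [measurable]: "f \<in> borel_measurable borel" and c: "c \<noteq> 0"
  shows "(\<integral>\<^sup>+x. f x \<partial>lborel) = ennreal (\<bar>c\<bar> ^ DIM('a)) * (\<integral>\<^sup>+x. f (t + c *\<^sub>R x) \<partial>lborel)"
  by (subst lborel_affine[OF c, of t]) (simp add: nn_integral_density nn_integral_distr nn_integral_cmult)

text \<open>Tensor products over \<open>Basis\<close> reduce explicit integrals to the line; the
  polynomial weight and the Gaussian below are both of this form.\<close>

lemma
  fixes f :: "'a::euclidean_space \<Rightarrow> real \<Rightarrow> 'b::{real_normed_field, banach, second_countable_topology}"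
  assumes "\<And>b. b \<in> Basis \<Longrightarrow> integrable lborel (f b)"
  shows lborel_integrable_prod_Basis:
      "integrable lborel (\<lambda>x. \<Prod>b\<in>Basis. f b (x \<bullet> b))"
    and lborel_integral_prod_Basis:
      "(\<integral>x. (\<Prod>b\<in>Basis. f b (x \<bullet> b)) \<partial>lborel) = (\<Prod>b\<in>Basis. (\<integral>x. f b x \<partial>lborel))"
proof -
  interpret product_sigma_finite "\<lambda>_::'a. lborel :: real measure"
    by (simp add: product_sigma_finite_def sigma_finite_lborel)
  have [measurable]: "f b \<in> borel_measurable borel" if "b \<in> Basis" for b
    using assms[OF that] by (simp add: borel_measurable_integrable)
  have eq: "(\<Prod>b\<in>Basis. f b ((\<Sum>i\<in>Basis. g i *\<^sub>R i) \<bullet> b)) = (\<Prod>b\<in>Basis. f b (g b))" for g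
    by (intro prod.cong) auto
  show "integrable lborel (\<lambda>x. \<Prod>b\<in>Basis. f b (x \<bullet> b))"
    using assms by (subst lborel_eq) (simp add: integrable_distr_eq eq product_integrable_prod)
  show "(\<integral>x. (\<Prod>b\<in>Basis. f b (x \<bullet> b)) \<partial>lborel) = (\<Prod>b\<in>Basis. (\<integral>x. f b x \<partial>lborel))"
    using assms by (subst lborel_eq) (simp add: integral_distr eq product_integral_prod)
qed

lemma integrable_lborel_inverse_1_plus_square: "integrable lborel (\<lambda>x::real. inverse (1 + x\<^sup>2))"
  using integrable_inverse_1_plus_square by (simp add: set_integrable_def einterval_def)

text \<open>Each factor \<open>1 + (x \<bullet> b)\<^sup>2\<close> is at most
  \<open>(1 + norm x)\<^sup>2\<close>, so a tensor product of integrable one-dimensional kernels is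
  a majorant. The exponent is one square per coordinate.\<close>

lemma integrable_inverse_power_norm:
  "integrable lborel (\<lambda>x::'a::euclidean_space. inverse ((1 + norm x) ^ (2 * DIM('a))))"
proof (rule Bochner_Integration.integrable_bound)
  show "integrable lborel (\<lambda>x::'a. \<Prod>b\<in>Basis. inverse (1 + (x \<bullet> b)\<^sup>2))"
    by (intro lborel_integrable_prod_Basis integrable_lborel_inverse_1_plus_square)
  show "AE x::'a in lborel. norm (inverse ((1 + norm x) ^ (2 * DIM('a))))
      \<le> norm (\<Prod>b\<in>Basis. inverse (1 + (x \<bullet> b)\<^sup>2))"
  proof (rule AE_I2)
    fix x :: 'a
    have "(\<Prod>b\<in>(Basis::'a set). 1 + (x \<bullet> b)\<^sup>2) \<le> (\<Prod>b\<in>(Basis::'a set). (1 + norm x)\<^sup>2)"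
    proof (intro prod_mono conjI)
      fix b :: 'a assume b: "b \<in> Basis"
      have "\<bar>x \<bullet> b\<bar>\<^sup>2 \<le> (norm x)\<^sup>2"
        using Basis_le_norm[OF b, of x] by (intro power_mono) auto
      then show "1 + (x \<bullet> b)\<^sup>2 \<le> (1 + norm x)\<^sup>2"
        using norm_ge_zero[of x] by (simp add: power2_sum del: norm_ge_zero)
    qed (auto intro: add_nonneg_nonneg)
    also have "\<dots> = (1 + norm x) ^ (2 * DIM('a))"
      by (simp add: power_mult)
    finally have *: "(\<Prod>b\<in>(Basis::'a set). 1 + (x \<bullet> b)\<^sup>2) \<le> (1 + norm x) ^ (2 * DIM('a))" .
    have "0 < (\<Prod>b\<in>(Basis::'a set). 1 + (x \<bullet> b)\<^sup>2)"
      by (intro prod_pos) (auto intro: add_pos_nonneg)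
    with * show "norm (inverse ((1 + norm x) ^ (2 * DIM('a))))
      \<le> norm (\<Prod>b\<in>(Basis::'a set). inverse (1 + (x \<bullet> b)\<^sup>2))"
      using prod_inversef[of "\<lambda>b. 1 + (x \<bullet> b)\<^sup>2" Basis]
      by (simp add: o_def le_imp_inverse_le)
  qed
qed (auto intro!: borel_measurable_continuous_onI continuous_intros simp: add_nonneg_eq_0_iff)

section \<open>Rapid decrease and closure properties of the Schwartz space\<close>

definition rapidly_decreasing :: "('a::euclidean_space \<Rightarrow> complex) \<Rightarrow> bool" where
  "rapidly_decreasing f \<longleftrightarrow> (\<forall>N. \<exists>C. \<forall>x. (1 + norm x) ^ N * cmod (f x) \<le> C)"

lemma rapidly_decreasingE:
  assumes "rapidly_decreasing f"
  obtains C where "C > 0" "\<And>x. (1 + norm x) ^ N * cmod (f x) \<le> C"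
proof -
  obtain C where C: "\<And>x. (1 + norm x) ^ N * cmod (f x) \<le> C"
    using assms unfolding rapidly_decreasing_def by blast
  show ?thesis
    by (rule that[of "max 1 C"]) (auto intro: order_trans[OF C])
qed

lemma rapidly_decreasing_integrable:
  fixes f :: "'a::euclidean_space \<Rightarrow> complex"
  assumes "rapidly_decreasing f" and [measurable]: "f \<in> borel_measurable borel"
  shows "integrable lborel (\<lambda>x. (1 + norm x) ^ N * cmod (f x))"
proof -
  obtain C where C: "\<And>x. (1 + norm x) ^ (N + 2 * DIM('a)) * cmod (f x) \<le> C"
    using assms(1) unfolding rapidly_decreasing_def by blast
  have "integrable lborel (\<lambda>x::'a. C * inverse ((1 + norm x) ^ (2 * DIM('a))))"
    by (intro integrable_mult_right integrable_inverse_power_norm)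
  then show ?thesis
  proof (rule Bochner_Integration.integrable_bound)
    show "AE x in lborel. norm ((1 + norm x) ^ N * cmod (f x)) \<le> norm (C * inverse ((1 + norm x) ^ (2 * DIM('a))))"
    proof (rule AE_I2)
      fix x :: 'a
      have "1 + norm x > 0" by (simp add: add_pos_nonneg)
      then have "(1 + norm x) ^ N * cmod (f x) \<le> C * inverse ((1 + norm x) ^ (2 * DIM('a)))"
        using C[of x] by (simp add: field_simps power_add)
      then show "norm ((1 + norm x) ^ N * cmod (f x)) \<le> norm (C * inverse ((1 + norm x) ^ (2 * DIM('a))))"
        by (metis abs_ge_self abs_of_nonneg mult_nonneg_nonneg norm_ge_zero order_trans real_norm_def zero_le_power add_nonneg_nonneg zero_le_one)
    qed
  qed simp
qed

lemma rapidly_decreasing_bound_integrable: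
  assumes "rapidly_decreasing f" "f \<in> borel_measurable borel" "g \<in> borel_measurable borel"
    and "\<And>x. cmod (g x) \<le> C * ((1 + norm x) ^ N * cmod (f x))"
  shows "integrable lborel g"
  by (rule Bochner_Integration.integrable_bound[OF
        integrable_mult_right[OF rapidly_decreasing_integrable[OF assms(1,2)], of C N]])
     (use assms(3,4) in \<open>auto intro: order_trans[OF _ abs_ge_self]\<close>)

lemma partial_deriv_eqI:
  "(f has_derivative f') (at x) \<Longrightarrow> partial_deriv b f x = f' b"
  unfolding partial_deriv_def by (simp add: frechet_derivative_at[symmetric])

lemma partial_derivs_Nil [simp]: "partial_derivs [] f = f"
  and partial_derivs_Cons: "partial_derivs (b # bs) f = partial_deriv b (partial_derivs bs f)"
  by (simp_all add: partial_derivs_def)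

text \<open>A family closed under partial derivatives contains all iterated derivatives of its
  members, so only undifferentiated members have to be inspected. The closure properties below are
  proved by exhibiting such a family, sometimes larger than the functions of interest.\<close>

lemma schwartz_coinduct [consumes 1, case_names differentiable decreasing deriv]:
  assumes "f \<in> X"
    and diff: "\<And>g x. g \<in> X \<Longrightarrow> g differentiable (at x)"
    and dec: "\<And>g. g \<in> X \<Longrightarrow> rapidly_decreasing g"
    and der: "\<And>g b. g \<in> X \<Longrightarrow> b \<in> Basis \<Longrightarrow> partial_deriv b g \<in> X"
  shows "f \<in> schwartz"
proof -
  have X: "partial_derivs bs f \<in> X" if "set bs \<subseteq> Basis" for bs
    using that by (induction bs) (auto simp: partial_derivs_Cons assms)
  show ?thesis
    unfolding schwartz_def smooth_fun_def
  proof (intro CollectI conjI allI impI)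
    fix bs :: "'a list" and N assume "set bs \<subseteq> Basis"
    from X[OF this] obtain C where "\<And>x. (1 + norm x) ^ N * cmod (partial_derivs bs f x) \<le> C"
      using dec unfolding rapidly_decreasing_def by blast
    then show "bounded (range (\<lambda>x. (1 + norm x) ^ N *\<^sub>R partial_derivs bs f x))"
      by (auto simp: bounded_iff abs_mult)
  qed (auto intro: diff X)
qed

lemma schwartz_partial_derivs:
  assumes "f \<in> schwartz" "set bs \<subseteq> Basis"
  shows "partial_derivs bs f \<in> schwartz"
proof -
  have "partial_derivs bs' (partial_derivs bs f) = partial_derivs (bs' @ bs) f" for bs'
    by (simp add: partial_derivs_def)
  then show ?thesis
    using assms unfolding schwartz_def smooth_fun_def by auto
qed

lemma schwartz_partial_deriv:
  "f \<in> schwartz \<Longrightarrow> b \<in> Basis \<Longrightarrow> partial_deriv b f \<in> schwartz"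
  using schwartz_partial_derivs[of f "[b]"] by (simp add: partial_derivs_Cons)

lemma schwartz_differentiable: "f \<in> schwartz \<Longrightarrow> f differentiable (at x)"
  unfolding schwartz_def smooth_fun_def by (auto dest: spec[of _ "[]"])

lemma schwartz_rapidly_decreasing:
  assumes "f \<in> schwartz" shows "rapidly_decreasing f"
  unfolding rapidly_decreasing_def
proof
  fix N
  have "bounded (range (\<lambda>x. (1 + norm x) ^ N *\<^sub>R partial_derivs [] f x))"
    using assms unfolding schwartz_def by (auto simp del: partial_derivs_Nil)
  then show "\<exists>C. \<forall>x. (1 + norm x) ^ N * cmod (f x) \<le> C"
    by (auto simp: bounded_iff abs_mult abs_of_nonneg add_nonneg_nonneg)
qed

lemma schwartz_has_derivative:
  assumes "f \<in> schwartz"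
  shows "(f has_derivative (\<lambda>h. \<Sum>b\<in>Basis. (h \<bullet> b) *\<^sub>R partial_deriv b f x)) (at x)"
proof -
  have D: "(f has_derivative frechet_derivative f (at x)) (at x)"
    using schwartz_differentiable[OF assms] by (simp add: frechet_derivative_works)
  then interpret bounded_linear "frechet_derivative f (at x)"
    by (rule has_derivative_bounded_linear)
  have "frechet_derivative f (at x) h = (\<Sum>b\<in>Basis. (h \<bullet> b) *\<^sub>R partial_deriv b f x)" for h
    by (subst euclidean_representation[of h, symmetric])
       (simp only: partial_deriv_def sum scaleR)
  then show ?thesis using D by (metis (no_types, lifting) ext)
qed

lemma schwartz_continuous: "f \<in> schwartz \<Longrightarrow> continuous_on A f"
  by (meson continuous_at_imp_continuous_on differentiable_imp_continuous_within schwartz_differentiable)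

lemma schwartz_measurable [measurable_dest]: "f \<in> schwartz \<Longrightarrow> f \<in> borel_measurable borel"
  by (intro borel_measurable_continuous_onI schwartz_continuous)

lemma schwartz_integrable: "f \<in> schwartz \<Longrightarrow> integrable lborel f"
  by (rule rapidly_decreasing_bound_integrable[of f _ 1 0])
     (auto intro: schwartz_rapidly_decreasing schwartz_measurable)

lemma schwartz_bounded:
  assumes "f \<in> schwartz" obtains C where "C > 0" "\<And>x. cmod (f x) \<le> C"
  using rapidly_decreasingE[OF schwartz_rapidly_decreasing[OF assms], of 0] by auto

lemma rapidly_decreasing_lincomb:
  assumes "rapidly_decreasing f" "rapidly_decreasing g"
  shows "rapidly_decreasing (\<lambda>x. a * f x + c * g x)"
  unfolding rapidly_decreasing_def
proof
  fix N
  obtain C D where C: "\<And>x. (1 + norm x) ^ N * cmod (f x) \<le> C"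
    and D: "\<And>x. (1 + norm x) ^ N * cmod (g x) \<le> D"
    using assms unfolding rapidly_decreasing_def by meson
  have "(1 + norm x) ^ N * cmod (a * f x + c * g x) \<le> cmod a * C + cmod c * D" for x
  proof -
    have "(1 + norm x) ^ N * cmod (a * f x + c * g x)
        \<le> (1 + norm x) ^ N * (cmod a * cmod (f x) + cmod c * cmod (g x))"
      by (intro mult_left_mono norm_triangle_le) (auto simp: norm_mult)
    also have "\<dots> = cmod a * ((1 + norm x) ^ N * cmod (f x)) + cmod c * ((1 + norm x) ^ N * cmod (g x))"
      by (simp add: algebra_simps)
    also have "\<dots> \<le> cmod a * C + cmod c * D"
      by (intro add_mono mult_left_mono C D) auto
    finally show ?thesis .
  qed
  then show "\<exists>C. \<forall>x. (1 + norm x) ^ N * cmod (a * f x + c * g x) \<le> C" by blast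
qed

lemma partial_deriv_lincomb:
  assumes "f \<in> schwartz" "g \<in> schwartz"
  shows "partial_deriv b (\<lambda>x. a * f x + c * g x) = (\<lambda>x. a * partial_deriv b f x + c * partial_deriv b g x)"
proof
  fix x
  have "((\<lambda>x. a * f x + c * g x) has_derivative
     (\<lambda>h. a * frechet_derivative f (at x) h + c * frechet_derivative g (at x) h)) (at x)"
    using assms[THEN schwartz_differentiable, of x]
    by (auto intro!: derivative_eq_intros simp: frechet_derivative_works)
  from partial_deriv_eqI[OF this, of b]
  show "partial_deriv b (\<lambda>x. a * f x + c * g x) x = a * partial_deriv b f x + c * partial_deriv b g x"
    by (simp add: partial_deriv_def)
qed

lemma schwartz_lincomb:
  assumes "f \<in> schwartz" "g \<in> schwartz"
  shows "(\<lambda>x. a * f x + c * g x) \<in> schwartz"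
proof -
  have "(\<lambda>x. a * f x + c * g x) \<in> {(\<lambda>x. a * f x + c * g x) | f g. f \<in> schwartz \<and> g \<in> schwartz}"
    using assms by blast
  then show ?thesis
  proof (rule schwartz_coinduct, goal_cases)
    case (1 g x)
    then show ?case using schwartz_differentiable by (auto intro!: derivative_intros)
  next
    case (2 g)
    then show ?case by (auto intro: rapidly_decreasing_lincomb dest: schwartz_rapidly_decreasing)
  next
    case (3 g b)
    then obtain f' g' where *: "f' \<in> schwartz" "g' \<in> schwartz" "g = (\<lambda>x. a * f' x + c * g' x)"
      by blast
    show ?case
      by (rule CollectI, rule exI[of _ "partial_deriv b f'"], rule exI[of _ "partial_deriv b g'"])
         (use * 3(2) in \<open>simp add: partial_deriv_lincomb schwartz_partial_deriv\<close>)
  qed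
qed

lemma schwartz_zero: "(\<lambda>x. 0) \<in> schwartz"
  by (rule schwartz_coinduct[of _ "{\<lambda>x. 0}"])
     (auto simp: rapidly_decreasing_def partial_deriv_def frechet_derivative_const)

lemma schwartz_cmult: "f \<in> schwartz \<Longrightarrow> (\<lambda>x. a * f x) \<in> schwartz"
  using schwartz_lincomb[of f f a 0] by simp

lemma schwartz_sum:
  "(\<And>i. i \<in> I \<Longrightarrow> f i \<in> schwartz) \<Longrightarrow> (\<lambda>x. \<Sum>i\<in>I. c i * f i x) \<in> schwartz"
proof (induction I rule: infinite_finite_induct)
  case (insert i I)
  then show ?case
    using schwartz_lincomb[of "f i" "\<lambda>x. \<Sum>i\<in>I. c i * f i x" "c i" 1] by simp
qed (auto simp: schwartz_zero)

lemma partial_derivs_lincomb: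
  assumes "f \<in> schwartz" "g \<in> schwartz" "set bs \<subseteq> Basis"
  shows "partial_derivs bs (\<lambda>x. a * f x + c * g x)
       = (\<lambda>x. a * partial_derivs bs f x + c * partial_derivs bs g x)"
  using assms(3)
  by (induction bs)
     (simp_all add: partial_derivs_Cons partial_deriv_lincomb schwartz_partial_derivs assms)

lemma partial_derivs_zero: "partial_derivs bs (\<lambda>x. 0) = (\<lambda>x. 0)"
  by (induction bs) (simp_all add: partial_derivs_Cons partial_deriv_def frechet_derivative_const)

lemma partial_derivs_sum:
  assumes "\<And>i. i \<in> I \<Longrightarrow> f i \<in> schwartz" "set bs \<subseteq> Basis"
  shows "partial_derivs bs (\<lambda>x. \<Sum>i\<in>I. c i * f i x) = (\<lambda>x. \<Sum>i\<in>I. c i * partial_derivs bs (f i) x)"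
  using assms(1)
proof (induction I rule: infinite_finite_induct)
  case (insert i I)
  then show ?case
    using partial_derivs_lincomb[of "f i" "\<lambda>x. \<Sum>i\<in>I. c i * f i x" bs "c i" 1]
    by (simp add: schwartz_sum assms)
qed (auto simp: partial_derivs_zero)

lemma partial_deriv_affine:
  assumes "f \<in> schwartz"
  shows "partial_deriv b (\<lambda>x. a * f (t + c *\<^sub>R x)) = (\<lambda>x. (a * of_real c) * partial_deriv b f (t + c *\<^sub>R x))"
proof
  fix x
  interpret bounded_linear "frechet_derivative f (at (t + c *\<^sub>R x))"
    using schwartz_differentiable[OF assms]
    by (auto simp: frechet_derivative_works intro: has_derivative_bounded_linear)
  have "(f \<circ> (\<lambda>x. t + c *\<^sub>R x) has_derivative frechet_derivative f (at (t + c *\<^sub>R x)) \<circ> (\<lambda>h. c *\<^sub>R h)) (at x)"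
    using schwartz_differentiable[OF assms]
    by (intro diff_chain_at) (auto intro!: derivative_eq_intros simp: frechet_derivative_works[symmetric])
  then have "((\<lambda>x. a * f (t + c *\<^sub>R x)) has_derivative
     (\<lambda>h. a * frechet_derivative f (at (t + c *\<^sub>R x)) (c *\<^sub>R h))) (at x)"
    by (intro has_derivative_mult_right) (simp add: o_def)
  from partial_deriv_eqI[OF this, of b]
  show "partial_deriv b (\<lambda>x. a * f (t + c *\<^sub>R x)) x = (a * of_real c) * partial_deriv b f (t + c *\<^sub>R x)"
    by (simp add: partial_deriv_def scaleR scaleR_conv_of_real)
qed

lemma rapidly_decreasing_affine:
  assumes "rapidly_decreasing f" "c \<noteq> 0"
  shows "rapidly_decreasing (\<lambda>x. a * f (t + c *\<^sub>R x))"
  unfolding rapidly_decreasing_def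
proof
  fix N
  obtain C where C: "C > 0" "\<And>x. (1 + norm x) ^ N * cmod (f x) \<le> C"
    using rapidly_decreasingE[OF assms(1)] by blast
  \<comment> \<open>From \<open>norm x \<le> (norm t + norm (t + c *\<^sub>R x)) /
    \<bar>c\<bar>\<close>. The product form lets the inequality be raised to the power
    \<open>N\<close>.\<close>
  define M where "M = (1 + norm t) * (1 + 1 / \<bar>c\<bar>)"
  have M: "1 + norm x \<le> M * (1 + norm (t + c *\<^sub>R x))" for x
  proof -
    have "norm (c *\<^sub>R x) \<le> norm t + norm (t + c *\<^sub>R x)"
      by (metis add.commute add_diff_cancel_left' norm_triangle_ineq4)
    then have "norm x \<le> (norm t + norm (t + c *\<^sub>R x)) / \<bar>c\<bar>"
      using assms(2) by (simp add: field_simps)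
    moreover have "1 + (T + n) / e \<le> (1 + T) * (1 + 1 / e) * (1 + n)"
      if "T \<ge> 0" "n \<ge> 0" "e > 0" for T n e :: real
    proof -
      have "(1 + T) * (1 + 1 / e) * (1 + n) - (1 + (T + n) / e)
        = T + n + T * n + 1 / e + T * n / e"
        using that by (simp add: field_simps)
      also have "\<dots> \<ge> 0" using that by auto
      finally show ?thesis by simp
    qed
    ultimately show ?thesis
      unfolding M_def using assms(2)
      by (smt (verit, best) norm_ge_zero zero_less_abs_iff)
  qed
  have "M \<ge> 0" unfolding M_def by (intro mult_nonneg_nonneg) auto
  have "(1 + norm x) ^ N * cmod (a * f (t + c *\<^sub>R x)) \<le> cmod a * M ^ N * C" for x
  proof -
    have "(1 + norm x) ^ N * cmod (a * f (t + c *\<^sub>R x))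
       \<le> (M * (1 + norm (t + c *\<^sub>R x))) ^ N * (cmod a * cmod (f (t + c *\<^sub>R x)))"
      unfolding norm_mult by (intro mult_right_mono power_mono M) auto
    also have "\<dots> = cmod a * M ^ N * ((1 + norm (t + c *\<^sub>R x)) ^ N * cmod (f (t + c *\<^sub>R x)))"
      by (simp add: power_mult_distrib)
    also have "\<dots> \<le> cmod a * M ^ N * C"
      using \<open>M \<ge> 0\<close> by (intro mult_left_mono C) auto
    finally show ?thesis .
  qed
  then show "\<exists>C. \<forall>x. (1 + norm x) ^ N * cmod (a * f (t + c *\<^sub>R x)) \<le> C" by blast
qed

lemma schwartz_affine:
  assumes "f \<in> schwartz" "c \<noteq> 0"
  shows "(\<lambda>x. a * f (t + c *\<^sub>R x)) \<in> schwartz"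
proof -
  have "(\<lambda>x. a * f (t + c *\<^sub>R x)) \<in> {(\<lambda>x. a * f (t + c *\<^sub>R x)) | a f. f \<in> schwartz}"
    using assms by blast
  then show ?thesis
  proof (rule schwartz_coinduct, goal_cases)
    case (1 g x)
    then obtain a f where f: "f \<in> schwartz" "g = (\<lambda>x. a * f (t + c *\<^sub>R x))" by blast
    have "(f \<circ> (\<lambda>x. t + c *\<^sub>R x)) differentiable (at x)"
      using schwartz_differentiable[OF f(1)]
      by (intro differentiable_chain_at) (auto intro!: derivative_intros)
    then show ?case using f by (auto intro!: derivative_intros simp: o_def)
  next
    case (2 g)
    then show ?case using assms by (auto intro: rapidly_decreasing_affine dest: schwartz_rapidly_decreasing)
  next
    case (3 g b)
    then obtain a f where f: "f \<in> schwartz" "g = (\<lambda>x. a * f (t + c *\<^sub>R x))" by blast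
    with 3 show ?case
      by (auto simp: partial_deriv_affine intro!: exI[of _ "a * of_real c"] exI[of _ "partial_deriv b f"] schwartz_partial_deriv)
  qed
qed

lemma schwartz_reflect: "f \<in> schwartz \<Longrightarrow> (\<lambda>y. f (x - y)) \<in> schwartz"
  using schwartz_affine[of f "-1" 1 x] by simp

lemma partial_derivs_reflect:
  assumes "f \<in> schwartz" "set bs \<subseteq> Basis"
  shows "partial_derivs bs (\<lambda>y. f (x - y)) = (\<lambda>y. (-1) ^ length bs * partial_derivs bs f (x - y))"
  using assms(2)
proof (induction bs)
  case (Cons b bs)
  then show ?case
    using partial_deriv_affine[OF schwartz_partial_derivs[OF assms(1)], of bs b "(-1) ^ length bs" x "-1"]
    by (simp add: partial_derivs_Cons)
qed simp

section \<open>The Fourier transform\<close>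

definition expi :: "real \<Rightarrow> complex" where
  "expi t = exp (- 2 * of_real pi * \<i> * of_real t)"

lemma expi_0 [simp]: "expi 0 = 1"
  and expi_add: "expi (s + t) = expi s * expi t"
  and norm_expi [simp]: "cmod (expi t) = 1"
  by (simp_all add: expi_def exp_add[symmetric] ring_distribs)

lemma expi_sum: "finite I \<Longrightarrow> expi (\<Sum>i\<in>I. t i) = (\<Prod>i\<in>I. expi (t i))"
  by (induction I rule: finite_induct) (auto simp: expi_add)

lemma expi_measurable [measurable]: "expi \<in> borel_measurable borel"
  unfolding expi_def by measurable

lemma expi_taylor: "cmod (expi t - 1 - (- 2 * of_real pi * \<i> * of_real t)) \<le> (2 * pi * t)\<^sup>2"
proof -
  have "expi t - 1 - (- 2 * of_real pi * \<i> * of_real t)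
      = iexp (- 2 * pi * t) - (\<Sum>k\<le>1. (\<i> * (- 2 * pi * t)) ^ k / fact k)"
    by (simp add: expi_def mult_ac)
  also have "cmod \<dots> \<le> \<bar>- 2 * pi * t\<bar> ^ Suc 1 / fact (Suc 1)"
    by (rule iexp_approx1)
  also have "\<dots> \<le> (2 * pi * t)\<^sup>2"
    by (simp add: power2_eq_square abs_mult)
  finally show ?thesis .
qed

lemma fourier_lborel:
  "f \<in> borel_measurable borel \<Longrightarrow> fourier f \<xi> = (\<integral>x. f x * expi (x \<bullet> \<xi>) \<partial>lborel)"
  unfolding fourier_def expi_def[symmetric] by (subst integral_completion) simp_all

lemma integrable_expi:
  assumes "integrable lborel (f :: 'a::euclidean_space \<Rightarrow> complex)"
  shows "integrable lborel (\<lambda>x. f x * expi (x \<bullet> \<xi>))"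
  using assms by (rule Bochner_Integration.integrable_bound)
    (use assms in \<open>auto simp: norm_mult dest: borel_measurable_integrable\<close>)

lemma fourier_add:
  assumes "integrable lborel f" "integrable lborel g"
  shows "fourier (\<lambda>x. f x + g x) \<xi> = fourier f \<xi> + fourier g \<xi>"
  using assms[THEN integrable_expi, of \<xi>] assms[THEN borel_measurable_integrable]
  by (simp add: fourier_lborel ring_distribs)

lemma fourier_cmult:
  "f \<in> borel_measurable borel \<Longrightarrow> fourier (\<lambda>x. a * f x) \<xi> = a * fourier f \<xi>"
  by (simp add: fourier_lborel mult.assoc)

lemma fourier_bound:
  "f \<in> borel_measurable borel \<Longrightarrow> cmod (fourier f \<xi>) \<le> (\<integral>x. cmod (f x) \<partial>lborel)"
  using integral_norm_bound[of lborel "\<lambda>x. f x * expi (x \<bullet> \<xi>)"] by (simp add: fourier_lborel norm_mult)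

lemma continuous_on_fourier:
  assumes "integrable lborel f"
  shows "continuous_on A (fourier f)"
proof -
  have [measurable]: "f \<in> borel_measurable borel" using assms by auto
  have "(\<lambda>n. fourier f (\<eta> n)) \<longlonglongrightarrow> fourier f \<xi>" if "\<eta> \<longlonglongrightarrow> \<xi>" for \<eta> \<xi>
    unfolding fourier_lborel[OF \<open>f \<in> borel_measurable borel\<close>, abs_def]
  proof (rule integral_dominated_convergence[where w = "\<lambda>x. cmod (f x)"])
    show "AE x in lborel. (\<lambda>n. f x * expi (x \<bullet> \<eta> n)) \<longlonglongrightarrow> f x * expi (x \<bullet> \<xi>)"
      unfolding expi_def using that by (intro AE_I2 tendsto_intros)
  qed (use assms in \<open>auto simp: norm_mult\<close>)
  then show ?thesis by (simp add: continuous_on_sequentially o_def)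
qed

lemma fourier_affine:
  fixes f :: "'a::euclidean_space \<Rightarrow> complex"
  assumes [measurable]: "f \<in> borel_measurable borel" and c: "c \<noteq> 0"
  shows "fourier (\<lambda>x. f (t + c *\<^sub>R x)) \<xi>
    = expi (- (t \<bullet> \<xi>) / c) * (fourier f (\<xi> /\<^sub>R c) / of_real (\<bar>c\<bar> ^ DIM('a)))"
proof -
  have "fourier f (\<xi> /\<^sub>R c) = (\<integral>x. f x * expi (x \<bullet> (\<xi> /\<^sub>R c)) \<partial>lborel)"
    by (simp add: fourier_lborel)
  also have "\<dots> = \<bar>c\<bar> ^ DIM('a) *\<^sub>R
      (\<integral>x. f (t + c *\<^sub>R x) * expi ((t + c *\<^sub>R x) \<bullet> (\<xi> /\<^sub>R c)) \<partial>lborel)"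
    by (subst lborel_integral_affine[OF _ c, of _ t]) auto
  also have "(\<lambda>x. f (t + c *\<^sub>R x) * expi ((t + c *\<^sub>R x) \<bullet> (\<xi> /\<^sub>R c)))
      = (\<lambda>x. expi ((t \<bullet> \<xi>) / c) * (f (t + c *\<^sub>R x) * expi (x \<bullet> \<xi>)))"
  proof
    fix x
    have "(t + c *\<^sub>R x) \<bullet> (\<xi> /\<^sub>R c) = (t \<bullet> \<xi>) / c + x \<bullet> \<xi>"
      using c by (simp add: inner_add_left field_simps)
    then show "f (t + c *\<^sub>R x) * expi ((t + c *\<^sub>R x) \<bullet> (\<xi> /\<^sub>R c))
        = expi ((t \<bullet> \<xi>) / c) * (f (t + c *\<^sub>R x) * expi (x \<bullet> \<xi>))"
      by (simp only: expi_add mult_ac)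
  qed
  finally have "fourier f (\<xi> /\<^sub>R c)
      = of_real (\<bar>c\<bar> ^ DIM('a)) * (expi ((t \<bullet> \<xi>) / c) * fourier (\<lambda>x. f (t + c *\<^sub>R x)) \<xi>)"
    by (simp add: fourier_lborel scaleR_conv_of_real)
  moreover have "expi s * expi (- s) = 1" for s
    by (simp add: expi_add[symmetric])
  ultimately show ?thesis
    using c by (simp add: minus_divide_left[symmetric] field_simps)
qed

section \<open>Multiplication by coordinates and derivatives of the Fourier transform\<close>

text \<open>Differentiating \<open>(x \<bullet> a) * f\<close> produces an extra multiple of
  \<open>f\<close>. The summand \<open>g\<close> absorbs it, so functions of this shape form a
  family closed under derivatives, as \<open>schwartz_coinduct\<close> requires; the factor 1
  matches the form of \<open>schwartz_lincomb\<close>.\<close>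

lemma partial_deriv_coord:
  assumes "f \<in> schwartz" "g \<in> schwartz"
  shows "partial_deriv b (\<lambda>x. of_real (x \<bullet> a) * f x + g x)
     = (\<lambda>x. of_real (x \<bullet> a) * partial_deriv b f x + (of_real (b \<bullet> a) * f x + 1 * partial_deriv b g x))"
proof
  fix x
  have "((\<lambda>x. of_real (x \<bullet> a) * f x + g x) has_derivative
     (\<lambda>h. of_real (x \<bullet> a) * frechet_derivative f (at x) h + of_real (h \<bullet> a) * f x
        + frechet_derivative g (at x) h)) (at x)"
    using assms[THEN schwartz_differentiable, of x]
    by (auto intro!: derivative_eq_intros simp: frechet_derivative_works)
  from partial_deriv_eqI[OF this, of b]
  show "partial_deriv b (\<lambda>x. of_real (x \<bullet> a) * f x + g x) x
     = of_real (x \<bullet> a) * partial_deriv b f x + (of_real (b \<bullet> a) * f x + 1 * partial_deriv b g x)"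
    by (simp add: partial_deriv_def)
qed

lemma rapidly_decreasing_coord:
  assumes "rapidly_decreasing f"
  shows "rapidly_decreasing (\<lambda>x. of_real (x \<bullet> a) * f x)"
  unfolding rapidly_decreasing_def
proof
  fix N
  obtain C where C: "\<And>x. (1 + norm x) ^ Suc N * cmod (f x) \<le> C"
    using assms unfolding rapidly_decreasing_def by meson
  have "(1 + norm x) ^ N * cmod (of_real (x \<bullet> a) * f x) \<le> norm a * C" for x
  proof -
    have "\<bar>x \<bullet> a\<bar> \<le> norm a * (1 + norm x)"
      using Cauchy_Schwarz_ineq2[of x a] norm_ge_zero[of a]
      by (simp add: algebra_simps del: norm_ge_zero)
    then have "(1 + norm x) ^ N * cmod (of_real (x \<bullet> a) * f x)
        \<le> (1 + norm x) ^ N * (norm a * (1 + norm x) * cmod (f x))"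
      unfolding norm_mult norm_of_real by (intro mult_left_mono mult_right_mono) auto
    also have "\<dots> = norm a * ((1 + norm x) ^ Suc N * cmod (f x))"
      by (simp add: mult_ac)
    also have "\<dots> \<le> norm a * C"
      by (intro mult_left_mono C) auto
    finally show ?thesis .
  qed
  then show "\<exists>C. \<forall>x. (1 + norm x) ^ N * cmod (of_real (x \<bullet> a) * f x) \<le> C" by blast
qed

lemma schwartz_coord:
  assumes "f \<in> schwartz"
  shows "(\<lambda>x. of_real (x \<bullet> a) * f x) \<in> schwartz"
proof -
  have "(\<lambda>x. of_real (x \<bullet> a) * f x)
      \<in> {(\<lambda>x. of_real (x \<bullet> a) * f x + g x) | f g. f \<in> schwartz \<and> g \<in> schwartz}"
    using assms schwartz_zero by force
  then show ?thesis
  proof (rule schwartz_coinduct, goal_cases)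
    case (1 g x)
    then obtain f' g' where *: "f' \<in> schwartz" "g' \<in> schwartz" "g = (\<lambda>x. of_real (x \<bullet> a) * f' x + g' x)"
      by blast
    have "(\<lambda>x. complex_of_real (x \<bullet> a)) differentiable (at x)"
      by (intro bounded_linear_imp_differentiable
          bounded_linear_compose[OF bounded_linear_of_real bounded_linear_inner_left])
    then show ?case
      using *(1,2)[THEN schwartz_differentiable, of x] unfolding *(3) by simp
  next
    case (2 g)
    then show ?case
      using rapidly_decreasing_lincomb[of _ _ 1 1]
      by (auto dest!: schwartz_rapidly_decreasing intro: rapidly_decreasing_coord)
  next
    case (3 g b)
    then obtain f' g' where *: "f' \<in> schwartz" "g' \<in> schwartz" "g = (\<lambda>x. of_real (x \<bullet> a) * f' x + g' x)"
      by blast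
    show ?case
      by (rule CollectI, rule exI[of _ "partial_deriv b f'"],
          rule exI[of _ "\<lambda>x. of_real (b \<bullet> a) * f' x + 1 * partial_deriv b g' x"])
         (use * 3(2) in \<open>auto simp only: partial_deriv_coord intro!: schwartz_partial_deriv schwartz_lincomb\<close>)
  qed
qed

lemma has_derivative_quadratic:
  fixes f :: "'a::real_normed_vector \<Rightarrow> 'b::real_normed_vector"
  assumes "bounded_linear L" and *: "\<And>h. norm (f (x + h) - f x - L h) \<le> C * (norm h)\<^sup>2"
  shows "(f has_derivative L) (at x)"
proof (rule has_derivativeI_sandwich[where e = 1 and H = "\<lambda>y. C * norm (y - x)"])
  fix y assume "y \<noteq> x"
  then show "norm (f y - f x - L (y - x)) / norm (y - x) \<le> C * norm (y - x)"
    using *[of "y - x"] by (simp add: divide_simps power2_eq_square mult_ac)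
next
  have "((\<lambda>y. C * norm (y - x)) \<longlongrightarrow> C * norm (x - x)) (at x)"
    by (intro tendsto_intros)
  then show "((\<lambda>y. C * norm (y - x)) \<longlongrightarrow> 0) (at x)" by simp
qed (use assms in auto)

text \<open>The second-order Taylor bound for \<open>expi\<close> holds pointwise with remainder at
  most a constant times \<open>((1 + norm x) * norm h)\<^sup>2\<close>. Integrated against
  \<open>f\<close> it leaves a remainder quadratic in \<open>h\<close>, because the weight of degree
  2 is integrable; no limit is interchanged with the integral.\<close>

lemma fourier_has_derivative:
  assumes "f \<in> schwartz"
  shows "(fourier f has_derivative
     (\<lambda>h. - 2 * of_real pi * \<i> * fourier (\<lambda>x. of_real (x \<bullet> h) * f x) \<xi>)) (at \<xi>)"
    (is "(_ has_derivative ?L) _")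
proof -
  have m [measurable]: "f \<in> borel_measurable borel" using assms by measurable
  \<comment> \<open>Written in coordinates, the candidate derivative is visibly a finite sum of
    bounded linear maps in \<open>h\<close>.\<close>
  have coord: "fourier (\<lambda>x. of_real (x \<bullet> h) * f x) \<xi>
      = (\<Sum>b\<in>Basis. of_real (h \<bullet> b) * fourier (\<lambda>x. of_real (x \<bullet> b) * f x) \<xi>)" for h
  proof -
    have *: "integrable lborel (\<lambda>x. of_real (x \<bullet> b) * f x * expi (x \<bullet> \<xi>))" for b
      by (intro integrable_expi schwartz_integrable schwartz_coord assms)
    have "fourier (\<lambda>x. of_real (x \<bullet> h) * f x) \<xi>
        = (\<integral>x. (\<Sum>b\<in>Basis. of_real (h \<bullet> b) * (of_real (x \<bullet> b) * f x * expi (x \<bullet> \<xi>))) \<partial>lborel)"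
      by (subst euclidean_inner)
         (simp add: fourier_lborel sum_distrib_right sum_distrib_left mult_ac)
    also have "\<dots> = (\<Sum>b\<in>Basis. of_real (h \<bullet> b) * fourier (\<lambda>x. of_real (x \<bullet> b) * f x) \<xi>)"
      using * by (subst Bochner_Integration.integral_sum) (auto simp: fourier_lborel mult.assoc)
    finally show ?thesis .
  qed
  show ?thesis
  proof (rule has_derivative_quadratic)
    have "?L = (\<lambda>h. - 2 * of_real pi * \<i> * (\<Sum>b\<in>Basis. of_real (h \<bullet> b) * fourier (\<lambda>x. of_real (x \<bullet> b) * f x) \<xi>))"
      by (rule ext) (subst coord, rule refl)
    then show "bounded_linear ?L"
      by (simp only:) (intro bounded_linear_const_mult bounded_linear_sum bounded_linear_mult_const
          bounded_linear_compose[OF bounded_linear_of_real bounded_linear_inner_left])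
  next
    fix h :: 'a
    define w where "w x = (2 * pi)\<^sup>2 * ((1 + norm x)\<^sup>2 * cmod (f x))" for x
    have w: "integrable lborel w"
      unfolding w_def
      by (intro integrable_mult_right rapidly_decreasing_integrable schwartz_rapidly_decreasing assms m)
    have i1: "integrable lborel (\<lambda>x. f x * expi (x \<bullet> \<eta>))" for \<eta>
      by (intro integrable_expi schwartz_integrable assms)
    have i2: "integrable lborel (\<lambda>x. of_real (x \<bullet> h) * f x * expi (x \<bullet> \<xi>))"
      by (intro integrable_expi schwartz_integrable schwartz_coord assms)
    have "fourier f (\<xi> + h) - fourier f \<xi> - ?L h
        = (\<integral>x. f x * expi (x \<bullet> (\<xi> + h)) - f x * expi (x \<bullet> \<xi>)
              - (- 2 * of_real pi * \<i>) * (of_real (x \<bullet> h) * f x * expi (x \<bullet> \<xi>)) \<partial>lborel)"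
      using i1 i2 by (simp add: fourier_lborel)
    also have "cmod \<dots> \<le> (\<integral>x. w x * (norm h)\<^sup>2 \<partial>lborel)"
    proof (rule Bochner_Integration.integral_norm_bound_integral)
      fix x
      have "f x * expi (x \<bullet> (\<xi> + h)) - f x * expi (x \<bullet> \<xi>)
              - (- 2 * of_real pi * \<i>) * (of_real (x \<bullet> h) * f x * expi (x \<bullet> \<xi>))
          = f x * expi (x \<bullet> \<xi>) * (expi (x \<bullet> h) - 1 - (- 2 * of_real pi * \<i> * of_real (x \<bullet> h)))"
        by (simp add: inner_add_right expi_add algebra_simps)
      also have "cmod \<dots> \<le> cmod (f x) * (2 * pi * (x \<bullet> h))\<^sup>2"
        unfolding norm_mult norm_expi mult_1_right by (intro mult_left_mono expi_taylor) auto
      also have "\<dots> \<le> cmod (f x) * (2 * pi * ((1 + norm x) * norm h))\<^sup>2"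
      proof -
        have "\<bar>x \<bullet> h\<bar> \<le> (1 + norm x) * norm h"
          using Cauchy_Schwarz_ineq2[of x h] norm_ge_zero[of h]
          by (simp add: algebra_simps del: norm_ge_zero)
        then have "\<bar>x \<bullet> h\<bar>\<^sup>2 \<le> ((1 + norm x) * norm h)\<^sup>2" by (intro power_mono) auto
        then show ?thesis by (intro mult_left_mono) (auto simp: power_mult_distrib)
      qed
      also have "\<dots> = w x * (norm h)\<^sup>2"
        by (simp add: w_def power_mult_distrib)
      finally show "cmod (f x * expi (x \<bullet> (\<xi> + h)) - f x * expi (x \<bullet> \<xi>)
              - (- 2 * of_real pi * \<i>) * (of_real (x \<bullet> h) * f x * expi (x \<bullet> \<xi>))) \<le> w x * (norm h)\<^sup>2" .
    qed (use w i1 i2 in auto)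
    finally show "cmod (fourier f (\<xi> + h) - fourier f \<xi> - ?L h) \<le> integral\<^sup>L lborel w * (norm h)\<^sup>2"
      by simp
  qed
qed

lemma partial_deriv_fourier:
  assumes "f \<in> schwartz"
  shows "partial_deriv b (fourier f) = fourier (\<lambda>x. (- 2 * of_real pi * \<i>) * (of_real (x \<bullet> b) * f x))"
proof
  fix \<xi>
  show "partial_deriv b (fourier f) \<xi> = fourier (\<lambda>x. (- 2 * of_real pi * \<i>) * (of_real (x \<bullet> b) * f x)) \<xi>"
    using partial_deriv_eqI[OF fourier_has_derivative[OF assms], of b \<xi>]
    by (subst fourier_cmult) (use assms in \<open>auto intro: schwartz_measurable schwartz_coord\<close>)
qed

lemma partial_deriv_zero_open:
  assumes "open S" "x \<in> S" "\<And>y. y \<in> S \<Longrightarrow> f y = 0"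
  shows "partial_deriv b f x = 0"
proof -
  have "((\<lambda>x. 0) has_derivative (\<lambda>_. 0)) (at x)" by simp
  then have "(f has_derivative (\<lambda>_. 0)) (at x)"
    by (rule has_derivative_transform_within_open[OF _ assms(1,2)]) (use assms(3) in auto)
  from partial_deriv_eqI[OF this] show ?thesis .
qed

lemma rapidly_decreasing_compact_support:
  assumes "\<And>x. cmod (f x) \<le> B" "\<And>x. norm x > R \<Longrightarrow> f x = 0"
  shows "rapidly_decreasing f"
  unfolding rapidly_decreasing_def
proof
  fix N
  have "(1 + norm x) ^ N * cmod (f x) \<le> (1 + \<bar>R\<bar>) ^ N * \<bar>B\<bar>" for x
  proof (cases "norm x > R")
    case False
    then show ?thesis
      by (intro mult_mono power_mono) (auto intro: order_trans[OF assms(1)])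
  qed (simp add: assms(2))
  then show "\<exists>C. \<forall>x. (1 + norm x) ^ N * cmod (f x) \<le> C" by blast
qed

text \<open>A derivative of \<open>fourier f\<close> is the Fourier transform of a coordinate
  multiple of \<open>f\<close>, and it still vanishes on the open set \<open>norm \<xi> > R\<close>.
  The family therefore keeps the same \<open>R\<close>, and decay is automatic for bounded functions
  supported in a fixed ball.\<close>

lemma fourier_in_schwartz:
  assumes "f \<in> schwartz" "\<And>\<xi>. norm \<xi> > R \<Longrightarrow> fourier f \<xi> = 0"
  shows "fourier f \<in> schwartz"
proof -
  have "fourier f \<in> {fourier f | f. f \<in> schwartz \<and> (\<forall>\<xi>. norm \<xi> > R \<longrightarrow> fourier f \<xi> = 0)}"
    using assms by blast
  then show ?thesis
  proof (rule schwartz_coinduct, goal_cases)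
    case (1 g x)
    then show ?case using fourier_has_derivative by (auto simp: differentiable_def)
  next
    case (2 g)
    then show ?case
      by (auto intro!: rapidly_decreasing_compact_support fourier_bound simp: schwartz_measurable)
  next
    case (3 g b)
    then obtain f where f: "f \<in> schwartz" "\<forall>\<xi>. norm \<xi> > R \<longrightarrow> fourier f \<xi> = 0" "g = fourier f"
      by blast
    have "partial_deriv b g \<xi> = 0" if "norm \<xi> > R" for \<xi>
      using that f(2,3)
      by (intro partial_deriv_zero_open[of "{\<xi>. norm \<xi> > R}"]) (auto intro!: open_Collect_less continuous_intros)
    then show ?case
      using f by (auto simp: partial_deriv_fourier intro!: exI[of _ "\<lambda>x. - 2 * of_real pi * \<i> * (of_real (x \<bullet> b) * f x)"]
           schwartz_cmult schwartz_coord)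
  qed
qed

section \<open>Fourier uniqueness and convolutions\<close>

text \<open>This is the characteristic function of the standard normal law, read at
  \<open>- 2 * pi * z\<close> to match the normalisation of \<open>expi\<close>.\<close>

lemma gaussian_fourier_1d:
  "(\<integral>x. of_real (std_normal_density x) * expi (x * z) \<partial>lborel) = of_real (exp (- (2 * pi * z)\<^sup>2 / 2))"
proof -
  have "char std_normal_distribution (- 2 * pi * z)
      = (\<integral>x. std_normal_density x *\<^sub>R iexp (- 2 * pi * z * x) \<partial>lborel)"
    unfolding char_def by (intro integral_density) (auto simp: normal_density_nonneg)
  also have "\<dots> = (\<integral>x. of_real (std_normal_density x) * expi (x * z) \<partial>lborel)"
    by (simp add: scaleR_conv_of_real expi_def mult_ac)
  finally show ?thesis
    by (simp add: char_std_normal_distribution)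
qed

definition gauss :: "'a::euclidean_space \<Rightarrow> real" where
  "gauss x = (\<Prod>b\<in>Basis. std_normal_density (x \<bullet> b))"

definition gauss_hat :: "'a::euclidean_space \<Rightarrow> real" where
  "gauss_hat z = (\<Prod>b\<in>Basis. exp (- (2 * pi * (z \<bullet> b))\<^sup>2 / 2))"

lemma integrable_gauss: "integrable lborel (gauss :: 'a::euclidean_space \<Rightarrow> real)"
  unfolding gauss_def by (intro lborel_integrable_prod_Basis integrable_normal_density) auto

lemma gauss_nonneg: "gauss x \<ge> 0"
  unfolding gauss_def by (intro prod_nonneg) auto

lemma gauss_hat_pos: "gauss_hat x > 0"
  unfolding gauss_hat_def by (intro prod_pos) auto

lemma gauss_hat_measurable [measurable]: "gauss_hat \<in> borel_measurable borel"
  unfolding gauss_hat_def by measurable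

lemma gauss_measurable [measurable]: "gauss \<in> borel_measurable borel"
  using integrable_gauss by auto

lemma integrable_gauss_hat: "integrable lborel (gauss_hat :: 'a::euclidean_space \<Rightarrow> real)"
  unfolding gauss_hat_def
proof (intro lborel_integrable_prod_Basis)
  show "integrable lborel (\<lambda>z::real. exp (- (2 * pi * z)\<^sup>2 / 2))"
  proof (rule Bochner_Integration.integrable_bound[OF integrable_lborel_inverse_1_plus_square])
    show "AE z in lborel. norm (exp (- (2 * pi * z)\<^sup>2 / 2)) \<le> norm (inverse (1 + z\<^sup>2))"
    proof (rule AE_I2)
      fix z :: real
      \<comment> \<open>This makes the quadratic coefficient at least 1, so
        \<open>exp y \<ge> 1 + y\<close> gives the majorant
        \<open>inverse (1 + z\<^sup>2)\<close>.\<close>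
      have "2\<^sup>2 \<le> pi\<^sup>2"
        using pi_ge_two by (intro power_mono) auto
      then have "1 * z\<^sup>2 \<le> (2 * pi)\<^sup>2 / 2 * z\<^sup>2"
        by (intro mult_right_mono) (auto simp: power_mult_distrib)
      then have "1 + z\<^sup>2 \<le> 1 + (2 * pi * z)\<^sup>2 / 2"
        by (simp add: power_mult_distrib)
      also have "\<dots> \<le> exp ((2 * pi * z)\<^sup>2 / 2)"
        by (rule exp_ge_add_one_self)
      finally have "inverse (exp ((2 * pi * z)\<^sup>2 / 2)) \<le> inverse (1 + z\<^sup>2)"
        by (intro le_imp_inverse_le) (auto intro: add_pos_nonneg)
      then show "norm (exp (- (2 * pi * z)\<^sup>2 / 2)) \<le> norm (inverse (1 + z\<^sup>2))"
        by (simp add: exp_minus)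
    qed
  qed auto
qed

lemma gauss_fourier:
  fixes z :: "'a::euclidean_space"
  shows "(\<integral>\<xi>. of_real (gauss \<xi>) * expi (\<xi> \<bullet> z) \<partial>lborel) = of_real (gauss_hat z)"
proof -
  have "(\<integral>\<xi>. of_real (gauss \<xi>) * expi (\<xi> \<bullet> z) \<partial>lborel)
     = (\<integral>\<xi>. (\<Prod>b\<in>Basis. of_real (std_normal_density (\<xi> \<bullet> b)) * expi ((\<xi> \<bullet> b) * (z \<bullet> b))) \<partial>lborel)"
    by (subst euclidean_inner) (simp add: gauss_def expi_sum prod.distrib)
  also have "\<dots> = (\<Prod>b\<in>(Basis::'a set). (\<integral>x. of_real (std_normal_density x) * expi (x * (z \<bullet> b)) \<partial>lborel))"
  proof (rule lborel_integral_prod_Basis)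
    fix b :: 'a assume "b \<in> Basis"
    have "integrable lborel (\<lambda>x. complex_of_real (std_normal_density x))"
      by (intro integrable_of_real integrable_normal_density) auto
    from integrable_expi[OF this, of "z \<bullet> b"]
    show "integrable lborel (\<lambda>x. of_real (std_normal_density x) * expi (x * (z \<bullet> b)))"
      by simp
  qed
  also have "\<dots> = of_real (gauss_hat z)"
    by (simp add: gaussian_fourier_1d gauss_hat_def)
  finally show ?thesis .
qed

text \<open>The Fourier transform of \<open>f\<close>, integrated against a modulated Gaussian of width \<open>c\<close>, is a
  Gaussian average of \<open>f\<close> around \<open>y\<close> at scale \<open>1 / c\<close>.\<close>

lemma fourier_injective_zero:
  fixes f :: "'a::euclidean_space \<Rightarrow> complex"
  assumes cont: "continuous_on UNIV f" and int: "integrable lborel f"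
    and bdd: "\<And>x. cmod (f x) \<le> B" and zero: "\<And>\<xi>. fourier f \<xi> = 0"
  shows "f y = 0"
proof -
  have m [measurable]: "f \<in> borel_measurable borel" using int by auto
  have smoothed: "(\<integral>u. f (y + u /\<^sub>R real (Suc n)) * of_real (gauss_hat u) \<partial>lborel) = 0" for n
  proof -
    define c where "c = real (Suc n)"
    have c: "c > 0" by (simp add: c_def)
    \<comment> \<open>The double integral of \<open>?h\<close> is computed in both orders:
      \<open>x\<close> first gives a value of \<open>fourier f\<close>, hence 0;
      \<open>\<xi>\<close> first gives \<open>f\<close> averaged against \<open>gauss_hat\<close>
      centred at \<open>y\<close>.\<close>
    let ?h = "\<lambda>\<xi> x. of_real (gauss \<xi>) * (f x * expi ((c *\<^sub>R \<xi>) \<bullet> (x - y)))"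
    have "integrable (lborel \<Otimes>\<^sub>M lborel) (\<lambda>(\<xi>, x). ?h \<xi> x)"
    proof (rule lborel_pair.Fubini_integrable)
      show "integrable lborel (\<lambda>\<xi>::'a. \<integral>x. norm (case (\<xi>, x) of (\<xi>, x) \<Rightarrow> ?h \<xi> x) \<partial>lborel)"
        by (simp add: norm_mult gauss_nonneg integrable_gauss)
      have "integrable lborel (\<lambda>x. ?h \<xi> x)" for \<xi>
        by (rule Bochner_Integration.integrable_bound[where f = "\<lambda>x. gauss \<xi> * cmod (f x)"])
           (use int in \<open>auto simp: norm_mult gauss_nonneg\<close>)
      then show "AE \<xi>::'a in lborel. integrable lborel (\<lambda>x. case (\<xi>, x) of (\<xi>, x) \<Rightarrow> ?h \<xi> x)"
        by simp
    qed measurable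
    then have "(\<integral>x. (\<integral>\<xi>. ?h \<xi> x \<partial>lborel) \<partial>lborel) = (\<integral>\<xi>. (\<integral>x. ?h \<xi> x \<partial>lborel) \<partial>lborel)"
      by (rule lborel_pair.Fubini_integral)
    also have "\<dots> = 0"
    proof -
      have "(\<integral>x. ?h \<xi> x \<partial>lborel) = 0" for \<xi>
      proof -
        have "(\<integral>x. ?h \<xi> x \<partial>lborel)
            = (\<integral>x. of_real (gauss \<xi>) * expi (- ((c *\<^sub>R \<xi>) \<bullet> y)) * (f x * expi (x \<bullet> (c *\<^sub>R \<xi>))) \<partial>lborel)"
          by (simp only: diff_conv_add_uminus inner_add_right inner_minus_right expi_add)
             (simp add: mult_ac inner_commute)
        also have "\<dots> = of_real (gauss \<xi>) * expi (- ((c *\<^sub>R \<xi>) \<bullet> y)) * fourier f (c *\<^sub>R \<xi>)"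
          by (simp only: Bochner_Integration.integral_mult_right_zero fourier_lborel[OF m])
        finally show ?thesis by (simp add: zero)
      qed
      then show ?thesis by (simp only: Bochner_Integration.integral_zero)
    qed
    finally have "0 = (\<integral>x. (\<integral>\<xi>. ?h \<xi> x \<partial>lborel) \<partial>lborel)" ..
    also have "\<dots> = (\<integral>x. f x * of_real (gauss_hat (c *\<^sub>R (x - y))) \<partial>lborel)"
    proof (rule Bochner_Integration.integral_cong[OF refl])
      fix x
      have "(\<integral>\<xi>. ?h \<xi> x \<partial>lborel) = (\<integral>\<xi>. f x * (of_real (gauss \<xi>) * expi (\<xi> \<bullet> (c *\<^sub>R (x - y)))) \<partial>lborel)"
        by (simp add: mult_ac)
      then show "(\<integral>\<xi>. ?h \<xi> x \<partial>lborel) = f x * of_real (gauss_hat (c *\<^sub>R (x - y)))"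
        by (simp only: Bochner_Integration.integral_mult_right_zero gauss_fourier)
    qed
    also have "\<dots> = \<bar>1 / c\<bar> ^ DIM('a) *\<^sub>R (\<integral>u. f (y + (1 / c) *\<^sub>R u)
        * of_real (gauss_hat (c *\<^sub>R (y + (1 / c) *\<^sub>R u - y))) \<partial>lborel)"
      using c by (intro lborel_integral_affine) auto
    finally show ?thesis
      using c by (simp add: c_def divide_inverse)
  qed
  have "(\<lambda>n. \<integral>u. f (y + u /\<^sub>R real (Suc n)) * of_real (gauss_hat u) \<partial>lborel)
      \<longlonglongrightarrow> (\<integral>u. f y * of_real (gauss_hat (u::'a)) \<partial>lborel)"
  proof (rule integral_dominated_convergence[where w = "\<lambda>u. B * gauss_hat u"])
    show "integrable lborel (\<lambda>u::'a. B * gauss_hat u)"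
      by (intro integrable_mult_right integrable_gauss_hat)
    show "AE u in lborel. norm (f (y + u /\<^sub>R real (Suc n)) * of_real (gauss_hat u)) \<le> B * gauss_hat u" for n
      by (auto simp: norm_mult abs_of_pos[OF gauss_hat_pos] less_imp_le[OF gauss_hat_pos]
          intro!: always_eventually mult_right_mono bdd)
    show "AE u in lborel. (\<lambda>n. f (y + u /\<^sub>R real (Suc n)) * of_real (gauss_hat u)) \<longlonglongrightarrow> f y * of_real (gauss_hat u)"
    proof (intro always_eventually allI tendsto_mult tendsto_const)
      fix u :: 'a
      have "(\<lambda>n. y + inverse (real (Suc n)) *\<^sub>R u) \<longlonglongrightarrow> y + 0 *\<^sub>R u"
        by (intro tendsto_intros LIMSEQ_inverse_real_of_nat)
      then show "(\<lambda>n. f (y + u /\<^sub>R real (Suc n))) \<longlonglongrightarrow> f y"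
        using cont by (intro continuous_on_tendsto_compose[of UNIV f]) auto
    qed
  qed auto
  \<comment> \<open>The averages all vanish, and they tend to \<open>f y\<close> times the mass of
    \<open>gauss_hat\<close>. Positivity of \<open>gauss_hat\<close> makes this mass
    nonzero.\<close>
  then have "(\<integral>u. f y * of_real (gauss_hat (u::'a)) \<partial>lborel) = 0"
    unfolding smoothed by (simp add: LIMSEQ_const_iff)
  then have "f y * of_real (\<integral>u. gauss_hat (u::'a) \<partial>lborel) = 0"
    by simp
  moreover have "(\<integral>u. gauss_hat (u::'a) \<partial>lborel) \<noteq> 0"
  proof
    assume "(\<integral>u. gauss_hat (u::'a) \<partial>lborel) = 0"
    then have "AE u::'a in lborel. gauss_hat u = 0"
      by (subst (asm) integral_nonneg_eq_0_iff_AE)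
         (auto simp: less_imp_le[OF gauss_hat_pos] integrable_gauss_hat)
    then have "AE u::'a in lborel. False"
      by eventually_elim (simp add: less_imp_neq[OF gauss_hat_pos, symmetric])
    then show False by (simp add: AE_iff_null null_sets_def)
  qed
  ultimately show ?thesis by simp
qed

lemma fourier_injective:
  fixes f g :: "'a::euclidean_space \<Rightarrow> complex"
  assumes "continuous_on UNIV f" "integrable lborel f" "\<And>x. cmod (f x) \<le> B"
    and "continuous_on UNIV g" "integrable lborel g" "\<And>x. cmod (g x) \<le> C"
    and "\<And>\<xi>. fourier f \<xi> = fourier g \<xi>"
  shows "f = g"
proof
  fix y
  have "(\<lambda>x. f x + (-1) * g x) y = 0"
  proof (rule fourier_injective_zero[where f = "\<lambda>x. f x + (-1) * g x" and B = "B + C"])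
    fix \<xi>
    have "fourier (\<lambda>x. f x + (-1) * g x) \<xi> = fourier f \<xi> + fourier (\<lambda>x. (-1) * g x) \<xi>"
      using assms by (intro fourier_add) auto
    also have "fourier (\<lambda>x. (-1) * g x) \<xi> = (-1) * fourier g \<xi>"
      using assms by (intro fourier_cmult) auto
    finally show "fourier (\<lambda>x. f x + (-1) * g x) \<xi> = 0" by (simp add: assms)
  qed (use assms in \<open>auto intro!: continuous_intros norm_triangle_le add_mono order_trans[OF norm_triangle_ineq4]\<close>)
  then show "f y = g y" by simp
qed

lemma fourier_injective_schwartz:
  assumes "f \<in> schwartz" "g \<in> schwartz" "\<And>\<xi>. fourier f \<xi> = fourier g \<xi>"
  shows "f = g"
proof -
  obtain B C where "\<And>x. cmod (f x) \<le> B" "\<And>x. cmod (g x) \<le> C"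
    using assms(1,2)[THEN schwartz_bounded] by metis
  then show ?thesis
    using assms by (intro fourier_injective) (auto intro: schwartz_continuous schwartz_integrable)
qed

section \<open>Convolution of an integrable function with a Schwartz function\<close>

definition conv_fun ::
  "('a::euclidean_space \<Rightarrow> complex) \<Rightarrow> ('a \<Rightarrow> complex) \<Rightarrow> 'a \<Rightarrow> complex" where
  "conv_fun f g x = (\<integral>y. f y * g (x - y) \<partial>lborel)"

context
  fixes f g :: "'a::euclidean_space \<Rightarrow> complex"
  assumes f: "integrable lborel f" and g: "g \<in> schwartz"
begin

private lemma fg_measurable [measurable]: "f \<in> borel_measurable borel" "g \<in> borel_measurable borel"
  using f g by auto

lemma convolution_integrand_integrable: "integrable lborel (\<lambda>y. f y * g (x - y))"
proof -
  obtain C where C: "\<And>x. cmod (g x) \<le> C" using schwartz_bounded[OF g] by blast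
  show ?thesis
    using integrable_mult_right[OF f, of "of_real C"]
    by (rule Bochner_Integration.integrable_bound)
       (auto simp: norm_mult mult.commute[of _ "cmod (f _)"]
         intro!: mult_left_mono order_trans[OF C] AE_I2)
qed

lemma convolution_bounded: "\<exists>B. \<forall>x. cmod (conv_fun f g x) \<le> B"
proof -
  obtain C where C: "C > 0" "\<And>x. cmod (g x) \<le> C" using schwartz_bounded[OF g] by blast
  have "cmod (conv_fun f g x) \<le> (\<integral>y. cmod (f y) * C \<partial>lborel)" for x
    unfolding conv_fun_def
    by (rule Bochner_Integration.integral_norm_bound_integral)
       (use convolution_integrand_integrable f C in \<open>auto simp: norm_mult intro!: mult_left_mono\<close>)
  then show ?thesis by blast
qed

lemma continuous_on_convolution: "continuous_on A (conv_fun f g)"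
proof -
  obtain C where C: "C > 0" "\<And>x. cmod (g x) \<le> C" using schwartz_bounded[OF g] by blast
  have "(\<lambda>n. conv_fun f g (\<eta> n)) \<longlonglongrightarrow> conv_fun f g \<xi>" if "\<eta> \<longlonglongrightarrow> \<xi>" for \<eta> \<xi>
    unfolding conv_fun_def
  proof (rule integral_dominated_convergence[where w = "\<lambda>x. cmod (f x) * C"])
    show "AE x in lborel. (\<lambda>n. f x * g (\<eta> n - x)) \<longlonglongrightarrow> f x * g (\<xi> - x)"
      using that schwartz_continuous[OF g, of UNIV]
      by (intro AE_I2 tendsto_intros continuous_on_tendsto_compose[of UNIV g]) auto
  qed (use f C in \<open>auto simp: norm_mult intro!: mult_left_mono\<close>)
  then show ?thesis by (simp add: continuous_on_sequentially o_def)
qed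

lemma convolution_measurable [measurable]: "conv_fun f g \<in> borel_measurable borel"
  by (intro borel_measurable_continuous_onI continuous_on_convolution)

text \<open>The character is included so that a single application of Fubini yields the convolution
  theorem; \<open>\<xi> = 0\<close> recovers integrability of the convolution.\<close>

lemma convolution_pair_integrable:
  "integrable (lborel \<Otimes>\<^sub>M lborel) (\<lambda>(y, x). f y * g (x - y) * expi (x \<bullet> \<xi>))"
proof (rule lborel_pair.Fubini_integrable)
  have shift: "(\<integral>x. cmod (g (x - y)) \<partial>lborel) = (\<integral>x. cmod (g x) \<partial>lborel)" for y
    by (subst (2) lborel_integral_affine[of _ 1 "- y"]) auto
  show "integrable lborel (\<lambda>y. \<integral>x. norm (case (y, x) of (y, x) \<Rightarrow> f y * g (x - y) * expi (x \<bullet> \<xi>)) \<partial>lborel)"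
    using f by (simp add: norm_mult shift)
  have "integrable lborel (\<lambda>x. g (x - y))" for y
    using lborel_integrable_affine_iff[of g 1 "- y"] schwartz_integrable[OF g] by simp
  then show "AE y in lborel. integrable lborel (\<lambda>x. case (y, x) of (y, x) \<Rightarrow> f y * g (x - y) * expi (x \<bullet> \<xi>))"
    by (auto intro!: integrable_expi)
qed measurable

lemma integrable_convolution: "integrable lborel (conv_fun f g)"
  using lborel_pair.integrable_snd[OF convolution_pair_integrable[of 0]]
  by (simp add: conv_fun_def[abs_def])

lemma fourier_convolution: "fourier (conv_fun f g) \<xi> = fourier f \<xi> * fourier g \<xi>"
proof -
  have "fourier (conv_fun f g) \<xi> = (\<integral>x. (\<integral>y. f y * g (x - y) * expi (x \<bullet> \<xi>) \<partial>lborel) \<partial>lborel)"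
    by (simp add: fourier_lborel conv_fun_def)
  also have "\<dots> = (\<integral>y. (\<integral>x. f y * g (x - y) * expi (x \<bullet> \<xi>) \<partial>lborel) \<partial>lborel)"
    by (rule lborel_pair.Fubini_integral[OF convolution_pair_integrable])
  also have "\<dots> = (\<integral>y. f y * expi (y \<bullet> \<xi>) * fourier g \<xi> \<partial>lborel)"
  proof (rule Bochner_Integration.integral_cong[OF refl])
    fix y
    have "(\<integral>x. f y * g (x - y) * expi (x \<bullet> \<xi>) \<partial>lborel) = f y * fourier (\<lambda>x. g (- y + 1 *\<^sub>R x)) \<xi>"
      by (simp add: fourier_lborel mult.assoc)
    also have "\<dots> = f y * (expi (y \<bullet> \<xi>) * fourier g \<xi>)"
      by (subst fourier_affine) auto
    finally show "(\<integral>x. f y * g (x - y) * expi (x \<bullet> \<xi>) \<partial>lborel) = f y * expi (y \<bullet> \<xi>) * fourier g \<xi>"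
      by simp
  qed
  also have "\<dots> = fourier f \<xi> * fourier g \<xi>"
    by (simp add: fourier_lborel)
  finally show ?thesis .
qed

end

section \<open>Test functions annihilated by polynomials\<close>

text \<open>All moments of these functions vanish. Vanishing of the transform on a neighbourhood of
  0, rather than to infinite order at 0, is a condition that derivatives preserve trivially.\<close>

definition schwartz_flat :: "('a::euclidean_space \<Rightarrow> complex) set" where
  "schwartz_flat = {f \<in> schwartz. \<exists>\<epsilon>>0. \<forall>\<xi>. norm \<xi> < \<epsilon> \<longrightarrow> fourier f \<xi> = 0}"

lemma schwartz_flat_sum:
  assumes "\<And>i. i \<in> I \<Longrightarrow> f i \<in> schwartz_flat"
  shows "(\<lambda>x. \<Sum>i\<in>I. c i * f i x) \<in> schwartz_flat"
  using assms
proof (induction I rule: infinite_finite_induct)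
  case (insert i I)
  have *: "f i \<in> schwartz_flat" "(\<lambda>x. \<Sum>i\<in>I. c i * f i x) \<in> schwartz_flat"
    using insert by auto
  then obtain d e where de: "d > 0" "e > 0" "\<And>\<xi>. norm \<xi> < d \<Longrightarrow> fourier (f i) \<xi> = 0"
    "\<And>\<xi>. norm \<xi> < e \<Longrightarrow> fourier (\<lambda>x. \<Sum>i\<in>I. c i * f i x) \<xi> = 0"
    unfolding schwartz_flat_def by blast
  have "fourier (\<lambda>x. \<Sum>i\<in>insert i I. c i * f i x) \<xi> = 0" if "norm \<xi> < min d e" for \<xi>
  proof -
    have "fourier (\<lambda>x. c i * f i x + (\<Sum>i\<in>I. c i * f i x)) \<xi>
        = fourier (\<lambda>x. c i * f i x) \<xi> + fourier (\<lambda>x. \<Sum>i\<in>I. c i * f i x) \<xi>"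
      using * by (intro fourier_add) (auto simp: schwartz_flat_def intro!: schwartz_integrable schwartz_cmult)
    also have "fourier (\<lambda>x. c i * f i x) \<xi> = c i * fourier (f i) \<xi>"
      using * by (intro fourier_cmult) (auto simp: schwartz_flat_def)
    finally show ?thesis using that de insert by simp
  qed
  moreover have "(\<lambda>x. \<Sum>i\<in>insert i I. c i * f i x) \<in> schwartz"
    by (rule schwartz_sum) (use insert in \<open>auto simp: schwartz_flat_def\<close>)
  ultimately show ?case
    using de unfolding schwartz_flat_def by (auto intro!: exI[of _ "min d e"])
next
  case empty
  then show ?case
    by (auto simp: schwartz_flat_def schwartz_zero fourier_lborel intro!: exI[of _ 1])
next
  case infinite
  then show ?case
    by (auto simp: schwartz_flat_def schwartz_zero fourier_lborel intro!: exI[of _ 1])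
qed

text \<open>Up to a constant, multiplication by a coordinate is differentiation of the Fourier
  transform, and the derivative of a function vanishing on an open ball vanishes on that
  ball.\<close>

lemma schwartz_flat_coord:
  assumes "f \<in> schwartz_flat"
  shows "(\<lambda>x. of_real (x \<bullet> b) * f x) \<in> schwartz_flat"
proof -
  obtain e where f: "f \<in> schwartz" and e: "e > 0" "\<And>\<xi>. norm \<xi> < e \<Longrightarrow> fourier f \<xi> = 0"
    using assms unfolding schwartz_flat_def by blast
  have "fourier (\<lambda>x. of_real (x \<bullet> b) * f x) \<xi> = 0" if "norm \<xi> < e" for \<xi>
  proof -
    have "partial_deriv b (fourier f) \<xi> = 0"
      by (rule partial_deriv_zero_open[of "{\<xi>. norm \<xi> < e}"])
         (use that e in \<open>auto intro!: open_Collect_less continuous_intros\<close>)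
    then show ?thesis
      using f by (subst (asm) partial_deriv_fourier[OF f], subst (asm) fourier_cmult)
        (auto intro: schwartz_measurable schwartz_coord)
  qed
  then show ?thesis
    using e f by (auto simp: schwartz_flat_def schwartz_coord)
qed

text \<open>Here \<open>f\<close> must stay arbitrary in the induction: for a product
  \<open>P * Q\<close> the hypothesis for \<open>P\<close> is applied to
  \<open>Q * f\<close>.\<close>

lemma schwartz_flat_polynomial:
  assumes "real_polynomial_function P"
  shows "f \<in> schwartz_flat \<Longrightarrow> (\<lambda>x. of_real (P x) * f x) \<in> schwartz_flat"
  using assms
proof (induction P arbitrary: f rule: real_polynomial_function.induct)
  case (linear P)
  note flat = linear.prems
  interpret bounded_linear P by fact
  have P: "P x = (\<Sum>b\<in>Basis. P b * (x \<bullet> b))" for x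
  proof -
    have "P x = P (\<Sum>b\<in>Basis. (x \<bullet> b) *\<^sub>R b)"
      by (simp only: euclidean_representation)
    then show ?thesis by (simp add: sum scaleR mult.commute)
  qed
  have "(\<lambda>x. of_real (P x) * f x) = (\<lambda>x. \<Sum>b\<in>Basis. of_real (P b) * (of_real (x \<bullet> b) * f x))"
    by (rule ext, subst P) (simp add: sum_distrib_right mult.assoc)
  then show ?case
    using flat by (auto intro!: schwartz_flat_sum schwartz_flat_coord)
next
  case (const c)
  then show ?case using schwartz_flat_sum[of "{()}" "\<lambda>_. f" "\<lambda>_. of_real c"] by simp
next
  case (add P Q)
  have "(\<lambda>x. of_real ((if b then P else Q) x) * f x) \<in> schwartz_flat" for b
    using add by (cases b) auto
  then show ?case
    using schwartz_flat_sum[of UNIV "\<lambda>b x. of_real ((if b then P else Q) x) * f x" "\<lambda>_. 1"]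
    by (simp add: UNIV_bool ring_distribs add.commute)
next
  case (mult P Q)
  then show ?case using mult.IH(1)[OF mult.IH(2)] by (simp add: mult.assoc)
qed

text \<open>The integral is the value at 0 of the Fourier transform of \<open>P * f\<close>, which
  is again flat. This is what makes the Triebel-Lizorkin norm depend only on the class modulo
  polynomials.\<close>

lemma integral_polynomial_schwartz_flat:
  fixes P :: "'a::euclidean_space \<Rightarrow> complex"
  assumes "polynomial_function P" "f \<in> schwartz_flat"
  shows "(LINT x|lebesgue. P x * f x) = 0"
proof -
  have *: "real_polynomial_function (\<lambda>x. Re (P x))" "real_polynomial_function (\<lambda>x. Im (P x))"
    using assms(1) bounded_linear_Re bounded_linear_Im unfolding polynomial_function_def by (auto simp: o_def)
  have flat: "(\<lambda>x. 1 * (of_real (Re (P x)) * f x) + \<i> * (of_real (Im (P x)) * f x)) \<in> schwartz_flat"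
  proof -
    have "(\<lambda>x. of_real (if b then Re (P x) else Im (P x)) * f x) \<in> schwartz_flat" for b
      using *[THEN schwartz_flat_polynomial[OF _ assms(2)]] by (cases b) auto
    then show ?thesis
      using schwartz_flat_sum[of UNIV "\<lambda>b x. of_real (if b then Re (P x) else Im (P x)) * f x"
          "\<lambda>b. if b then 1 else \<i>"]
      by (simp add: UNIV_bool add.commute)
  qed
  have "(\<lambda>x. 1 * (of_real (Re (P x)) * f x) + \<i> * (of_real (Im (P x)) * f x)) = (\<lambda>x. P x * f x)"
  proof
    fix x
    show "1 * (of_real (Re (P x)) * f x) + \<i> * (of_real (Im (P x)) * f x) = P x * f x"
      by (simp add: complex_eq_iff)
  qed
  with flat have "(\<lambda>x. P x * f x) \<in> schwartz_flat" by simp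
  then obtain e where "e > 0" "\<And>\<xi>. norm \<xi> < e \<Longrightarrow> fourier (\<lambda>x. P x * f x) \<xi> = 0"
    unfolding schwartz_flat_def by blast
  from this(2)[of 0] this(1) show ?thesis by (simp add: fourier_def)
qed

section \<open>Littlewood-Paley pieces\<close>

locale littlewood_paley =
  fixes \<phi> :: "'a::euclidean_space \<Rightarrow> complex"
  assumes generator: "lp_generator \<phi>"
begin

lemma phi_schwartz: "\<phi> \<in> schwartz"
  using generator by (simp add: lp_generator_def)

lemma fourier_phi_le: "norm \<xi> \<le> 1 \<Longrightarrow> fourier \<phi> \<xi> = 1"
  and fourier_phi_ge: "norm \<xi> \<ge> 2 \<Longrightarrow> fourier \<phi> \<xi> = 0"
  using generator by (auto simp: lp_generator_def)

text \<open>Normalised in the integral norm, so that the Fourier transform is merely rescaled and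
  all pieces have the same integral norm.\<close>

definition dilate :: "real \<Rightarrow> ('a \<Rightarrow> complex) \<Rightarrow> 'a \<Rightarrow> complex" where
  "dilate c f x = of_real (c ^ DIM('a)) * f (c *\<^sub>R x)"

lemma dilate_schwartz: "f \<in> schwartz \<Longrightarrow> c > 0 \<Longrightarrow> dilate c f \<in> schwartz"
  using schwartz_affine[of f c "of_real (c ^ DIM('a))" 0] by (simp add: dilate_def[abs_def])

lemma fourier_dilate:
  assumes [measurable]: "f \<in> borel_measurable borel" and c: "c > 0"
  shows "fourier (dilate c f) \<xi> = fourier f (\<xi> /\<^sub>R c)"
proof -
  have "fourier (dilate c f) \<xi> = of_real (c ^ DIM('a)) * fourier (\<lambda>x. f (0 + c *\<^sub>R x)) \<xi>"
    unfolding dilate_def[abs_def] by (subst fourier_cmult) simp_all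
  also have "fourier (\<lambda>x. f (0 + c *\<^sub>R x)) \<xi> = fourier f (\<xi> /\<^sub>R c) / of_real (c ^ DIM('a))"
    using c by (subst fourier_affine) auto
  finally show ?thesis using c by simp
qed

text \<open>Turns the definite descriptions in \<open>lp_base\<close> and \<open>lp_piece\<close>
  into equations once a Schwartz function with the prescribed transform is at hand.\<close>

lemma schwartz_the_eqI:
  assumes "\<psi> \<in> schwartz" "\<And>\<xi>. fourier \<psi> \<xi> = F \<xi>"
  shows "(THE \<psi>. \<psi> \<in> schwartz \<and> (\<forall>\<xi>. fourier \<psi> \<xi> = F \<xi>)) = \<psi>"
  by (rule the_equality) (use assms in \<open>auto intro: fourier_injective_schwartz\<close>)

lemma lp_base_schwartz: "lp_base \<phi> \<in> schwartz"
  and fourier_lp_base: "fourier (lp_base \<phi>) \<xi> = fourier \<phi> (\<xi> /\<^sub>R 2) - fourier \<phi> \<xi>"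
proof -
  let ?\<psi> = "\<lambda>x. 1 * dilate 2 \<phi> x + (-1) * \<phi> x"
  have S: "?\<psi> \<in> schwartz"
    by (intro schwartz_lincomb dilate_schwartz phi_schwartz) simp
  have F: "fourier ?\<psi> \<xi> = fourier \<phi> (\<xi> /\<^sub>R 2) - fourier \<phi> \<xi>" for \<xi>
  proof -
    have "fourier ?\<psi> \<xi> = fourier (\<lambda>x. 1 * dilate 2 \<phi> x) \<xi> + fourier (\<lambda>x. (-1) * \<phi> x) \<xi>"
      by (intro fourier_add schwartz_integrable schwartz_cmult dilate_schwartz phi_schwartz) simp
    also have "\<dots> = 1 * fourier (dilate 2 \<phi>) \<xi> + (-1) * fourier \<phi> \<xi>"
      by (simp only: fourier_cmult schwartz_measurable dilate_schwartz phi_schwartz zero_less_numeral)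
    finally show ?thesis
      by (simp add: fourier_dilate schwartz_measurable phi_schwartz)
  qed
  have "lp_base \<phi> = ?\<psi>"
    unfolding lp_base_def by (rule schwartz_the_eqI[OF S F])
  with S F show "lp_base \<phi> \<in> schwartz" "fourier (lp_base \<phi>) \<xi> = fourier \<phi> (\<xi> /\<^sub>R 2) - fourier \<phi> \<xi>"
    by auto
qed

text \<open>The multiplier of the block of index 0: nonnegative, radial and supported in
  \<open>1 \<le> norm \<xi> \<le> 4\<close>. On the sphere \<open>norm \<xi> = 2\<close> both
  defining values of \<open>fourier \<phi>\<close> are prescribed, whence \<open>chi = 1\<close>
  there; the nonvanishing arguments below start from this sphere.\<close>

definition chi :: "'a \<Rightarrow> real" where
  "chi \<xi> = Re (fourier (lp_base \<phi>) \<xi>)"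

lemma fourier_lp_base_chi: "fourier (lp_base \<phi>) \<xi> = of_real (chi \<xi>)"
proof -
  have "fourier (lp_base \<phi>) \<xi> \<in> \<real>"
    using generator by (auto simp: fourier_lp_base lp_generator_def)
  then show ?thesis by (simp add: chi_def of_real_Re)
qed

lemma chi_nonneg: "chi \<xi> \<ge> 0"
proof -
  have "Re (fourier \<phi> \<xi>) \<le> Re (fourier \<phi> (\<xi> /\<^sub>R 2))"
    using generator unfolding lp_generator_def by auto
  then show ?thesis by (simp add: chi_def fourier_lp_base)
qed

lemma chi_cong:
  assumes "norm \<xi> = norm \<eta>" shows "chi \<xi> = chi \<eta>"
proof -
  have "Re (fourier \<phi> \<xi>) = Re (fourier \<phi> \<eta>)" if "norm \<xi> = norm \<eta>" for \<xi> \<eta>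
    using generator that unfolding lp_generator_def by (simp add: antisym)
  from this[OF assms] this[of "\<xi> /\<^sub>R 2" "\<eta> /\<^sub>R 2"] assms show ?thesis
    by (simp add: chi_def fourier_lp_base)
qed

lemma chi_eq_0: "norm \<xi> \<le> 1 \<or> norm \<xi> \<ge> 4 \<Longrightarrow> chi \<xi> = 0"
  by (auto simp: chi_def fourier_lp_base fourier_phi_le fourier_phi_ge)

lemma chi_eq_1: "norm \<xi> = 2 \<Longrightarrow> chi \<xi> = 1"
  by (simp add: chi_def fourier_lp_base fourier_phi_le fourier_phi_ge)

lemma continuous_on_chi: "continuous_on A chi"
  unfolding chi_def[abs_def]
  by (intro continuous_intros continuous_on_fourier schwartz_integrable lp_base_schwartz)

lemma chi_measurable [measurable]: "chi \<in> borel_measurable borel"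
  by (intro borel_measurable_continuous_onI continuous_on_chi)

lemma fourier_lp_base_schwartz: "fourier (lp_base \<phi>) \<in> schwartz"
  by (rule fourier_in_schwartz[where R = 4])
     (simp_all add: lp_base_schwartz fourier_lp_base_chi chi_eq_0)

lemma integrable_chi: "integrable lborel chi"
  unfolding chi_def[abs_def] by (intro integrable_Re schwartz_integrable fourier_lp_base_schwartz)

text \<open>As \<open>chi\<close> is nonnegative, a zero integral would bound its Fourier transform
  by 0, and uniqueness would force \<open>chi = 0\<close>, against its value on the sphere of radius
  2.\<close>

lemma integral_chi_pos: "(\<integral>x. chi x \<partial>lborel) > 0"
proof -
  obtain e :: 'a where e: "norm e = 1" using norm_Basis nonempty_Basis by blast
  have "(\<integral>x. chi x \<partial>lborel) \<noteq> 0"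
  proof
    assume "(\<integral>x. chi x \<partial>lborel) = 0"
    then have "(\<integral>x. cmod (fourier (lp_base \<phi>) x) \<partial>lborel) = 0"
      by (simp add: fourier_lp_base_chi chi_nonneg)
    then have z: "fourier (fourier (lp_base \<phi>)) \<xi> = 0" for \<xi>
      using fourier_bound[OF schwartz_measurable[OF fourier_lp_base_schwartz], of \<xi>] by simp
    obtain B where B: "B > 0" "\<And>x. cmod (fourier (lp_base \<phi>) x) \<le> B"
      using schwartz_bounded[OF fourier_lp_base_schwartz] by blast
    have "fourier (lp_base \<phi>) (2 *\<^sub>R e) = 0"
      by (rule fourier_injective_zero[OF _ _ B(2) z])
         (simp_all add: schwartz_continuous schwartz_integrable fourier_lp_base_schwartz)
    with chi_eq_1[of "2 *\<^sub>R e"] e show False by (simp add: fourier_lp_base_chi)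
  qed
  moreover have "(\<integral>x. chi x \<partial>lborel) \<ge> 0" by (simp add: chi_nonneg)
  ultimately show ?thesis by simp
qed

lemma lp_piece_eq: "lp_piece \<phi> k = dilate (2 powi k) (lp_base \<phi>)"
  unfolding lp_piece_def
proof (rule schwartz_the_eqI)
  show "dilate (2 powi k) (lp_base \<phi>) \<in> schwartz"
    by (intro dilate_schwartz lp_base_schwartz) simp
  show "fourier (dilate (2 powi k) (lp_base \<phi>)) \<xi> = fourier (lp_base \<phi>) ((2 powi (- k)) *\<^sub>R \<xi>)" for \<xi>
    by (subst fourier_dilate) (simp_all add: lp_base_schwartz schwartz_measurable power_int_minus)
qed

abbreviation block :: "int \<Rightarrow> (('a \<Rightarrow> complex) \<Rightarrow> complex) \<Rightarrow> 'a \<Rightarrow> complex" (\<open>\<Delta>\<close>) where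
  "\<Delta> k \<equiv> conv_dist (lp_piece \<phi> k)"

lemma lp_piece_schwartz: "lp_piece \<phi> k \<in> schwartz"
  unfolding lp_piece_eq by (intro dilate_schwartz lp_base_schwartz) simp

lemma fourier_lp_piece: "fourier (lp_piece \<phi> k) \<xi> = of_real (chi ((2 powi (- k)) *\<^sub>R \<xi>))"
  unfolding lp_piece_eq
  by (subst fourier_dilate) (simp_all add: lp_base_schwartz schwartz_measurable power_int_minus fourier_lp_base_chi)

text \<open>The functions against which a distribution is tested to form a block thus annihilate
  polynomials.\<close>

lemma lp_piece_reflect_flat: "(\<lambda>y. lp_piece \<phi> k (x - y)) \<in> schwartz_flat"
proof -
  have "fourier (\<lambda>y. lp_piece \<phi> k (x + (-1) *\<^sub>R y)) \<xi> = 0" if "norm \<xi> < 2 powi k" for \<xi>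
  proof (subst fourier_affine)
    have "norm ((2 powi (- k)) *\<^sub>R (\<xi> /\<^sub>R - 1)) \<le> 1"
      using that by (simp add: power_int_minus field_simps)
    then have "fourier (lp_piece \<phi> k) (\<xi> /\<^sub>R - 1) = 0"
      unfolding fourier_lp_piece using chi_eq_0 by (metis of_real_0)
    then show "expi (- (x \<bullet> \<xi>) / - 1) * (fourier (lp_piece \<phi> k) (\<xi> /\<^sub>R - 1) / of_real (\<bar>- 1\<bar> ^ DIM('a))) = 0"
      by simp
  qed (auto intro: schwartz_measurable lp_piece_schwartz)
  then show ?thesis
    using schwartz_reflect[OF lp_piece_schwartz[of k], of x]
    by (auto simp: schwartz_flat_def intro!: exI[of _ "2 powi k"])
qed

text \<open>The Fourier transform moves to the reflected, translated piece, where it becomes the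
  dilated multiplier times a character in \<open>x\<close>. Evenness of \<open>chi\<close> removes
  the reflection.\<close>

lemma conv_dist_fourier:
  assumes [measurable]: "f \<in> borel_measurable borel"
  shows "\<Delta> k (fourier_dist (dist_of_fun f)) x
       = fourier (\<lambda>t. f t * of_real (chi ((2 powi (- k)) *\<^sub>R t))) x"
proof -
  let ?\<psi> = "\<lambda>y. lp_piece \<phi> k (x + (-1) *\<^sub>R y)"
  have S: "?\<psi> \<in> schwartz"
    using schwartz_reflect[OF lp_piece_schwartz[of k], of x] by simp
  have F: "fourier ?\<psi> t = of_real (chi ((2 powi (- k)) *\<^sub>R t)) * expi (t \<bullet> x)" for t
  proof -
    have "chi ((2 powi (- k)) *\<^sub>R (t /\<^sub>R - 1)) = chi ((2 powi (- k)) *\<^sub>R t)"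
      by (intro chi_cong) simp
    then show ?thesis
      by (subst fourier_affine)
         (auto simp: fourier_lp_piece inner_commute intro: schwartz_measurable lp_piece_schwartz)
  qed
  \<comment> \<open>Since \<open>dist_of_fun\<close> is 0 off \<open>schwartz\<close>, the integral
    formula is available only after this membership is known; the compact support of
    \<open>chi\<close> supplies it.\<close>
  have "fourier ?\<psi> \<in> schwartz"
  proof (rule fourier_in_schwartz[OF S, where R = "4 * 2 powi k"])
    fix \<xi> :: 'a assume "norm \<xi> > 4 * 2 powi k"
    then have "norm ((2 powi (- k)) *\<^sub>R \<xi>) \<ge> 4" by (simp add: power_int_minus field_simps)
    then show "fourier ?\<psi> \<xi> = 0" using F chi_eq_0 by (metis mult_zero_left of_real_0)
  qed
  then have "\<Delta> k (fourier_dist (dist_of_fun f)) x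
      = (LINT t|lebesgue. f t * (of_real (chi ((2 powi (- k)) *\<^sub>R t)) * expi (t \<bullet> x)))"
    using S F by (simp add: conv_dist_def fourier_dist_def dist_of_fun_def)
  then show ?thesis
    by (simp add: fourier_def expi_def mult.assoc)
qed

end

section \<open>Lower bounds on dyadic sets\<close>

lemma two_powi: "(2::real) powi k = 2 powr real_of_int k"
  by (simp add: powr_real_of_int')

lemma epowr_ennreal: "t \<ge> 0 \<Longrightarrow> epowr (ennreal t) a = ennreal (t powr a)"
  by (simp add: epowr_def)

lemma epowr_mono:
  assumes "a > 0" "x \<le> y" shows "epowr x a \<le> epowr y a"
proof (cases y)
  case (real t)
  with assms(2) obtain s where "x = ennreal s" "0 \<le> s" "s \<le> t"
    by (metis ennreal_enn2real_if ennreal_le_iff enn2real_nonneg top.extremum_unique ennreal_neq_top)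
  with real assms(1) show ?thesis by (auto simp: epowr_ennreal intro!: ennreal_leI powr_mono2)
qed (simp add: epowr_def)

lemma epowr_eq_top_iff: "epowr x a = \<infinity> \<longleftrightarrow> x = \<infinity>"
  by (simp add: epowr_def)

lemma epowr_lower_bound:
  assumes "ennreal (a powr q) \<le> S" "a \<ge> 0" "q > 0" "r > 0"
  shows "ennreal (a powr r) \<le> epowr (epowr S (1 / q)) r"
proof -
  have "epowr (epowr (ennreal (a powr q)) (1 / q)) r \<le> epowr (epowr S (1 / q)) r"
    using assms by (intro epowr_mono) auto
  then show ?thesis
    using assms by (simp add: epowr_ennreal powr_powr)
qed

lemma infsum_ennreal_ge: "(f k :: ennreal) \<le> (\<Sum>\<^sub>\<infinity>k\<in>UNIV. f k)"
proof -
  have "sum f {k} \<le> (\<Sum>\<^sub>\<infinity>k\<in>UNIV. f k)"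
    by (subst nonneg_infsum_complete) (auto intro!: SUP_upper2[of "{k}"])
  then show ?thesis by simp
qed

context littlewood_paley
begin

text \<open>Says that \<open>TL_norm\<close> controls the l^r norm of the amplitudes
  \<open>b\<close> whenever the weighted blocks in \<open>I\<close> are L^r-normalised dilates of
  one profile \<open>g\<close>. The constant \<open>c\<close> is fixed before \<open>u\<close>,
  \<open>q\<close>, \<open>s\<close>, \<open>I\<close> and \<open>b\<close>, as the test arguments
  let all of these, or the number of blocks, vary.\<close>

definition dyadic_lower_bound :: "('a \<Rightarrow> complex) \<Rightarrow> real \<Rightarrow> real \<Rightarrow> bool" where
  "dyadic_lower_bound g r c \<longleftrightarrow> (\<forall>u B q s I b. finite I \<longrightarrow> q > 0 \<longrightarrow> B \<ge> 0 \<longrightarrow> (\<forall>k\<in>I. b k \<ge> 0) \<longrightarrow>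
     (\<forall>k\<in>I. \<forall>x. cmod (of_real (2 powr (k * s)) * \<Delta> k u x)
           = b k * 2 powr (k * real DIM('a) / r) * cmod (g ((2 powi k) *\<^sub>R x))) \<longrightarrow>
     TL_norm \<phi> r q s u \<le> ennreal B \<longrightarrow> c * (\<Sum>k\<in>I. b k powr r) \<le> B powr r)"

lemma dyadic_lower_boundD:
  assumes "dyadic_lower_bound g r c" "finite I" "q > 0" "B \<ge> 0" "\<And>k. k \<in> I \<Longrightarrow> b k \<ge> 0"
    and "\<And>k x. k \<in> I \<Longrightarrow>
         cmod (of_real (2 powr (k * s)) * \<Delta> k u x)
           = b k * 2 powr (k * real DIM('a) / r) * cmod (g ((2 powi k) *\<^sub>R x))"
    and "TL_norm \<phi> r q s u \<le> ennreal B"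
  shows "c * (\<Sum>k\<in>I. b k powr r) \<le> B powr r"
  using assms unfolding dyadic_lower_bound_def by blast

text \<open>Near a suitable point \<open>x0\<close> the profile is bounded below; the preimages
  \<open>A k\<close> of a small ball there under the dilations are pairwise disjoint. Keeping only
  the block \<open>k\<close> on \<open>A k\<close> gives contributions that add up, each of size
  \<open>b k powr r\<close> times a constant.\<close>

lemma TL_norm_lower_dyadic:
  assumes g: "continuous_on UNIV g" and x1: "g x1 \<noteq> 0" and r: "r > 0"
  shows "\<exists>c>0. dyadic_lower_bound g r c"
proof -
  have m [measurable]: "g \<in> borel_measurable borel"
    using g by (rule borel_measurable_continuous_onI)
  \<comment> \<open>Around the origin the preimages would overlap, so a nonzero point is needed;
    continuity rules out that \<open>g\<close> vanishes everywhere else.\<close>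
  have "\<exists>x0. x0 \<noteq> 0 \<and> g x0 \<noteq> 0"
  proof (rule ccontr)
    assume "\<not> ?thesis"
    then have z: "g x = 0" if "x \<noteq> 0" for x using that by blast
    have "(g \<longlongrightarrow> g 0) (at 0)" using g by (simp add: continuous_on_def)
    moreover have "(g \<longlongrightarrow> 0) (at 0)"
      by (rule tendsto_eventually) (use z in \<open>auto simp: eventually_at_filter\<close>)
    ultimately have "g 0 = 0" using tendsto_unique trivial_limit_at by blast
    with z x1 show False by metis
  qed
  then obtain x0 where x0: "x0 \<noteq> 0" "g x0 \<noteq> 0" by blast
  define \<delta> where "\<delta> = cmod (g x0) / 2"
  have \<delta>: "\<delta> > 0" using x0 by (simp add: \<delta>_def)
  obtain e' where e': "e' > 0" "\<And>x. dist x x0 < e' \<Longrightarrow> dist (g x) (g x0) < \<delta>"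
    using g \<delta> unfolding continuous_on_iff by (metis UNIV_I)
  \<comment> \<open>With radius at most a third of \<open>norm x0\<close>, the norms in the ball lie
    strictly between 2/3 and 4/3 of \<open>norm x0\<close>. The ratio is 2, exactly the step between
    consecutive scales.\<close>
  define \<epsilon> where "\<epsilon> = min e' (norm x0 / 3)"
  have \<epsilon>: "\<epsilon> > 0" "\<epsilon> \<le> norm x0 / 3" using e' x0 by (auto simp: \<epsilon>_def)
  have lower: "\<delta> \<le> cmod (g y)" if "y \<in> ball x0 \<epsilon>" for y
  proof -
    have "dist (g y) (g x0) < \<delta>" using that e'(2)[of y] by (simp add: \<epsilon>_def dist_commute)
    moreover have "cmod (g x0) \<le> cmod (g y) + dist (g y) (g x0)"
      by (metis dist_norm norm_minus_commute norm_triangle_sub)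
    ultimately show ?thesis unfolding \<delta>_def by linarith
  qed
  define V where "V = measure lborel (ball x0 \<epsilon>)"
  have V: "V > 0" "emeasure lborel (ball x0 \<epsilon>) = ennreal V"
    using \<epsilon> content_ball_pos[of \<epsilon> x0] emeasure_lborel_ball_finite[of x0 \<epsilon>]
    by (auto simp: V_def emeasure_eq_ennreal_measure less_top)
  define A where "A k = {x. (2 powi k) *\<^sub>R x \<in> ball x0 \<epsilon>}" for k
  have A_norm: "2 / 3 * norm x0 < 2 powi k * norm x \<and> 2 powi k * norm x < 4 / 3 * norm x0"
    if "x \<in> A k" for x k
  proof -
    have "norm ((2 powi k) *\<^sub>R x) = 2 powi k * norm x" by simp
    moreover have "norm (x0 - (2 powi k) *\<^sub>R x) < norm x0 / 3"
      using that \<epsilon> by (simp add: A_def dist_norm)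
    ultimately show ?thesis
      using norm_triangle_ineq2[of x0 "(2 powi k) *\<^sub>R x"] norm_triangle_ineq2[of "(2 powi k) *\<^sub>R x" x0]
      by (simp add: norm_minus_commute)
  qed
  have A_lt: False if "x \<in> A k" "x \<in> A l" "k < l" for x k l
  proof -
    have "2 * 2 powi k \<le> (2::real) powi l"
    proof -
      have "2 powi (k + 1) \<le> (2::real) powi l"
        using that by (intro power_int_increasing) auto
      then show ?thesis by (simp add: power_int_add)
    qed
    then have "2 * 2 powi k * norm x \<le> 2 powi l * norm x"
      by (intro mult_right_mono) auto
    with A_norm[OF that(1)] A_norm[OF that(2)] show False by simp
  qed
  have A_disj: "k = l" if "x \<in> A k" "x \<in> A l" for x k l
    using A_lt that by (metis linorder_neqE)
  have [measurable]: "A k \<in> sets borel" for k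
    unfolding A_def mem_ball by measurable
  have "dyadic_lower_bound g r (\<delta> powr r * V)"
    unfolding dyadic_lower_bound_def
  proof (intro allI impI)
    fix u B q s I and b :: "int \<Rightarrow> real"
    assume I: "finite I" and q: "q > 0" and B: "B \<ge> 0" and "\<forall>k\<in>I. b k \<ge> 0"
      and "\<forall>k\<in>I. \<forall>x. cmod (of_real (2 powr (k * s)) * \<Delta> k u x)
           = b k * 2 powr (k * real DIM('a) / r) * cmod (g ((2 powi k) *\<^sub>R x))"
      and TL: "TL_norm \<phi> r q s u \<le> ennreal B"
    then have b: "b k \<ge> 0" and eq: "cmod (of_real (2 powr (k * s)) * \<Delta> k u x)
           = b k * 2 powr (k * real DIM('a) / r) * cmod (g ((2 powi k) *\<^sub>R x))"
      if "k \<in> I" for k x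
      using that by blast+
    define a where "a k x = cmod (of_real (2 powr (k * s)) * \<Delta> k u x)" for k x
    define F where "F x = epowr (epowr (\<Sum>\<^sub>\<infinity>k\<in>UNIV. ennreal (a k x powr q)) (1 / q)) r" for x
    define N where "N = (\<integral>\<^sup>+x. F x \<partial>lborel)"
    have "epowr N (1 / r) \<le> ennreal B"
      using TL unfolding TL_norm_def N_def F_def a_def by (simp add: nn_integral_completion)
    then have N: "N \<le> ennreal (B powr r)"
    proof -
      assume *: "epowr N (1 / r) \<le> ennreal B"
      then have "N \<noteq> \<infinity>" by (auto simp: epowr_def top_unique)
      then obtain n where n: "N = ennreal n" "n \<ge> 0" by (cases N) auto
      with * B have "n powr (1 / r) \<le> B" by (simp add: epowr_ennreal)
      then have "(n powr (1 / r)) powr r \<le> B powr r" using r by (intro powr_mono2) auto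
      with n r show ?thesis by (simp add: powr_powr)
    qed
    \<comment> \<open>Disjointness leaves at most one nonzero summand at \<open>x\<close>, and a
      single term is a lower bound for the inner sum whatever \<open>q\<close> is.\<close>
    have point: "(\<Sum>k\<in>I. indicator (A k) x * ennreal (a k x powr r)) \<le> F x" for x
    proof (cases "\<exists>k\<in>I. x \<in> A k")
      case True
      then obtain k where k: "k \<in> I" "x \<in> A k" by blast
      have "(\<Sum>k\<in>I. indicator (A k) x * ennreal (a k x powr r))
          = (\<Sum>l\<in>{k}. indicator (A l) x * ennreal (a l x powr r))"
        by (rule sum.mono_neutral_right) (use k I A_disj in \<open>auto split: split_indicator\<close>)
      also have "\<dots> \<le> F x"
        unfolding F_def using k q r
        by (simp, intro epowr_lower_bound infsum_ennreal_ge[of "\<lambda>k. ennreal (a k x powr q)"])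
           (auto simp: a_def)
      finally show ?thesis .
    next
      case False
      then show ?thesis by (simp add: sum.neutral)
    qed
    have piece: "ennreal (b k powr r * (\<delta> powr r * V)) \<le> (\<integral>\<^sup>+x. indicator (A k) x * ennreal (a k x powr r) \<partial>lborel)"
      if k: "k \<in> I" for k
    proof -
      let ?H = "\<lambda>y. indicator (ball x0 \<epsilon>) y * ennreal (b k powr r * cmod (g y) powr r)"
      have "ennreal (b k powr r * (\<delta> powr r * V)) = (\<integral>\<^sup>+y. indicator (ball x0 \<epsilon>) y * ennreal (b k powr r * \<delta> powr r) \<partial>lborel)"
        using V by (subst nn_integral_multc) (auto simp: ennreal_mult'[symmetric] mult_ac intro!: borel_measurable_indicator)
      also have "\<dots> \<le> (\<integral>\<^sup>+y. ?H y \<partial>lborel)"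
        using \<delta> r lower by (intro nn_integral_mono)
          (auto split: split_indicator intro!: ennreal_leI mult_left_mono powr_mono2)
      also have "\<dots> = ennreal (\<bar>2 powi k\<bar> ^ DIM('a)) * (\<integral>\<^sup>+x. ?H (0 + (2 powi k) *\<^sub>R x) \<partial>lborel)"
      proof (rule nn_integral_lborel_affine)
        have [measurable]: "ball x0 \<epsilon> \<in> sets borel" by simp
        show "?H \<in> borel_measurable borel" by measurable
      qed simp
      also have "\<dots> = (\<integral>\<^sup>+x. ennreal (\<bar>2 powi k\<bar> ^ DIM('a)) * ?H (0 + (2 powi k) *\<^sub>R x) \<partial>lborel)"
      proof (rule nn_integral_cmult[symmetric])
        have [measurable]: "ball x0 \<epsilon> \<in> sets borel" by simp
        show "(\<lambda>x. ?H (0 + (2 powi k) *\<^sub>R x)) \<in> borel_measurable lborel" by measurable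
      qed
      also have "\<dots> = (\<integral>\<^sup>+x. indicator (A k) x * ennreal (a k x powr r) \<partial>lborel)"
      proof (rule nn_integral_cong)
        fix x
        \<comment> \<open>The \<open>r\<close>-th power of the weight
          \<open>2 powr (k * DIM('a) / r)\<close> is precisely the Jacobian of the dilation.\<close>
        have "a k x powr r = b k powr r * (2 powi k) ^ DIM('a) * cmod (g ((2 powi k) *\<^sub>R x)) powr r"
          unfolding a_def eq[OF k] using b[OF k] r
          by (simp add: powr_mult powr_powr two_powi powr_realpow[symmetric])
        then show "ennreal (\<bar>2 powi k\<bar> ^ DIM('a)) * ?H (0 + (2 powi k) *\<^sub>R x)
            = indicator (A k) x * ennreal (a k x powr r)"
          by (simp add: A_def indicator_def ennreal_mult'[symmetric] mult_ac)
      qed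
      finally show ?thesis .
    qed
    have "ennreal (\<delta> powr r * V * (\<Sum>k\<in>I. b k powr r)) = (\<Sum>k\<in>I. ennreal (b k powr r * (\<delta> powr r * V)))"
      using V by (subst sum_ennreal) (auto simp: sum_distrib_left mult_ac)
    also have "\<dots> \<le> (\<Sum>k\<in>I. \<integral>\<^sup>+x. indicator (A k) x * ennreal (a k x powr r) \<partial>lborel)"
      by (intro sum_mono piece)
    also have "\<dots> = (\<integral>\<^sup>+x. (\<Sum>k\<in>I. indicator (A k) x * ennreal (a k x powr r)) \<partial>lborel)"
    proof (rule nn_integral_sum[symmetric])
      fix k assume k: "k \<in> I"
      have "a k = (\<lambda>x. b k * 2 powr (k * real DIM('a) / r) * cmod (g ((2 powi k) *\<^sub>R x)))"
        unfolding a_def eq[OF k] ..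
      then have [measurable]: "a k \<in> borel_measurable borel" by simp
      show "(\<lambda>x. indicator (A k) x * ennreal (a k x powr r)) \<in> borel_measurable lborel"
        by measurable
    qed
    also have "\<dots> \<le> N"
      unfolding N_def by (intro nn_integral_mono point)
    also note N
    finally show "\<delta> powr r * V * (\<Sum>k\<in>I. b k powr r) \<le> B powr r"
      by (simp add: ennreal_le_iff)
  qed
  moreover have "\<delta> powr r * V > 0" using \<delta> V by simp
  ultimately show ?thesis by blast
qed

end

section \<open>Necessary conditions on the exponents\<close>

lemma powr_bounded_exponent_zero:
  fixes e C :: real
  assumes "\<And>k::int. 2 powr (k * e) \<le> C"
  shows "e = 0"
proof (rule ccontr)
  assume "e \<noteq> 0"
  \<comment> \<open>Chosen so that \<open>k * e * ln 2 \<ge> C\<close>; then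
    \<open>exp y > y\<close> contradicts the bound. The sign factor handles negative
    \<open>e\<close>.\<close>
  define k where "k = \<lceil>C / (\<bar>e\<bar> * ln 2)\<rceil> * (if e > 0 then 1 else -1)"
  have "C = C / (\<bar>e\<bar> * ln 2) * (\<bar>e\<bar> * ln 2)" using \<open>e \<noteq> 0\<close> by simp
  also have "\<dots> \<le> real_of_int \<lceil>C / (\<bar>e\<bar> * ln 2)\<rceil> * (\<bar>e\<bar> * ln 2)"
    by (intro mult_right_mono) auto
  also have "\<dots> = real_of_int k * e * ln 2"
    using \<open>e \<noteq> 0\<close> by (auto simp: k_def)
  also have "\<dots> < exp (real_of_int k * e * ln 2)"
    using exp_ge_add_one_self[of "real_of_int k * e * ln 2"] by linarith
  also have "\<dots> = 2 powr (k * e)" by (simp add: powr_def)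
  finally show False using assms[of k] by simp
qed

context littlewood_paley
begin

lemma Lp_space_borelI:
  "f \<in> borel_measurable borel \<Longrightarrow> integrable lborel (\<lambda>x. cmod (f x) powr p) \<Longrightarrow> f \<in> Lp_space p"
  by (auto simp: Lp_space_def integrable_completion intro: measurable_completion)

lemma Lp_norm_borel:
  "f \<in> borel_measurable borel \<Longrightarrow> Lp_norm p f = (\<integral>x. cmod (f x) powr p \<partial>lborel) powr (1 / p)"
  by (simp add: Lp_norm_def integral_completion)

lemma fourier_boundedE:
  assumes "fourier_bounded \<phi> p r q s"
  obtains C where "C > 0"
    "\<And>f. f \<in> borel_measurable borel \<Longrightarrow> integrable lborel (\<lambda>x. cmod (f x) powr p) \<Longrightarrow>
       TL_norm \<phi> r q s (fourier_dist (dist_of_fun f))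
         \<le> ennreal (C * (\<integral>x. cmod (f x) powr p \<partial>lborel) powr (1 / p))"
  using assms Lp_space_borelI[of _ p] Lp_norm_borel[of _ p] unfolding fourier_bounded_def by metis

text \<open>The annulus contains the support of \<open>chi\<close>, so multiplying the dilated
  multiplier by the equally dilated shell changes nothing.\<close>

definition shell :: "'a \<Rightarrow> complex" where
  "shell t = indicator {t. 1 \<le> norm t \<and> norm t \<le> 4} t"

lemma shell_measurable [measurable]: "shell \<in> borel_measurable borel"
  unfolding shell_def[abs_def] by measurable

lemma integrable_shell: "integrable lborel (\<lambda>t. cmod (shell t) powr p)"
proof (rule Bochner_Integration.integrable_bound)
  show "integrable lborel (indicator (cball 0 4) :: 'a \<Rightarrow> real)"
    by (auto intro!: emeasure_lborel_cball_finite simp: less_top)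
qed (auto simp: shell_def indicator_def)

lemma fourier_dilated_arg:
  assumes [measurable]: "f \<in> borel_measurable borel"
  shows "fourier (\<lambda>t. f ((2 powi (- k)) *\<^sub>R t)) x = of_real ((2 powi k) ^ DIM('a)) * fourier f ((2 powi k) *\<^sub>R (x::'a))"
  using fourier_affine[of f "2 powi (- k)" 0 x]
  by (simp add: power_int_minus divide_inverse power_inverse mult.commute)

lemma fourier_of_real_0:
  "f \<in> borel_measurable borel \<Longrightarrow> fourier (\<lambda>t. of_real (f t)) 0 = of_real (\<integral>t. f t \<partial>lborel)"
  by (simp add: fourier_lborel)

text \<open>Shared by both test functions: localised to a dyadic annulus, each is a constant times a
  dilate of one fixed profile \<open>h\<close>. The power of 2 is the Jacobian of that
  dilation.\<close>

lemma block_fourier_dilated: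
  fixes h :: "'a \<Rightarrow> real"
  assumes [measurable]: "f \<in> borel_measurable borel" "h \<in> borel_measurable borel"
    and eq: "\<And>t. f t * of_real (chi ((2 powi (- k)) *\<^sub>R t)) = of_real c * of_real (h ((2 powi (- k)) *\<^sub>R t))"
  shows "\<Delta> k (fourier_dist (dist_of_fun f)) x
    = of_real (c * 2 powr (k * real DIM('a))) * fourier (\<lambda>t. of_real (h t)) ((2 powi k) *\<^sub>R x)"
proof -
  have "\<Delta> k (fourier_dist (dist_of_fun f)) x = fourier (\<lambda>t. of_real c * of_real (h ((2 powi (- k)) *\<^sub>R t))) x"
    by (simp only: conv_dist_fourier[OF assms(1)] eq)
  also have "\<dots> = of_real c * fourier (\<lambda>t. of_real (h ((2 powi (- k)) *\<^sub>R t))) x"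
    by (rule fourier_cmult) measurable
  also have "fourier (\<lambda>t. of_real (h ((2 powi (- k)) *\<^sub>R t))) x
      = of_real ((2 powi k) ^ DIM('a)) * fourier (\<lambda>t. of_real (h t)) ((2 powi k) *\<^sub>R x)"
    by (rule fourier_dilated_arg) measurable
  also have "(2 powi k) ^ DIM('a) = 2 powr (k * real DIM('a))"
    by (simp add: two_powi powr_power mult.commute)
  finally show ?thesis by simp
qed

text \<open>One block suffices for each test function. Comparing both sides bounds
  \<open>2 powr (k * e)\<close> times a fixed constant for all integers \<open>k\<close>, positive
  and negative, which forces \<open>e = 0\<close>.\<close>

theorem fourier_bounded_imp_scaling:
  assumes bdd: "fourier_bounded \<phi> p r q s" and p: "p > 0" and r: "r > 0" and q: "q > 0"
  shows "s = real DIM('a) * (1 / p + 1 / r - 1)"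
proof -
  obtain C where C: "C > 0"
    "\<And>f. f \<in> borel_measurable borel \<Longrightarrow> integrable lborel (\<lambda>x. cmod (f x) powr p) \<Longrightarrow>
       TL_norm \<phi> r q s (fourier_dist (dist_of_fun f))
         \<le> ennreal (C * (\<integral>x. cmod (f x) powr p \<partial>lborel) powr (1 / p))"
    using fourier_boundedE[OF bdd] by blast
  define d where "d = real DIM('a)"
  define G where "G = fourier (\<lambda>t. of_real (chi t) :: complex)"
  have G: "continuous_on UNIV G"
    unfolding G_def by (intro continuous_on_fourier integrable_of_real integrable_chi)
  have G0: "G 0 \<noteq> 0"
    unfolding G_def using integral_chi_pos by (simp add: fourier_of_real_0)
  obtain c where c: "c > 0" "dyadic_lower_bound G r c"
    using TL_norm_lower_dyadic[OF G G0 r] by blast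
  define W where "W = (\<integral>t. cmod (shell t) powr p \<partial>lborel)"
  have W: "W \<ge> 0" by (simp add: W_def)
  \<comment> \<open>In \<open>e\<close>, \<open>d\<close> comes from the Jacobian of the block,
    \<open>- d / r\<close> from its L^r normalisation and \<open>- d / p\<close> from the L^p norm
    of the dilated shell.\<close>
  define e where "e = s + d - d / r - d / p"
  have bound: "c * 2 powr (k * (e * r)) \<le> (C * W powr (1 / p)) powr r" for k :: int
  proof -
    define f where "f t = shell (0 + (2 powi (- k)) *\<^sub>R t)" for t
    have fm [measurable]: "f \<in> borel_measurable borel" unfolding f_def[abs_def] by measurable
    have fi: "integrable lborel (\<lambda>t. cmod (f t) powr p)"
      unfolding f_def
      using lborel_integrable_affine_iff[of "\<lambda>t. cmod (shell t) powr p" "2 powi (- k)" 0] integrable_shell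
      by simp
    have "W = \<bar>2 powi (- k)\<bar> ^ DIM('a) *\<^sub>R (\<integral>t. cmod (f t) powr p \<partial>lborel)"
      unfolding W_def f_def by (rule lborel_integral_affine) auto
    then have "(\<integral>t. cmod (f t) powr p \<partial>lborel) = (2 powi k) ^ DIM('a) * W"
      by (simp add: power_int_minus power_inverse)
    also have "(2 powi k) ^ DIM('a) = 2 powr (k * d)"
      by (simp add: two_powi d_def powr_realpow[symmetric] powr_powr)
    finally have fn: "(\<integral>t. cmod (f t) powr p \<partial>lborel) powr (1 / p) = 2 powr (k * d / p) * W powr (1 / p)"
      using W by (simp add: powr_mult powr_powr)
    have conv: "\<Delta> k (fourier_dist (dist_of_fun f)) x
        = of_real (2 powr (k * d)) * G ((2 powi k) *\<^sub>R x)" for x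
    proof -
      have "f t * of_real (chi ((2 powi (- k)) *\<^sub>R t)) = of_real 1 * of_real (chi ((2 powi (- k)) *\<^sub>R t))" for t
        using chi_eq_0[of "(2 powi (- k)) *\<^sub>R t"]
        by (cases "chi ((2 powi (- k)) *\<^sub>R t) = 0") (force simp: f_def shell_def indicator_def)+
      from block_fourier_dilated[OF fm chi_measurable this] show ?thesis
        by (simp add: G_def d_def)
    qed
    have "c * (\<Sum>k\<in>{k}. (2 powr (k * (s + d - d / r))) powr r)
       \<le> (C * (2 powr (k * d / p) * W powr (1 / p))) powr r"
    proof (rule dyadic_lower_boundD[OF c(2), where u = "fourier_dist (dist_of_fun f)"])
      show "TL_norm \<phi> r q s (fourier_dist (dist_of_fun f)) \<le> ennreal (C * (2 powr (k * d / p) * W powr (1 / p)))"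
        using C(2)[OF fm fi] unfolding fn .
      show "cmod (of_real (2 powr (l * s)) * \<Delta> l (fourier_dist (dist_of_fun f)) x)
           = 2 powr (l * (s + d - d / r)) * 2 powr (l * real DIM('a) / r) * cmod (G ((2 powi l) *\<^sub>R x))"
        if "l \<in> {k}" for l x
        using that by (simp add: conv norm_mult d_def[symmetric] powr_add[symmetric] algebra_simps)
    qed (use C q in auto)
    then have "c * 2 powr (k * (s + d - d / r) * r) \<le> 2 powr (k * d / p * r) * (C * W powr (1 / p)) powr r"
      using C by (simp add: powr_powr powr_mult mult_ac)
    then have "c * 2 powr (k * (s + d - d / r) * r) * 2 powr (- (k * d / p * r)) \<le> (C * W powr (1 / p)) powr r"
      by (simp add: powr_minus field_simps)
    moreover have "real_of_int k * (e * r) = k * (s + d - d / r) * r + - (k * d / p * r)"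
      by (simp add: e_def algebra_simps)
    ultimately show ?thesis by (simp only: powr_add mult.assoc)
  qed
  have "e * r = 0"
    by (rule powr_bounded_exponent_zero[where C = "(C * W powr (1 / p)) powr r / c"])
       (use bound c in \<open>simp add: field_simps\<close>)
  with r have "e = 0" by simp
  then show ?thesis unfolding e_def d_def by (simp add: algebra_simps)
qed

text \<open>Homogeneity of \<open>norm t powr (- d / p)\<close> makes every block inside the cutoff
  a dilate of the same profile \<open>G\<close>. The value of \<open>s\<close> already found then
  makes all the amplitudes equal to 1, so the lower bound counts blocks.\<close>

theorem fourier_bounded_imp_exponent_le:
  assumes bdd: "fourier_bounded \<phi> p r q s" and p: "p > 0" and r: "r > 0" and q: "q > 0"
  shows "p \<le> r"
proof -
  obtain C where C: "C > 0"
    "\<And>f. f \<in> borel_measurable borel \<Longrightarrow> integrable lborel (\<lambda>x. cmod (f x) powr p) \<Longrightarrow>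
       TL_norm \<phi> r q s (fourier_dist (dist_of_fun f))
         \<le> ennreal (C * (\<integral>x. cmod (f x) powr p \<partial>lborel) powr (1 / p))"
    using fourier_boundedE[OF bdd] by blast
  define d where "d = real DIM('a)"
  have s: "s = d * (1 / p + 1 / r - 1)"
    using fourier_bounded_imp_scaling[OF assms] by (simp add: d_def)
  define h where "h t = norm t powr (- d / p) * chi t" for t :: 'a
  have hm [measurable]: "h \<in> borel_measurable borel" unfolding h_def[abs_def] by measurable
  have hi: "integrable lborel h"
  proof (rule Bochner_Integration.integrable_bound[OF integrable_chi])
    show "AE t in lborel. norm (h t) \<le> norm (chi t)"
    proof (rule AE_I2)
      fix t :: 'a
      show "norm (h t) \<le> norm (chi t)"
      proof (cases "norm t \<le> 1")
        case False
        then have "norm t powr (- d / p) \<le> norm t powr 0"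
          using p by (intro powr_mono) (auto simp: d_def)
        then have "norm t powr (- d / p) \<le> 1" using False by (simp split: if_splits)
        then show ?thesis using chi_nonneg[of t] by (simp add: h_def abs_mult mult_left_le_one_le)
      qed (simp add: h_def chi_eq_0)
    qed
  qed measurable
  define G where "G = fourier (\<lambda>t. of_real (h t) :: complex)"
  have G: "continuous_on UNIV G"
    unfolding G_def by (intro continuous_on_fourier integrable_of_real hi)
  have "(\<integral>t. h t \<partial>lborel) \<noteq> 0"
  proof
    assume "(\<integral>t. h t \<partial>lborel) = 0"
    then have "AE t in lborel. h t = 0"
      by (subst (asm) integral_nonneg_eq_0_iff_AE[OF hi]) (auto simp: h_def chi_nonneg)
    then have "AE t in lborel. chi t = 0"
    proof eventually_elim
      case (elim t)
      then show ?case by (cases "t = 0") (auto simp: h_def chi_eq_0)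
    qed
    then have "(\<integral>t. chi t \<partial>lborel) = 0" by (rule integral_eq_zero_AE)
    with integral_chi_pos show False by simp
  qed
  then have G0: "G 0 \<noteq> 0" unfolding G_def by (simp add: fourier_of_real_0)
  obtain c where c: "c > 0" "dyadic_lower_bound G r c"
    using TL_norm_lower_dyadic[OF G G0 r] by blast
  \<comment> \<open>\<open>w n\<close> is the \<open>p\<close>-th power of the test function with
    cutoff \<open>2 ^ n\<close>. The measure with density \<open>norm t powr (- d)\<close> is
    dilation invariant, so each dyadic annulus has mass \<open>W\<close> and the total is
    \<open>n * W\<close>.\<close>
  define w where "w n t = indicator {t. 1 \<le> norm t \<and> norm t < 2 ^ n} t * norm t powr (- d)" for n :: nat and t :: 'a
  define W where "W = (\<integral>t. w 1 t \<partial>lborel)"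
  have wm [measurable]: "w n \<in> borel_measurable borel" for n unfolding w_def[abs_def] by measurable
  have wi: "integrable lborel (w n)" for n
  proof (rule Bochner_Integration.integrable_bound)
    show "integrable lborel (indicator (cball 0 (2 ^ n)) :: 'a \<Rightarrow> real)"
      by (auto intro!: emeasure_lborel_cball_finite simp: less_top)
    show "AE t in lborel. norm (w n t) \<le> norm (indicator (cball 0 (2 ^ n)) t :: real)"
    proof (rule AE_I2)
      fix t :: 'a
      have "norm t powr (- d) \<le> norm t powr 0" if "1 \<le> norm t"
        using that by (intro powr_mono) (auto simp: d_def)
      then show "norm (w n t) \<le> norm (indicator (cball 0 (2 ^ n)) t :: real)"
        by (auto simp: w_def indicator_def split: if_splits)
    qed
  qed measurable
  have w_step: "(\<integral>t. w (Suc n) t \<partial>lborel) = (\<integral>t. w n t \<partial>lborel) + W" for n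
  proof -
    have split: "w (Suc n) t = w n t + 2 powr (- real n * d) * w 1 (0 + (2 powi (- int n)) *\<^sub>R t)" for t
    proof -
      have "norm ((2 powi (- int n)) *\<^sub>R t) powr (- d) = 2 powr (real n * d) * norm t powr (- d)"
        by (simp add: two_powi powr_mult powr_powr)
      then have "2 powr (- real n * d) * norm ((2 powi (- int n)) *\<^sub>R t) powr (- d) = norm t powr (- d)"
        by (simp add: powr_minus)
      moreover have "1 \<le> norm ((2 powi (- int n)) *\<^sub>R t) \<longleftrightarrow> 2 ^ n \<le> norm t"
          "norm ((2 powi (- int n)) *\<^sub>R t) < 2 \<longleftrightarrow> norm t < 2 ^ Suc n"
        by (simp_all add: power_int_minus field_simps)
      moreover have "(1::real) \<le> 2 ^ n" by simp
      ultimately show ?thesis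
        by (auto simp: w_def indicator_def simp del: norm_scaleR one_le_power)
    qed
    have "W = \<bar>2 powi (- int n)\<bar> ^ DIM('a) *\<^sub>R (\<integral>t. w 1 (0 + (2 powi (- int n)) *\<^sub>R t) \<partial>lborel)"
      unfolding W_def by (rule lborel_integral_affine) auto
    also have "\<bar>2 powi (- int n)\<bar> ^ DIM('a) = 2 powr (- real n * d)"
      by (simp add: two_powi d_def powr_realpow[symmetric] powr_powr)
    finally have "W = (\<integral>t. 2 powr (- real n * d) * w 1 (0 + (2 powi (- int n)) *\<^sub>R t) \<partial>lborel)"
      by simp
    moreover have "integrable lborel (\<lambda>t. 2 powr (- real n * d) * w 1 (0 + (2 powi (- int n)) *\<^sub>R t))"
      by (intro integrable_mult_right, subst lborel_integrable_affine_iff) (use wi in auto)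
    ultimately show ?thesis using wi[of n] by (simp add: split)
  qed
  have w_int: "(\<integral>t. w n t \<partial>lborel) = real n * W" for n
  proof (induction n)
    case 0
    have "w 0 t = 0" for t by (auto simp: w_def indicator_def)
    then show ?case by simp
  qed (simp add: w_step algebra_simps)
  have "0 \<le> W" unfolding W_def by (intro integral_nonneg_AE) (auto simp: w_def)
  \<comment> \<open>The multiplier of index \<open>k\<close> reaches up to
    \<open>2 powi (k + 2)\<close>. A cutoff at \<open>2 ^ Suc n\<close> therefore contains the
    blocks \<open>0 \<le> k < n\<close> completely: \<open>n\<close> blocks against a mass of
    \<open>Suc n\<close> annuli.\<close>
  have bound: "c * real n \<le> (C * (real (Suc n) * W) powr (1 / p)) powr r" for n
  proof -
    define f :: "'a \<Rightarrow> complex" where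
      "f t = of_real (indicator {t. 1 \<le> norm t \<and> norm t < 2 ^ Suc n} t * norm t powr (- d / p))" for t
    have fm [measurable]: "f \<in> borel_measurable borel" unfolding f_def[abs_def] by measurable
    have fw: "(\<lambda>t. cmod (f t) powr p) = w (Suc n)"
      using p by (auto simp: f_def w_def indicator_def powr_powr fun_eq_iff)
    have conv: "\<Delta> k (fourier_dist (dist_of_fun f)) x
        = of_real (2 powr (k * (d - d / p))) * G ((2 powi k) *\<^sub>R x)" if k: "k \<in> {0..<int n}" for x k
    proof -
      have "f t * of_real (chi ((2 powi (- k)) *\<^sub>R t))
          = of_real (2 powr (- k * d / p)) * of_real (h ((2 powi (- k)) *\<^sub>R t))" for t
      proof (cases "1 < norm ((2 powi (- k)) *\<^sub>R t) \<and> norm ((2 powi (- k)) *\<^sub>R t) < 4")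
        case True
        then have t: "2 powi k < norm t" "norm t < 4 * 2 powi k"
          by (simp_all add: power_int_minus field_simps)
        have "1 \<le> (2::real) powi k" using k by (intro one_le_power_int) auto
        moreover have "4 * 2 powi k \<le> (2::real) ^ Suc n"
        proof -
          have "(2::real) powi (k + 2) \<le> 2 powi (int (Suc n))"
            using k by (intro power_int_increasing) auto
          then show ?thesis by (simp only: power_int_of_nat) (simp add: power_int_add)
        qed
        ultimately have "f t = of_real (norm t powr (- d / p))"
          using t unfolding f_def indicator_def by auto
        moreover have "norm ((2 powi (- k)) *\<^sub>R t) powr (- d / p) = 2 powr (k * d / p) * norm t powr (- d / p)"
          by (simp add: two_powi powr_mult powr_powr)
        then have "2 powr (- k * d / p) * norm ((2 powi (- k)) *\<^sub>R t) powr (- d / p) = norm t powr (- d / p)"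
          by (simp add: powr_minus)
        ultimately show ?thesis by (simp add: h_def flip: of_real_mult)
      next
        case False
        then have "chi ((2 powi (- k)) *\<^sub>R t) = 0" by (intro chi_eq_0) auto
        then show ?thesis by (simp add: h_def)
      qed
      note block = block_fourier_dilated[OF fm hm this, of x]
      have "- k * d / p + k * d = k * (d - d / p)" by (simp add: algebra_simps)
      then show ?thesis
        unfolding block G_def d_def[symmetric] by (simp only: powr_add[symmetric])
    qed
    have "c * (\<Sum>k\<in>{0..<int n}. 1 powr r) \<le> (C * (real (Suc n) * W) powr (1 / p)) powr r"
    proof (rule dyadic_lower_boundD[OF c(2), where u = "fourier_dist (dist_of_fun f)" and b = "\<lambda>_. 1"])
      show "TL_norm \<phi> r q s (fourier_dist (dist_of_fun f)) \<le> ennreal (C * (real (Suc n) * W) powr (1 / p))"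
        using C(2)[OF fm] wi unfolding fw w_int .
      show "cmod (of_real (2 powr (k * s)) * \<Delta> k (fourier_dist (dist_of_fun f)) x)
           = 1 * 2 powr (k * real DIM('a) / r) * cmod (G ((2 powi k) *\<^sub>R x))"
        if "k \<in> {0..<int n}" for k x
        using that by (simp add: conv norm_mult d_def[symmetric] s powr_add[symmetric] algebra_simps)
    qed (use C q in auto)
    then show ?thesis by simp
  qed
  show ?thesis
  proof (rule ccontr)
    assume "\<not> p \<le> r"
    then have a: "r / p < 1" "r / p > 0" using p r by auto
    define D where "D = (C * W powr (1 / p)) powr r"
    have "c * real n \<le> D * real (Suc n) powr (r / p)" for n
      using bound[of n] C(1) \<open>0 \<le> W\<close> by (simp add: D_def powr_mult powr_powr mult_ac)
    then have le: "real n \<le> D / c * real (Suc n) powr (r / p)" for n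
      using c by (simp add: field_simps)
    \<comment> \<open>For \<open>n \<ge> 1\<close> one has \<open>Suc n \<le> 2 * n\<close>, so both
      sides can be written in \<open>Suc n\<close>. As \<open>r / p < 1\<close>, the result bounds
      \<open>Suc n\<close> itself.\<close>
    have "real (Suc n) powr (1 - r / p) \<le> 2 * (D / c)" if "n \<ge> 1" for n
    proof -
      have "real (Suc n) \<le> 2 * (D / c) * real (Suc n) powr (r / p)"
        using le[of n] that by simp
      then show ?thesis by (simp add: powr_diff field_simps)
    qed
    then have "real (Suc n) \<le> (2 * (D / c)) powr (1 / (1 - r / p))" if "n \<ge> 1" for n
    proof -
      have "(real (Suc n) powr (1 - r / p)) powr (1 / (1 - r / p)) \<le> (2 * (D / c)) powr (1 / (1 - r / p))"
        using a \<open>n \<ge> 1 \<Longrightarrow> real (Suc n) powr (1 - r / p) \<le> 2 * (D / c)\<close> that by (intro powr_mono2) auto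
      moreover have "(1 - r / p) * (1 / (1 - r / p)) = 1"
        unfolding times_divide_eq_right mult_1_right by (rule divide_self) (use a in linarith)
      ultimately show ?thesis by (simp only: powr_powr) simp
    qed
    moreover obtain n where "(2 * (D / c)) powr (1 / (1 - r / p)) < real n"
      using reals_Archimedean2 by blast
    ultimately show False
      by (smt (verit) One_nat_def Suc_le_eq gr0I not_less of_nat_0 of_nat_Suc powr_ge_zero)
  qed
qed

end

section \<open>Tempered distributions convolved with Schwartz functions\<close>

text \<open>Mean value inequality along the segment from \<open>b - y\<close> to
  \<open>a - y\<close>. For \<open>w\<close> on it, \<open>w + y\<close> lies between
  \<open>b\<close> and \<open>a\<close>, so the weight in \<open>y\<close> is paid for by the decay
  of the gradient at \<open>w\<close> and a factor depending only on \<open>a\<close> and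
  \<open>b\<close>.\<close>

lemma schwartz_translation_bound:
  fixes g :: "'a::euclidean_space \<Rightarrow> complex"
  assumes g: "g \<in> schwartz"
  obtains C where "C > 0"
    "\<And>a b y. (1 + norm y) ^ N * cmod (g (a - y) - g (b - y)) \<le> C * (1 + norm a + norm b) ^ N * norm (a - b)"
proof -
  have "\<exists>C>0. \<forall>w. (1 + norm w) ^ N * cmod (partial_deriv i g w) \<le> C" if "i \<in> Basis" for i
    using rapidly_decreasingE[OF schwartz_rapidly_decreasing[OF schwartz_partial_deriv[OF g that]], of N] by metis
  then obtain C where C: "\<And>i. i \<in> Basis \<Longrightarrow> C i > 0"
    "\<And>i w. i \<in> Basis \<Longrightarrow> (1 + norm w) ^ N * cmod (partial_deriv i g w) \<le> C i"
    by metis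
  define D where "D = (\<Sum>i\<in>Basis. C i)"
  have "D > 0" unfolding D_def using C nonempty_Basis by (intro sum_pos) auto
  moreover have "(1 + norm y) ^ N * cmod (g (a - y) - g (b - y)) \<le> D * (1 + norm a + norm b) ^ N * norm (a - b)" for a b y
  proof -
    define B where "B = D * (1 + norm a + norm b) ^ N / (1 + norm y) ^ N"
    have y: "1 + norm y > 0" by (simp add: add_pos_nonneg)
    have "cmod (g (a - y) - g (b - y)) \<le> B * norm ((a - y) - (b - y))"
    proof (rule differentiable_bound[where S = "closed_segment (b - y) (a - y)"])
      fix w assume w: "w \<in> closed_segment (b - y) (a - y)"
      show "(g has_derivative (\<lambda>h. \<Sum>i\<in>Basis. (h \<bullet> i) *\<^sub>R partial_deriv i g w)) (at w within closed_segment (b - y) (a - y))"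
        by (rule has_derivative_at_withinI[OF schwartz_has_derivative[OF g]])
      show "onorm (\<lambda>h. \<Sum>i\<in>Basis. (h \<bullet> i) *\<^sub>R partial_deriv i g w) \<le> B"
      proof (rule onorm_le)
        fix h :: 'a
        obtain t where t: "0 \<le> t" "t \<le> 1" "w = (1 - t) *\<^sub>R (b - y) + t *\<^sub>R (a - y)"
          using w by (auto simp: closed_segment_def)
        have "w + y = (1 - t) *\<^sub>R b + t *\<^sub>R a" unfolding t(3) by (simp add: algebra_simps)
        then have "norm (w + y) \<le> (1 - t) * norm b + t * norm a"
          using t by (auto intro: norm_triangle_le)
        also have "\<dots> \<le> 1 * norm b + 1 * norm a"
          using t by (intro add_mono mult_right_mono) auto
        finally have "norm y \<le> norm w + (norm a + norm b)"
          using norm_triangle_ineq4[of "w + y" w] by simp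
        then have "1 + norm y \<le> 1 + norm w + (norm a + norm b)" by simp
        also have "\<dots> \<le> (1 + norm w) * (1 + norm a + norm b)"
        proof -
          have "0 \<le> norm w * (norm a + norm b)" by simp
          then show ?thesis unfolding ring_distribs mult_1_left mult_1_right by linarith
        qed
        finally have "(1 + norm y) ^ N \<le> ((1 + norm w) * (1 + norm a + norm b)) ^ N"
          by (intro power_mono) auto
        then have pw: "(1 + norm y) ^ N \<le> (1 + norm w) ^ N * (1 + norm a + norm b) ^ N"
          by (simp add: power_mult_distrib)
        have bound: "cmod (partial_deriv i g w) \<le> C i * (1 + norm a + norm b) ^ N / (1 + norm y) ^ N" if "i \<in> Basis" for i
        proof -
          have "(1 + norm y) ^ N * cmod (partial_deriv i g w)
              \<le> (1 + norm w) ^ N * (1 + norm a + norm b) ^ N * cmod (partial_deriv i g w)"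
            by (intro mult_right_mono pw) auto
          also have "\<dots> = (1 + norm a + norm b) ^ N * ((1 + norm w) ^ N * cmod (partial_deriv i g w))"
            by (simp only: mult_ac)
          also have "\<dots> \<le> (1 + norm a + norm b) ^ N * C i"
            by (intro mult_left_mono C that) auto
          finally show ?thesis using y by (simp add: field_simps)
        qed
        have "norm (\<Sum>i\<in>Basis. (h \<bullet> i) *\<^sub>R partial_deriv i g w)
            \<le> (\<Sum>i\<in>Basis. norm h * (C i * (1 + norm a + norm b) ^ N / (1 + norm y) ^ N))"
        proof (intro sum_norm_le)
          fix i :: 'a assume "i \<in> Basis"
          then show "norm ((h \<bullet> i) *\<^sub>R partial_deriv i g w)
              \<le> norm h * (C i * (1 + norm a + norm b) ^ N / (1 + norm y) ^ N)"
            unfolding norm_scaleR by (intro mult_mono bound Basis_le_norm) auto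
        qed
        also have "\<dots> = B * norm h"
          by (simp add: B_def D_def sum_distrib_right sum_distrib_left sum_divide_distrib mult_ac)
        finally show "norm (\<Sum>i\<in>Basis. (h \<bullet> i) *\<^sub>R partial_deriv i g w) \<le> B * norm h" .
      qed
    qed auto
    then show ?thesis
      using y by (simp add: B_def field_simps)
  qed
  ultimately show ?thesis using that by blast
qed

text \<open>The convolution is assumed to be a known Schwartz function \<open>\<Theta>\<close>. Its
  partial derivative then exists, and the limit of the difference quotients along the sequence
  \<open>t n\<close> identifies it, without a separate proof that convolutions are
  differentiable.\<close>

lemma schwartz_convolution_partial_deriv:
  fixes \<psi> K :: "'a::euclidean_space \<Rightarrow> complex"
  assumes K: "integrable lborel K" and \<psi>: "\<psi> \<in> schwartz" and \<Theta>: "\<Theta> \<in> schwartz"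
    and eq: "\<Theta> = conv_fun K \<psi>" and b: "b \<in> Basis"
  shows "partial_deriv b \<Theta> = conv_fun K (partial_deriv b \<psi>)"
proof
  fix y
  have [measurable]: "K \<in> borel_measurable borel" "\<psi> \<in> borel_measurable borel"
    "partial_deriv b \<psi> \<in> borel_measurable borel"
    using K \<psi> schwartz_partial_deriv[OF \<psi> b] by auto
  define t where "t n = inverse (real (Suc n))" for n
  have t: "t n > 0" for n by (simp add: t_def)
  have quot: "(\<lambda>n. (f (y + t n *\<^sub>R b) - f y) /\<^sub>R t n) \<longlonglongrightarrow> partial_deriv b f y"
    if "f \<in> schwartz" for f :: "'a \<Rightarrow> complex" and y
  proof -
    have D: "(f has_derivative frechet_derivative f (at y)) (at y)"
      using schwartz_differentiable[OF that] by (simp add: frechet_derivative_works)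
    then interpret bounded_linear "frechet_derivative f (at y)"
      by (rule has_derivative_bounded_linear)
    have "(\<lambda>n. t n *\<^sub>R b) \<longlonglongrightarrow> 0 *\<^sub>R b"
      unfolding t_def by (intro tendsto_intros LIMSEQ_inverse_real_of_nat)
    then have "filterlim (\<lambda>n. t n *\<^sub>R b) (at 0) sequentially"
      using b t by (auto simp: filterlim_at nonzero_Basis less_imp_neq[symmetric])
    with D have "(\<lambda>n. norm (f (y + t n *\<^sub>R b) - f y - frechet_derivative f (at y) (t n *\<^sub>R b)) / norm (t n *\<^sub>R b)) \<longlonglongrightarrow> 0"
      unfolding has_derivative_at by - (rule filterlim_compose[OF conjunct2])
    moreover have "norm (f (y + t n *\<^sub>R b) - f y - frechet_derivative f (at y) (t n *\<^sub>R b)) / norm (t n *\<^sub>R b)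
        = norm ((f (y + t n *\<^sub>R b) - f y) /\<^sub>R t n - partial_deriv b f y)" for n
    proof -
      have "f (y + t n *\<^sub>R b) - f y - frechet_derivative f (at y) (t n *\<^sub>R b)
          = t n *\<^sub>R ((f (y + t n *\<^sub>R b) - f y) /\<^sub>R t n - partial_deriv b f y)"
        using t[of n] by (simp add: scaleR partial_deriv_def scaleR_diff_right)
      then show ?thesis using t[of n] b by simp
    qed
    ultimately have "(\<lambda>n. norm ((f (y + t n *\<^sub>R b) - f y) /\<^sub>R t n - partial_deriv b f y)) \<longlonglongrightarrow> 0"
      by simp
    then show ?thesis
      by (simp add: tendsto_norm_zero_iff LIM_zero_iff)
  qed
  \<comment> \<open>With weight exponent 0 this is a Lipschitz bound for \<open>\<psi>\<close>; it
    dominates all difference quotients uniformly in \<open>z\<close> and \<open>n\<close>.\<close>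
  obtain C where C: "C > 0" "\<And>a b y. (1 + norm y) ^ 0 * cmod (\<psi> (a - y) - \<psi> (b - y)) \<le> C * (1 + norm a + norm b) ^ 0 * norm (a - b)"
    using schwartz_translation_bound[OF \<psi>, of 0] by blast
  have "(\<lambda>n. \<integral>z. K z * ((\<psi> (y + t n *\<^sub>R b - z) - \<psi> (y - z)) /\<^sub>R t n) \<partial>lborel)
      \<longlonglongrightarrow> (\<integral>z. K z * partial_deriv b \<psi> (y - z) \<partial>lborel)"
  proof (rule integral_dominated_convergence[where w = "\<lambda>z. cmod (K z) * C"])
    show "AE z in lborel. (\<lambda>n. K z * ((\<psi> (y + t n *\<^sub>R b - z) - \<psi> (y - z)) /\<^sub>R t n)) \<longlonglongrightarrow> K z * partial_deriv b \<psi> (y - z)"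
      using quot[OF \<psi>, of "y - z" for z] by (intro AE_I2 tendsto_intros) (simp add: algebra_simps)
    show "AE z in lborel. norm (K z * ((\<psi> (y + t n *\<^sub>R b - z) - \<psi> (y - z)) /\<^sub>R t n)) \<le> cmod (K z) * C" for n
    proof (rule AE_I2)
      fix z
      have "cmod (\<psi> (y + t n *\<^sub>R b - z) - \<psi> (y - z)) \<le> C * t n"
        using C(2)[of z "y + t n *\<^sub>R b" y] t[of n] b by simp
      then have "inverse (t n) * cmod (\<psi> (y + t n *\<^sub>R b - z) - \<psi> (y - z)) \<le> inverse (t n) * (C * t n)"
        using t[of n] by (intro mult_left_mono) auto
      also have "inverse (t n) * (C * t n) = C" using t[of n] by simp
      also have "inverse (t n) = \<bar>inverse (t n)\<bar>" using t[of n] by simp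
      finally have "cmod ((\<psi> (y + t n *\<^sub>R b - z) - \<psi> (y - z)) /\<^sub>R t n) \<le> C"
        unfolding norm_scaleR .
      then show "norm (K z * ((\<psi> (y + t n *\<^sub>R b - z) - \<psi> (y - z)) /\<^sub>R t n)) \<le> cmod (K z) * C"
        unfolding norm_mult by (intro mult_left_mono) auto
    qed
  qed (use K in auto)
  moreover have "(\<integral>z. K z * ((\<psi> (y + t n *\<^sub>R b - z) - \<psi> (y - z)) /\<^sub>R t n) \<partial>lborel)
      = (\<Theta> (y + t n *\<^sub>R b) - \<Theta> y) /\<^sub>R t n" for n
  proof -
    have "(\<Theta> (y + t n *\<^sub>R b) - \<Theta> y) /\<^sub>R t n
      = (\<integral>z. (K z * \<psi> (y + t n *\<^sub>R b - z) - K z * \<psi> (y - z)) /\<^sub>R t n \<partial>lborel)"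
      using convolution_integrand_integrable[OF K \<psi>] by (simp add: eq conv_fun_def)
    also have "(\<lambda>z. (K z * \<psi> (y + t n *\<^sub>R b - z) - K z * \<psi> (y - z)) /\<^sub>R t n)
      = (\<lambda>z. K z * ((\<psi> (y + t n *\<^sub>R b - z) - \<psi> (y - z)) /\<^sub>R t n))"
      by (simp add: fun_eq_iff scaleR_conv_of_real algebra_simps)
    finally show ?thesis ..
  qed
  ultimately have "(\<lambda>n. (\<Theta> (y + t n *\<^sub>R b) - \<Theta> y) /\<^sub>R t n) \<longlonglongrightarrow> conv_fun K (partial_deriv b \<psi>) y"
    by (simp only: conv_fun_def)
  with quot[OF \<Theta>] show "partial_deriv b \<Theta> y = conv_fun K (partial_deriv b \<psi>) y"
    by (rule LIMSEQ_unique)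
qed

lemma schwartz_convolution_partial_derivs:
  assumes K: "integrable lborel K" and \<psi>: "\<psi> \<in> schwartz" and \<Theta>: "\<Theta> \<in> schwartz"
    and eq: "\<Theta> = conv_fun K \<psi>" and bs: "set bs \<subseteq> Basis"
  shows "partial_derivs bs \<Theta> = conv_fun K (partial_derivs bs \<psi>)"
  using bs
proof (induction bs)
  case (Cons b bs)
  then have "set bs \<subseteq> Basis" "b \<in> Basis" by auto
  from schwartz_convolution_partial_deriv[OF K schwartz_partial_derivs[OF \<psi> this(1)]
      schwartz_partial_derivs[OF \<Theta> this(1)] Cons.IH[OF this(1)] this(2)]
  show ?case by (simp only: partial_derivs_Cons)
qed (use eq in simp)

section \<open>Seminorm estimates for tempered functionals\<close>

lemma schwartz_seminorm_le:
  assumes "\<And>x. (1 + norm x) ^ N * cmod (partial_derivs bs f x) \<le> C"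
  shows "schwartz_seminorm N bs f \<le> C"
  unfolding schwartz_seminorm_def by (rule cSUP_least) (use assms in auto)

definition seminorm_sum :: "nat \<Rightarrow> ('a::euclidean_space \<Rightarrow> complex) \<Rightarrow> real" where
  "seminorm_sum N f = (\<Sum>bs\<in>{bs. set bs \<subseteq> Basis \<and> length bs \<le> N}. schwartz_seminorm N bs f)"

lemma finite_Basis_lists: "finite {bs::'a::euclidean_space list. set bs \<subseteq> Basis \<and> length bs \<le> N}"
  by (rule finite_lists_length_le) simp

text \<open>The constant in \<open>tempered\<close> may have either sign. Since the seminorm sum is
  nonnegative on \<open>schwartz\<close>, where the suprema are over bounded sets, it can be
  replaced by its absolute value.\<close>

lemma temperedE:
  assumes "u \<in> tempered"
  obtains C N where "C \<ge> 0" "\<And>g. g \<in> schwartz \<Longrightarrow> cmod (u g) \<le> C * seminorm_sum N g"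
proof -
  obtain C N where C: "\<And>g. g \<in> schwartz \<Longrightarrow> cmod (u g) \<le> C * seminorm_sum N g"
    using assms unfolding tempered_def seminorm_sum_def by blast
  have nonneg: "0 \<le> seminorm_sum N g" if "g \<in> schwartz" for g :: "'a \<Rightarrow> complex"
    unfolding seminorm_sum_def
  proof (rule sum_nonneg)
    fix bs :: "'a list" assume "bs \<in> {bs. set bs \<subseteq> Basis \<and> length bs \<le> N}"
    then have "rapidly_decreasing (partial_derivs bs g)"
      using that by (auto intro: schwartz_rapidly_decreasing schwartz_partial_derivs)
    then obtain B where B: "\<And>x. (1 + norm x) ^ N * cmod (partial_derivs bs g x) \<le> B"
      unfolding rapidly_decreasing_def by meson
    have "(1 + norm (0::'a)) ^ N * cmod (partial_derivs bs g 0)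
        \<le> (SUP x. (1 + norm x) ^ N * cmod (partial_derivs bs g x))"
      by (rule cSUP_upper[of 0 UNIV "\<lambda>x. (1 + norm x) ^ N * cmod (partial_derivs bs g x)"])
         (auto intro!: bdd_aboveI2 B)
    moreover have "0 \<le> (1 + norm (0::'a)) ^ N * cmod (partial_derivs bs g 0)" by simp
    ultimately show "0 \<le> schwartz_seminorm N bs g" unfolding schwartz_seminorm_def by linarith
  qed
  show ?thesis
  proof (rule that[of "\<bar>C\<bar>"])
    show "cmod (u g) \<le> \<bar>C\<bar> * seminorm_sum N g" if "g \<in> schwartz" for g
      using C[OF that] mult_right_mono[OF abs_ge_self nonneg[OF that], of C] by linarith
  qed simp
qed

lemma tempered_add:
  "u \<in> tempered \<Longrightarrow> f \<in> schwartz \<Longrightarrow> g \<in> schwartz \<Longrightarrow> u (\<lambda>x. f x + g x) = u f + u g"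
  and tempered_cmult: "u \<in> tempered \<Longrightarrow> f \<in> schwartz \<Longrightarrow> u (\<lambda>x. a * f x) = a * u f"
  by (auto simp: tempered_def)

lemma tempered_diff:
  assumes "u \<in> tempered" "f \<in> schwartz" "g \<in> schwartz"
  shows "u (\<lambda>x. f x - g x) = u f - u g"
proof -
  have "u (\<lambda>x. f x + (-1) * g x) = u f + u (\<lambda>x. (-1) * g x)"
    by (intro tempered_add[OF assms(1,2)] schwartz_cmult assms(3))
  also have "u (\<lambda>x. (-1) * g x) = (-1) * u g"
    by (rule tempered_cmult[OF assms(1,3)])
  finally show ?thesis by simp
qed

lemma tempered_sum:
  assumes u: "u \<in> tempered" and "finite I" "\<And>i. i \<in> I \<Longrightarrow> f i \<in> schwartz"
  shows "u (\<lambda>x. \<Sum>i\<in>I. c i * f i x) = (\<Sum>i\<in>I. c i * u (f i))"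
  using assms(2,3)
proof (induction I rule: finite_induct)
  case empty
  have "u (\<lambda>x. 0 * 0) = 0 * u (\<lambda>x. 0)"
    by (rule tempered_cmult[OF u schwartz_zero])
  then show ?case by simp
next
  case (insert i I)
  have "u (\<lambda>x. c i * f i x + (\<Sum>i\<in>I. c i * f i x))
      = u (\<lambda>x. c i * f i x) + u (\<lambda>x. \<Sum>i\<in>I. c i * f i x)"
    using insert.prems by (intro tempered_add[OF u] schwartz_cmult schwartz_sum) auto
  also have "u (\<lambda>x. c i * f i x) = c i * u (f i)"
    using insert.prems by (intro tempered_cmult[OF u]) auto
  finally show ?case using insert by simp
qed

text \<open>Only finitely many derivative lists have length at most \<open>N\<close>, so the sum of
  their constants serves them all.\<close>

lemma schwartz_translation_bound_derivs:
  fixes \<psi> :: "'a::euclidean_space \<Rightarrow> complex"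
  assumes \<psi>: "\<psi> \<in> schwartz"
  obtains C where "C > 0"
    "\<And>bs a b y. set bs \<subseteq> Basis \<Longrightarrow> length bs \<le> N \<Longrightarrow>
      (1 + norm y) ^ N * cmod (partial_derivs bs \<psi> (a - y) - partial_derivs bs \<psi> (b - y))
        \<le> C * (1 + norm a + norm b) ^ N * norm (a - b)"
proof -
  let ?L = "{bs::'a list. set bs \<subseteq> Basis \<and> length bs \<le> N}"
  have "\<exists>C>0. \<forall>a b y. (1 + norm y) ^ N * cmod (partial_derivs bs \<psi> (a - y) - partial_derivs bs \<psi> (b - y))
        \<le> C * (1 + norm a + norm b) ^ N * norm (a - b)" if "set bs \<subseteq> Basis" for bs
    using schwartz_translation_bound[OF schwartz_partial_derivs[OF \<psi> that], of N] by metis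
  then obtain C where C: "\<And>bs. set bs \<subseteq> Basis \<Longrightarrow> C bs > 0"
    "\<And>bs a b y. set bs \<subseteq> Basis \<Longrightarrow>
       (1 + norm y) ^ N * cmod (partial_derivs bs \<psi> (a - y) - partial_derivs bs \<psi> (b - y))
        \<le> C bs * (1 + norm a + norm b) ^ N * norm (a - b)"
    by metis
  show ?thesis
  proof (rule that[of "\<Sum>bs\<in>?L. C bs"])
    show "(\<Sum>bs\<in>?L. C bs) > 0"
      by (rule sum_pos[OF finite_Basis_lists]) (auto intro: C exI[of _ "[]"])
    fix bs :: "'a list" and a b y :: 'a assume bs: "set bs \<subseteq> Basis" "length bs \<le> N"
    have "C bs \<le> (\<Sum>bs\<in>?L. C bs)"
      by (rule member_le_sum) (use bs C finite_Basis_lists in \<open>auto simp: less_imp_le\<close>)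
    then have "C bs * (1 + norm a + norm b) ^ N * norm (a - b)
        \<le> (\<Sum>bs\<in>?L. C bs) * (1 + norm a + norm b) ^ N * norm (a - b)"
      by (intro mult_right_mono) auto
    with C(2)[OF bs(1), of y a b]
    show "(1 + norm y) ^ N * cmod (partial_derivs bs \<psi> (a - y) - partial_derivs bs \<psi> (b - y))
        \<le> (\<Sum>bs\<in>?L. C bs) * (1 + norm a + norm b) ^ N * norm (a - b)" by simp
  qed
qed

text \<open>Continuity of \<open>u\<close> transfers the translation estimate from the seminorms to
  \<open>u\<close>. The same inequality yields continuity of \<open>conv_dist \<psi> u\<close> and,
  with \<open>b = 0\<close>, its polynomial growth.\<close>

lemma tempered_translation_bound:
  fixes \<psi> :: "'a::euclidean_space \<Rightarrow> complex"
  assumes u: "u \<in> tempered" and \<psi>: "\<psi> \<in> schwartz"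
  obtains C N where "C > 0"
    "\<And>a b. cmod (u (\<lambda>y. \<psi> (a - y)) - u (\<lambda>y. \<psi> (b - y))) \<le> C * (1 + norm a + norm b) ^ N * norm (a - b)"
proof -
  obtain C0 N where C0: "C0 \<ge> 0" "\<And>g. g \<in> schwartz \<Longrightarrow> cmod (u g) \<le> C0 * seminorm_sum N g"
    using temperedE[OF u] by blast
  obtain C where C: "C > 0"
    "\<And>bs a b y. set bs \<subseteq> Basis \<Longrightarrow> length bs \<le> N \<Longrightarrow>
      (1 + norm y) ^ N * cmod (partial_derivs bs \<psi> (a - y) - partial_derivs bs \<psi> (b - y))
        \<le> C * (1 + norm a + norm b) ^ N * norm (a - b)"
    using schwartz_translation_bound_derivs[OF \<psi>, of N] by blast
  define M where "M = real (card {bs::'a list. set bs \<subseteq> Basis \<and> length bs \<le> N})"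
  have bound: "cmod (u (\<lambda>y. \<psi> (a - y)) - u (\<lambda>y. \<psi> (b - y))) \<le> C0 * M * C * (1 + norm a + norm b) ^ N * norm (a - b)" for a b
  proof -
    have S: "(\<lambda>y. \<psi> (c - y)) \<in> schwartz" for c by (rule schwartz_reflect[OF \<psi>])
    have "schwartz_seminorm N bs (\<lambda>y. \<psi> (a - y) - \<psi> (b - y)) \<le> C * (1 + norm a + norm b) ^ N * norm (a - b)"
      if bs: "set bs \<subseteq> Basis" "length bs \<le> N" for bs
    proof (rule schwartz_seminorm_le)
      fix y
      have "partial_derivs bs (\<lambda>y. 1 * \<psi> (a - y) + (-1) * \<psi> (b - y)) y
          = (-1) ^ length bs * (partial_derivs bs \<psi> (a - y) - partial_derivs bs \<psi> (b - y))"
        by (simp only: partial_derivs_lincomb[OF S S bs(1)] partial_derivs_reflect[OF \<psi> bs(1)])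
           (simp add: algebra_simps)
      then show "(1 + norm y) ^ N * cmod (partial_derivs bs (\<lambda>y. \<psi> (a - y) - \<psi> (b - y)) y)
          \<le> C * (1 + norm a + norm b) ^ N * norm (a - b)"
        using C(2)[OF bs, of y a b] by (simp add: norm_mult norm_power)
    qed
    then have "seminorm_sum N (\<lambda>y. \<psi> (a - y) - \<psi> (b - y)) \<le> M * (C * (1 + norm a + norm b) ^ N * norm (a - b))"
      unfolding seminorm_sum_def M_def by (intro sum_bounded_above) auto
    then have "C0 * seminorm_sum N (\<lambda>y. \<psi> (a - y) - \<psi> (b - y)) \<le> C0 * (M * (C * (1 + norm a + norm b) ^ N * norm (a - b)))"
      using C0(1) by (rule mult_left_mono)
    moreover have "(\<lambda>y. \<psi> (a - y) - \<psi> (b - y)) \<in> schwartz"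
      using schwartz_lincomb[OF S[of a] S[of b], of 1 "-1"] by simp
    ultimately show ?thesis
      using C0(2)[of "\<lambda>y. \<psi> (a - y) - \<psi> (b - y)"]
      unfolding tempered_diff[OF u S[of a] S[of b]] mult.assoc by linarith
  qed
  show ?thesis
  proof (rule that[of "C0 * M * C + 1" N])
    show "C0 * M * C + 1 > 0" using C0(1) C(1) by (simp add: M_def add_nonneg_pos)
    fix a b :: 'a
    have "C0 * M * C * ((1 + norm a + norm b) ^ N * norm (a - b)) \<le> (C0 * M * C + 1) * ((1 + norm a + norm b) ^ N * norm (a - b))"
      by (intro mult_right_mono) auto
    then show "cmod (u (\<lambda>y. \<psi> (a - y)) - u (\<lambda>y. \<psi> (b - y))) \<le> (C0 * M * C + 1) * (1 + norm a + norm b) ^ N * norm (a - b)"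
      using bound[of a b] by (simp add: mult.assoc)
  qed
qed

lemma continuous_on_conv_dist:
  assumes u: "u \<in> tempered" and \<psi>: "\<psi> \<in> schwartz"
  shows "continuous_on A (conv_dist \<psi> u)"
proof -
  obtain C N where C: "C > 0"
    "\<And>a b. cmod (u (\<lambda>y. \<psi> (a - y)) - u (\<lambda>y. \<psi> (b - y))) \<le> C * (1 + norm a + norm b) ^ N * norm (a - b)"
    using tempered_translation_bound[OF assms] by blast
  have "(conv_dist \<psi> u \<longlongrightarrow> conv_dist \<psi> u b) (at b within A)" for b
  proof (rule Lim_transform_bound[THEN LIM_zero_cancel])
    show "eventually (\<lambda>a. norm (conv_dist \<psi> u a - conv_dist \<psi> u b) \<le> norm (C * (1 + norm a + norm b) ^ N * norm (a - b))) (at b within A)"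
      using C(2) C(1) by (auto intro!: always_eventually simp: conv_dist_def abs_mult)
    have "((\<lambda>a. C * (1 + norm a + norm b) ^ N * norm (a - b)) \<longlongrightarrow> C * (1 + norm b + norm b) ^ N * norm (b - b)) (at b within A)"
      by (intro tendsto_intros)
    then show "((\<lambda>a. C * (1 + norm a + norm b) ^ N * norm (a - b)) \<longlongrightarrow> 0) (at b within A)" by simp
  qed
  then show ?thesis by (simp add: continuous_on_def)
qed

lemma conv_dist_polynomial_growth:
  assumes u: "u \<in> tempered" and \<psi>: "\<psi> \<in> schwartz"
  obtains C N where "C > 0" "\<And>a. cmod (conv_dist \<psi> u a) \<le> C * (1 + norm a) ^ N"
proof -
  obtain C N where C: "C > 0"
    "\<And>a b. cmod (u (\<lambda>y. \<psi> (a - y)) - u (\<lambda>y. \<psi> (b - y))) \<le> C * (1 + norm a + norm b) ^ N * norm (a - b)"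
    using tempered_translation_bound[OF assms] by blast
  show ?thesis
  proof (rule that[of "cmod (conv_dist \<psi> u 0) + C" "Suc N"])
    show "cmod (conv_dist \<psi> u 0) + C > 0" using C by (simp add: add_nonneg_pos)
    fix a
    have "cmod (conv_dist \<psi> u a - conv_dist \<psi> u 0) \<le> C * (1 + norm a) ^ N * norm a"
      using C(2)[of a 0] by (simp add: conv_dist_def)
    also have "\<dots> \<le> C * (1 + norm a) ^ N * (1 + norm a)"
      using C(1) by (intro mult_left_mono) auto
    finally have "cmod (conv_dist \<psi> u a - conv_dist \<psi> u 0) \<le> C * (1 + norm a) ^ Suc N" by (simp add: mult_ac)
    moreover have "cmod (conv_dist \<psi> u 0) * 1 \<le> cmod (conv_dist \<psi> u 0) * (1 + norm a) ^ Suc N"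
      by (intro mult_left_mono one_le_power) auto
    moreover have "cmod (conv_dist \<psi> u a) \<le> cmod (conv_dist \<psi> u 0) + cmod (conv_dist \<psi> u a - conv_dist \<psi> u 0)"
      by (metis norm_triangle_sub)
    ultimately show "cmod (conv_dist \<psi> u a) \<le> (cmod (conv_dist \<psi> u 0) + C) * (1 + norm a) ^ Suc N"
      unfolding ring_distribs by linarith
  qed
qed

text \<open>The distribution may be moved under the integral because the convolution is the limit, in the
  Schwartz topology, of the finite sums obtained by replacing \<open>z\<close> with simple functions \<open>\<sigma> i z\<close>
  that converge to \<open>z\<close>.\<close>

lemma conv_dist_reproducing:
  fixes \<psi> K :: "'a::euclidean_space \<Rightarrow> complex"
  assumes u: "u \<in> tempered" and K: "K \<in> schwartz" and \<psi>: "\<psi> \<in> schwartz"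
    and eq: "conv_fun K \<psi> = \<psi>"
  shows "conv_dist \<psi> u x = (\<integral>z. K z * conv_dist \<psi> u (x - z) \<partial>lborel)" (is ?eq)
    and "integrable lborel (\<lambda>z. K z * conv_dist \<psi> u (x - z))" (is ?int)
proof -
  have Ki: "integrable lborel K" by (rule schwartz_integrable[OF K])
  have [measurable]: "K \<in> borel_measurable borel" "\<psi> \<in> borel_measurable borel"
    using K \<psi> by auto
  define v where "v = conv_dist \<psi> u"
  have vc: "continuous_on UNIV v" unfolding v_def by (rule continuous_on_conv_dist[OF u \<psi>])
  have [measurable]: "v \<in> borel_measurable borel" using vc by (rule borel_measurable_continuous_onI)
  obtain D M where D: "D > 0" "\<And>a. cmod (v a) \<le> D * (1 + norm a) ^ M"
    unfolding v_def using conv_dist_polynomial_growth[OF u \<psi>] by blast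
  \<comment> \<open>The sum \<open>2 * norm x + 3 * norm z\<close> bounds the norms of
    \<open>x - \<sigma> i z\<close> and \<open>x - z\<close> together, because
    \<open>norm (\<sigma> i z) \<le> 2 * norm z\<close>. Splitting off the factor in
    \<open>x\<close> leaves a power of \<open>1 + norm z\<close> that \<open>K\<close> can
    absorb.\<close>
  have weight: "(1 + 2 * norm x + 3 * norm z) ^ N \<le> (3 * (1 + norm x)) ^ N * (1 + norm z) ^ N" for z :: 'a and N
  proof -
    have "0 \<le> norm x * norm z" by simp
    then have "1 + 2 * norm x + 3 * norm z \<le> (3 * (1 + norm x)) * (1 + norm z)"
      using norm_ge_zero[of x] by (simp add: algebra_simps del: norm_ge_zero zero_le_mult_iff)
    then show ?thesis by (simp add: power_mono flip: power_mult_distrib)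
  qed
  have Kw: "integrable lborel (\<lambda>z. (1 + norm z) ^ N * cmod (K z))" for N
    by (intro rapidly_decreasing_integrable schwartz_rapidly_decreasing K) simp
  have v_bound: "cmod (v w) \<le> D * (3 * (1 + norm x)) ^ M * (1 + norm z) ^ M" if "norm w \<le> norm x + 2 * norm z" for w z :: 'a
  proof -
    have "1 + norm w \<le> 1 + 2 * norm x + 3 * norm z"
      using that norm_ge_zero[of x] norm_ge_zero[of z] by linarith
    then have "(1 + norm w) ^ M \<le> (1 + 2 * norm x + 3 * norm z) ^ M"
      by (intro power_mono) auto
    then have "D * (1 + norm w) ^ M \<le> D * ((3 * (1 + norm x)) ^ M * (1 + norm z) ^ M)"
      using D(1) weight[of z M] by (intro mult_left_mono) auto
    with D(2)[of w] show ?thesis by (simp add: mult.assoc)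
  qed
  \<comment> \<open>One majorant for both the integrand at \<open>x - z\<close> and its
    discretisation at \<open>x - \<sigma> i z\<close>: both points have norm at most
    \<open>norm x + 2 * norm z\<close>.\<close>
  define W where "W z = D * (3 * (1 + norm x)) ^ M * ((1 + norm z) ^ M * cmod (K z))" for z
  have W: "integrable lborel W" unfolding W_def by (intro integrable_mult_right Kw)
  have Kv_bound: "cmod (K z * v w) \<le> W z" if "norm w \<le> norm x + 2 * norm z" for w z
    using mult_left_mono[OF v_bound[OF that], of "cmod (K z)"] by (simp add: norm_mult W_def mult_ac)
  show ?int
    unfolding v_def[symmetric]
  proof (rule Bochner_Integration.integrable_bound[OF W])
    show "AE z in lborel. norm (K z * v (x - z)) \<le> norm (W z)"
    proof (rule AE_I2)
      fix z show "norm (K z * v (x - z)) \<le> norm (W z)"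
        using Kv_bound[of "x - z" z] norm_triangle_ineq4[of x z] norm_ge_zero[of z]
        by (smt (verit) real_norm_def)
    qed
  qed measurable
  obtain \<sigma> :: "nat \<Rightarrow> 'a \<Rightarrow> 'a" where \<sigma>: "\<And>i. simple_function lborel (\<sigma> i)"
    "\<And>z. (\<lambda>i. \<sigma> i z) \<longlonglongrightarrow> z" "\<And>i z. norm (\<sigma> i z) \<le> 2 * norm z"
  proof -
    have "\<exists>F. (\<forall>i. simple_function lborel (F i)) \<and> (\<forall>x\<in>space lborel. (\<lambda>i. F i x) \<longlonglongrightarrow> x) \<and>
      (\<forall>i. \<forall>x\<in>space lborel. dist (F i x) (0::'a) \<le> 2 * dist x 0)"
      by (rule borel_measurable_implies_sequence_metric) simp
    then show ?thesis using that by auto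
  qed
  have [measurable]: "\<sigma> i \<in> borel_measurable borel" for i
    using borel_measurable_simple_function[OF \<sigma>(1)[of i]] by simp
  define R where "R i = range (\<sigma> i)" for i
  have R: "finite (R i)" for i
    using simple_functionD(1)[OF \<sigma>(1)[of i]] unfolding R_def space_lborel space_borel .
  \<comment> \<open>The integral of \<open>K\<close> over a level set of \<open>\<sigma> i\<close>.
    With these weights, integrals of functions of \<open>\<sigma> i z\<close> against
    \<open>K\<close> are finite sums, to which linearity of \<open>u\<close> applies.\<close>
  define \<kappa> where "\<kappa> i g = (\<integral>z. K z * indicator {z. \<sigma> i z = g} z \<partial>lborel)" for i g
  have discretize: "(\<Sum>g\<in>R i. \<kappa> i g * h g) = (\<integral>z. K z * h (\<sigma> i z) \<partial>lborel)"
    and discretize_int: "integrable lborel (\<lambda>z. K z * h (\<sigma> i z))" for i and h :: "'a \<Rightarrow> complex"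
  proof -
    have int: "integrable lborel (\<lambda>z. K z * indicator {z. \<sigma> i z = g} z * h g)" for g
    proof (intro integrable_mult_left Bochner_Integration.integrable_bound[OF Ki])
      show "AE z in lborel. norm (K z * indicator {z. \<sigma> i z = g} z) \<le> norm (K z)"
        by (auto simp: indicator_def)
    qed measurable
    have sum: "K z * h (\<sigma> i z) = (\<Sum>g\<in>R i. K z * indicator {z. \<sigma> i z = g} z * h g)" for z
    proof -
      have "(\<Sum>g\<in>R i. K z * indicator {z. \<sigma> i z = g} z * h g) = (\<Sum>g\<in>{\<sigma> i z}. K z * indicator {z. \<sigma> i z = g} z * h g)"
        by (rule sum.mono_neutral_right) (use R[of i] in \<open>auto simp: R_def indicator_def\<close>)
      then show ?thesis by simp
    qed
    show "integrable lborel (\<lambda>z. K z * h (\<sigma> i z))"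
      unfolding sum by (intro Bochner_Integration.integrable_sum int)
    show "(\<Sum>g\<in>R i. \<kappa> i g * h g) = (\<integral>z. K z * h (\<sigma> i z) \<partial>lborel)"
      unfolding sum using int by (subst Bochner_Integration.integral_sum) (auto simp: \<kappa>_def)
  qed
  define S where "S i y = (\<Sum>g\<in>R i. \<kappa> i g * \<psi> (x - g - y))" for i y
  have refl: "(\<lambda>y. \<psi> (a - y)) \<in> schwartz" for a by (rule schwartz_reflect[OF \<psi>])
  have S: "S i \<in> schwartz" for i
    unfolding S_def[abs_def] by (intro schwartz_sum refl)
  have uS: "u (S i) = (\<integral>z. K z * v (x - \<sigma> i z) \<partial>lborel)" for i
  proof -
    have "u (S i) = (\<Sum>g\<in>R i. \<kappa> i g * u (\<lambda>y. \<psi> (x - g - y)))"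
      unfolding S_def[abs_def] by (intro tempered_sum[OF u R] refl)
    then show ?thesis using discretize[of i "\<lambda>g. v (x - g)"] by (simp add: v_def conv_dist_def)
  qed
  have lim1: "(\<lambda>i. u (S i)) \<longlonglongrightarrow> (\<integral>z. K z * v (x - z) \<partial>lborel)"
    unfolding uS
  proof (rule integral_dominated_convergence[where w = W])
    show "AE z in lborel. (\<lambda>i. K z * v (x - \<sigma> i z)) \<longlonglongrightarrow> K z * v (x - z)"
    proof (intro always_eventually allI tendsto_mult tendsto_const)
      fix z
      have "(\<lambda>i. x - \<sigma> i z) \<longlonglongrightarrow> x - z" by (intro tendsto_intros \<sigma>)
      then show "(\<lambda>i. v (x - \<sigma> i z)) \<longlonglongrightarrow> v (x - z)"
        using vc by (intro continuous_on_tendsto_compose[of UNIV v]) auto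
    qed
    show "AE z in lborel. norm (K z * v (x - \<sigma> i z)) \<le> W z" for i
    proof (intro always_eventually allI Kv_bound)
      fix z show "norm (x - \<sigma> i z) \<le> norm x + 2 * norm z"
        using norm_triangle_ineq4[of x "\<sigma> i z"] \<sigma>(3)[of i z] by simp
    qed
  qed (use W in auto)
  obtain C0 N where C0: "C0 \<ge> 0" "\<And>g. g \<in> schwartz \<Longrightarrow> cmod (u g) \<le> C0 * seminorm_sum N g"
    using temperedE[OF u] by blast
  obtain C where C: "C > 0"
    "\<And>bs a b y. set bs \<subseteq> Basis \<Longrightarrow> length bs \<le> N \<Longrightarrow>
      (1 + norm y) ^ N * cmod (partial_derivs bs \<psi> (a - y) - partial_derivs bs \<psi> (b - y))
        \<le> C * (1 + norm a + norm b) ^ N * norm (a - b)"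
    using schwartz_translation_bound_derivs[OF \<psi>, of N] by blast
  \<comment> \<open>Bounds the weighted discretisation error at \<open>z\<close> simultaneously for
    all points \<open>y\<close> and all derivatives of order at most \<open>N\<close>, which is what
    convergence in the relevant seminorms demands.\<close>
  define e where "e i z = cmod (K z) * (C * (1 + 2 * norm x + 3 * norm z) ^ N * norm (\<sigma> i z - z))" for i z
  define e' where "e' z = C * (3 * (1 + norm x)) ^ N * 3 * ((1 + norm z) ^ Suc N * cmod (K z))" for z
  have e': "integrable lborel e'" unfolding e'_def by (intro integrable_mult_right Kw)
  have em [measurable]: "e i \<in> borel_measurable borel" for i unfolding e_def[abs_def] by measurable
  have e_le: "norm (e i z) \<le> e' z" for i z
  proof -
    have "norm (\<sigma> i z - z) \<le> 3 * (1 + norm z)"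
      using norm_triangle_ineq4[of "\<sigma> i z" z] \<sigma>(3)[of i z] by simp
    then have "e i z \<le> cmod (K z) * (C * ((3 * (1 + norm x)) ^ N * (1 + norm z) ^ N) * (3 * (1 + norm z)))"
      unfolding e_def using C(1) weight by (intro mult_left_mono mult_mono) auto
    also have "\<dots> = e' z" by (simp add: e'_def mult_ac)
    finally show ?thesis using C(1) by (simp add: e_def)
  qed
  have ei: "integrable lborel (e i)" for i
    by (rule Bochner_Integration.integrable_bound[OF e']) (use e_le in \<open>auto intro: order_trans[OF _ abs_ge_self]\<close>)
  have lim_e: "(\<lambda>i. \<integral>z. e i z \<partial>lborel) \<longlonglongrightarrow> (\<integral>z. 0 \<partial>(lborel::'a measure))"
  proof (rule integral_dominated_convergence[where w = e'])
    show "AE z in lborel. (\<lambda>i. e i z) \<longlonglongrightarrow> 0"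
    proof (rule AE_I2)
      fix z
      have "(\<lambda>i. e i z) \<longlonglongrightarrow> cmod (K z) * (C * (1 + 2 * norm x + 3 * norm z) ^ N * norm (z - z))"
        unfolding e_def by (intro tendsto_intros \<sigma>)
      then show "(\<lambda>i. e i z) \<longlonglongrightarrow> 0" by simp
    qed
  qed (use e' e_le in auto)
  define m where "m = real (card {bs::'a list. set bs \<subseteq> Basis \<and> length bs \<le> N})"
  have diff: "cmod (u (S i) - v x) \<le> C0 * (m * (\<integral>z. e i z \<partial>lborel))" for i
  proof -
    let ?T = "\<lambda>y. S i y - \<psi> (x - y)"
    have T: "?T \<in> schwartz" using schwartz_lincomb[OF S[of i] refl[of x], of 1 "-1"] by simp
    have "schwartz_seminorm N bs ?T \<le> (\<integral>z. e i z \<partial>lborel)" if bs: "set bs \<subseteq> Basis" "length bs \<le> N" for bs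
    proof (rule schwartz_seminorm_le)
      fix y
      define \<psi>' where "\<psi>' = partial_derivs bs \<psi>"
      have \<psi>': "\<psi>' \<in> schwartz" unfolding \<psi>'_def by (rule schwartz_partial_derivs[OF \<psi> bs(1)])
      \<comment> \<open>The reproducing identity passes to derivatives, so each seminorm compares
        the discretised integral with the integral it approximates.\<close>
      have conv: "\<psi>' = conv_fun K \<psi>'"
        unfolding \<psi>'_def
        by (rule schwartz_convolution_partial_derivs[OF Ki \<psi> \<psi> eq[symmetric] bs(1)])
      have dS: "partial_derivs bs (S i) = (\<lambda>y. \<Sum>g\<in>R i. \<kappa> i g * ((-1) ^ length bs * \<psi>' (x - g - y)))"
        unfolding S_def[abs_def] \<psi>'_def
        by (subst partial_derivs_sum[OF refl bs(1)]) (simp only: partial_derivs_reflect[OF \<psi> bs(1)])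
      have "partial_derivs bs (\<lambda>y. 1 * S i y + (-1) * \<psi> (x - y)) y
          = (\<Sum>g\<in>R i. \<kappa> i g * ((-1) ^ length bs * \<psi>' (x - g - y))) - (-1) ^ length bs * \<psi>' (x - y)"
        unfolding partial_derivs_lincomb[OF S refl bs(1)] dS partial_derivs_reflect[OF \<psi> bs(1)] \<psi>'_def
        by simp
      also have "\<dots> = (-1) ^ length bs * ((\<Sum>g\<in>R i. \<kappa> i g * \<psi>' (x - g - y)) - \<psi>' (x - y))"
        by (simp add: sum_distrib_left algebra_simps)
      also have "(\<Sum>g\<in>R i. \<kappa> i g * \<psi>' (x - g - y)) = (\<integral>z. K z * \<psi>' (x - \<sigma> i z - y) \<partial>lborel)"
        by (rule discretize[of i "\<lambda>g. \<psi>' (x - g - y)"])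
      also have "\<psi>' (x - y) = (\<integral>z. K z * \<psi>' (x - y - z) \<partial>lborel)"
        by (subst conv) (simp only: conv_fun_def)
      also have "(\<integral>z. K z * \<psi>' (x - \<sigma> i z - y) \<partial>lborel) - (\<integral>z. K z * \<psi>' (x - y - z) \<partial>lborel)
          = (\<integral>z. K z * \<psi>' (x - \<sigma> i z - y) - K z * \<psi>' (x - y - z) \<partial>lborel)"
        by (rule Bochner_Integration.integral_diff[symmetric])
           (intro discretize_int[of "\<lambda>g. \<psi>' (x - g - y)"] convolution_integrand_integrable[OF Ki \<psi>'])+
      finally have D_eq: "cmod (partial_derivs bs ?T y)
          = cmod (\<integral>z. K z * \<psi>' (x - \<sigma> i z - y) - K z * \<psi>' (x - y - z) \<partial>lborel)"
        by (simp add: norm_mult norm_power)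
      have pos: "(1 + norm y) ^ N > 0" by (simp add: add_pos_nonneg)
      have "(1 + norm y) ^ N * cmod (partial_derivs bs ?T y)
          = cmod (\<integral>z. of_real ((1 + norm y) ^ N) * (K z * \<psi>' (x - \<sigma> i z - y) - K z * \<psi>' (x - y - z)) \<partial>lborel)"
        unfolding D_eq Bochner_Integration.integral_mult_right_zero norm_mult norm_of_real abs_of_pos[OF pos] ..
      also have "\<dots> \<le> (\<integral>z. e i z \<partial>lborel)"
      proof (rule Bochner_Integration.integral_norm_bound_integral[OF _ ei])
        show "integrable lborel (\<lambda>z. of_real ((1 + norm y) ^ N) * (K z * \<psi>' (x - \<sigma> i z - y) - K z * \<psi>' (x - y - z)))"
          by (intro integrable_mult_right Bochner_Integration.integrable_diff
              discretize_int[of "\<lambda>g. \<psi>' (x - g - y)"] convolution_integrand_integrable[OF Ki \<psi>'])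
        fix z
        have "norm (x - \<sigma> i z) \<le> norm x + 2 * norm z" "norm (x - z) \<le> norm x + norm z"
          using norm_triangle_ineq4[of x "\<sigma> i z"] \<sigma>(3)[of i z] norm_triangle_ineq4[of x z] by auto
        then have w: "(1 + norm (x - \<sigma> i z) + norm (x - z)) ^ N \<le> (1 + 2 * norm x + 3 * norm z) ^ N"
          by (intro power_mono) (auto intro: add_nonneg_nonneg)
        have "(1 + norm y) ^ N * cmod (\<psi>' (x - \<sigma> i z - y) - \<psi>' (x - z - y))
            \<le> C * (1 + norm (x - \<sigma> i z) + norm (x - z)) ^ N * norm ((x - \<sigma> i z) - (x - z))"
          unfolding \<psi>'_def by (rule C(2)[OF bs])
        also have "\<dots> \<le> C * (1 + 2 * norm x + 3 * norm z) ^ N * norm (\<sigma> i z - z)"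
          using C(1) w by (intro mult_mono) (auto simp: norm_minus_commute)
        finally have "cmod (K z) * ((1 + norm y) ^ N * cmod (\<psi>' (x - \<sigma> i z - y) - \<psi>' (x - z - y))) \<le> e i z"
          unfolding e_def by (rule mult_left_mono) simp
        moreover have "K z * \<psi>' (x - \<sigma> i z - y) - K z * \<psi>' (x - y - z) = K z * (\<psi>' (x - \<sigma> i z - y) - \<psi>' (x - z - y))"
          by (simp add: algebra_simps)
        ultimately show "norm (of_real ((1 + norm y) ^ N) * (K z * \<psi>' (x - \<sigma> i z - y) - K z * \<psi>' (x - y - z))) \<le> e i z"
          by (simp only: norm_mult norm_of_real abs_of_pos[OF pos] mult_ac)
      qed
      finally show "(1 + norm y) ^ N * cmod (partial_derivs bs ?T y) \<le> (\<integral>z. e i z \<partial>lborel)" .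
    qed
    then have "seminorm_sum N ?T \<le> m * (\<integral>z. e i z \<partial>lborel)"
      unfolding seminorm_sum_def m_def by (intro sum_bounded_above) auto
    then have "C0 * seminorm_sum N ?T \<le> C0 * (m * (\<integral>z. e i z \<partial>lborel))"
      using C0(1) by (rule mult_left_mono)
    moreover have "u ?T = u (S i) - v x"
      unfolding v_def conv_dist_def by (rule tempered_diff[OF u S refl])
    ultimately show ?thesis using C0(2)[OF T] by simp
  qed
  \<comment> \<open>Together with \<open>lim1\<close> this computes the limit of
    \<open>u (S i)\<close> twice.\<close>
  have "(\<lambda>i. u (S i)) \<longlonglongrightarrow> v x"
  proof (rule Lim_transform_bound[THEN LIM_zero_cancel])
    show "eventually (\<lambda>i. norm (u (S i) - v x) \<le> norm (C0 * (m * (\<integral>z. e i z \<partial>lborel)))) sequentially"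
      using diff by (auto intro!: always_eventually order_trans[OF _ abs_ge_self])
    have "(\<lambda>i. C0 * (m * (\<integral>z. e i z \<partial>lborel))) \<longlonglongrightarrow> C0 * (m * (\<integral>z. 0 \<partial>(lborel::'a measure)))"
      by (intro tendsto_intros lim_e)
    then show "(\<lambda>i. C0 * (m * (\<integral>z. e i z \<partial>lborel))) \<longlonglongrightarrow> 0" by simp
  qed
  from LIMSEQ_unique[OF this lim1] show ?eq by (simp add: v_def)
qed

section \<open>Bernstein's inequality and the embedding\<close>

lemma infsum_two_sided_geometric_finite:
  assumes "\<epsilon> > 0"
  shows "(\<Sum>\<^sub>\<infinity>k\<in>(UNIV::int set). ennreal (2 powr (- \<epsilon> * \<bar>real_of_int k\<bar>))) < \<infinity>"
proof -
  define \<rho> where "\<rho> = 2 powr (- \<epsilon>)"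
  have \<rho>: "0 < \<rho>" "\<rho> < 1" using assms by (auto simp: \<rho>_def powr_less_one)
  have geom: "2 powr (- \<epsilon> * real n) = \<rho> ^ n" for n :: nat
    by (simp add: \<rho>_def powr_realpow[symmetric] powr_powr)
  have "(\<Sum>k\<in>F. ennreal (2 powr (- \<epsilon> * \<bar>real_of_int k\<bar>))) \<le> ennreal (2 * (1 / (1 - \<rho>)))"
    if F: "finite F" for F :: "int set"
  proof -
    have S: "(\<Sum>n\<in>G. \<rho> ^ n) \<le> 1 / (1 - \<rho>)" if "finite G" for G :: "nat set"
      using sum_le_suminf[OF summable_geometric that, of \<rho>] \<rho> suminf_geometric[of \<rho>] by simp
    have "(\<Sum>k\<in>F. 2 powr (- \<epsilon> * \<bar>real_of_int k\<bar>))
        = (\<Sum>k\<in>F \<inter> {0..}. 2 powr (- \<epsilon> * \<bar>real_of_int k\<bar>)) + (\<Sum>k\<in>F - {0..}. 2 powr (- \<epsilon> * \<bar>real_of_int k\<bar>))"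
      by (rule sum.Int_Diff[OF F])
    also have "(\<Sum>k\<in>F \<inter> {0..}. 2 powr (- \<epsilon> * \<bar>real_of_int k\<bar>)) = (\<Sum>n\<in>nat ` (F \<inter> {0..}). \<rho> ^ n)"
      by (subst sum.reindex) (auto simp: inj_on_def geom[symmetric] intro!: sum.cong)
    also have "(\<Sum>k\<in>F - {0..}. 2 powr (- \<epsilon> * \<bar>real_of_int k\<bar>)) = (\<Sum>n\<in>(\<lambda>k. nat (- k)) ` (F - {0..}). \<rho> ^ n)"
      by (subst sum.reindex) (auto simp: inj_on_def geom[symmetric] intro!: sum.cong)
    finally have "(\<Sum>k\<in>F. 2 powr (- \<epsilon> * \<bar>real_of_int k\<bar>)) \<le> 2 * (1 / (1 - \<rho>))"
      using S[of "nat ` (F \<inter> {0..})"] S[of "(\<lambda>k. nat (- k)) ` (F - {0..})"] F by simp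
    then show ?thesis by (subst sum_ennreal) (auto intro: ennreal_leI)
  qed
  then have "(\<Sum>\<^sub>\<infinity>k\<in>(UNIV::int set). ennreal (2 powr (- \<epsilon> * \<bar>real_of_int k\<bar>))) \<le> ennreal (2 * (1 / (1 - \<rho>)))"
    by (subst nonneg_infsum_complete) (auto intro!: SUP_least)
  then show ?thesis by (rule le_less_trans) simp
qed

lemma infsum_cmult_ennreal:
  "(\<Sum>\<^sub>\<infinity>k\<in>A. c * f k) = c * (\<Sum>\<^sub>\<infinity>k\<in>A. f k)" for c :: ennreal
  by (subst (1 2) nonneg_infsum_complete) (simp_all add: SUP_mult_left_ennreal sum_distrib_left)

text \<open>One bound decreases geometrically in \<open>k\<close>, the other increases. They cross
  at the common value \<open>B powr (\<beta> / (\<alpha> + \<beta>)) * h powr (\<alpha> / (\<alpha>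
  + \<beta>))\<close>, and their minimum decays geometrically on both sides of the crossing;
  \<open>q\<close> influences only the constant.\<close>

lemma infsum_two_sided_decay:
  fixes a :: "int \<Rightarrow> real"
  assumes \<alpha>: "\<alpha> > 0" and \<beta>: "\<beta> > 0" and q: "q > 0"
  obtains C where "C > 0"
    "\<And>a h B. \<lbrakk>h \<ge> 0; B > 0; \<And>k::int. 0 \<le> a k; \<And>k. a k \<le> 2 powr (- (k * \<beta>)) * h;
        \<And>k. a k \<le> 2 powr (k * \<alpha>) * B\<rbrakk> \<Longrightarrow>
      (\<Sum>\<^sub>\<infinity>k\<in>UNIV. ennreal (a k powr q))
        \<le> ennreal (C * (B powr (\<beta> / (\<alpha> + \<beta>)) * h powr (\<alpha> / (\<alpha> + \<beta>))) powr q)"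
proof -
  define \<gamma> where "\<gamma> = min \<alpha> \<beta>"
  have \<gamma>: "\<gamma> > 0" "\<gamma> \<le> \<alpha>" "\<gamma> \<le> \<beta>" using \<alpha> \<beta> by (auto simp: \<gamma>_def)
  define f where "f k = ennreal (2 powr (- (\<gamma> * q) * \<bar>real_of_int k\<bar>))" for k
  have "(\<Sum>\<^sub>\<infinity>k\<in>UNIV. f k) < \<infinity>"
    unfolding f_def by (rule infsum_two_sided_geometric_finite) (use \<gamma> q in simp)
  then obtain G where G: "G \<ge> 0" "(\<Sum>\<^sub>\<infinity>k\<in>UNIV. f k) = ennreal G"
    by (cases "\<Sum>\<^sub>\<infinity>k\<in>UNIV. f k") auto
  \<comment> \<open>The factor \<open>2 powr (\<gamma> * q)\<close> pays for replacing the real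
    crossing index by its floor, and the 1 keeps \<open>C\<close> positive.\<close>
  define C where "C = 2 powr (\<gamma> * q) * G + 1"
  show ?thesis
  proof (rule that[of C])
    show C: "C > 0" using G by (simp add: C_def add_nonneg_pos)
    fix a :: "int \<Rightarrow> real" and h B
    assume h: "h \<ge> 0" and B: "B > 0" and a: "\<And>k. 0 \<le> a k" "\<And>k. a k \<le> 2 powr (- (k * \<beta>)) * h"
        "\<And>k. a k \<le> 2 powr (k * \<alpha>) * B"
    define M where "M = B powr (\<beta> / (\<alpha> + \<beta>)) * h powr (\<alpha> / (\<alpha> + \<beta>))"
    show "(\<Sum>\<^sub>\<infinity>k\<in>UNIV. ennreal (a k powr q)) \<le> ennreal (C * M powr q)"
    proof (cases "h = 0")
      case True
      then have "a k = 0" for k using a(1,2)[of k] by simp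
      then show ?thesis using q by simp
    next
      case False
      with h have h: "h > 0" by simp
      \<comment> \<open>The two bounds on a cross at the real index \<kappa>, with common value M.\<close>
      define \<kappa> where "\<kappa> = log 2 (h / B) / (\<alpha> + \<beta>)"
      have hB: "h / B = 2 powr (\<kappa> * (\<alpha> + \<beta>))"
        using h B \<alpha> \<beta> by (simp add: \<kappa>_def)
      then have h_eq: "h = 2 powr (\<kappa> * (\<alpha> + \<beta>)) * B" using B by (simp add: field_simps)
      have ab: "(\<alpha> + \<beta>) * (\<alpha> / (\<alpha> + \<beta>)) = \<alpha>" "\<beta> / (\<alpha> + \<beta>) + \<alpha> / (\<alpha> + \<beta>) = 1"
        using \<alpha> \<beta> by (auto simp: add_divide_distrib[symmetric])
      have "M = 2 powr (\<kappa> * ((\<alpha> + \<beta>) * (\<alpha> / (\<alpha> + \<beta>)))) * (B powr (\<beta> / (\<alpha> + \<beta>)) * B powr (\<alpha> / (\<alpha> + \<beta>)))"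
        unfolding M_def using B by (subst h_eq) (simp add: powr_mult powr_powr mult_ac)
      then have M1: "M = 2 powr (\<kappa> * \<alpha>) * B"
        using B by (simp only: ab powr_add[symmetric]) simp
      have M2: "M = 2 powr (- (\<kappa> * \<beta>)) * h"
        unfolding M1 h_eq by (simp add: powr_add[symmetric] algebra_simps flip: mult.assoc)
      have M: "M > 0" using B by (simp add: M1)
      have dec: "a k \<le> M * 2 powr (- \<gamma> * \<bar>real_of_int k - \<kappa>\<bar>)" for k
      proof (cases "real_of_int k \<ge> \<kappa>")
        case True
        have "a k \<le> 2 powr (- (k * \<beta>)) * h" by (rule a)
        also have "\<dots> = M * 2 powr (- \<beta> * (real_of_int k - \<kappa>))"
          unfolding M2 by (simp add: powr_add[symmetric] algebra_simps)
        also have "\<dots> \<le> M * 2 powr (- \<gamma> * \<bar>real_of_int k - \<kappa>\<bar>)"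
          using True \<gamma> M by (intro mult_left_mono powr_mono) (auto intro!: mult_right_mono)
        finally show ?thesis .
      next
        case False
        have "a k \<le> 2 powr (k * \<alpha>) * B" by (rule a)
        also have "\<dots> = M * 2 powr (- \<alpha> * (\<kappa> - real_of_int k))"
          unfolding M1 by (simp add: powr_add[symmetric] algebra_simps)
        also have "\<dots> \<le> M * 2 powr (- \<gamma> * \<bar>real_of_int k - \<kappa>\<bar>)"
          using False \<gamma> M by (intro mult_left_mono powr_mono) (auto intro!: mult_right_mono)
        finally show ?thesis .
      qed
      define j where "j = \<lfloor>\<kappa>\<rfloor>"
      have term_le: "ennreal (a k powr q) \<le> ennreal (M powr q * 2 powr (\<gamma> * q)) * f (k - j)" for k
      proof -
        have "\<bar>real_of_int (k - j)\<bar> - 1 \<le> \<bar>real_of_int k - \<kappa>\<bar>"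
          unfolding j_def by linarith
        then have "\<gamma> * (\<bar>real_of_int (k - j)\<bar> - 1) \<le> \<gamma> * \<bar>real_of_int k - \<kappa>\<bar>"
          using \<gamma> by (intro mult_left_mono) auto
        then have "M * 2 powr (- \<gamma> * \<bar>real_of_int k - \<kappa>\<bar>) \<le> M * 2 powr (\<gamma> - \<gamma> * \<bar>real_of_int (k - j)\<bar>)"
          using M by (intro mult_left_mono powr_mono) (auto simp: algebra_simps)
        with dec[of k] have "a k \<le> M * 2 powr (\<gamma> - \<gamma> * \<bar>real_of_int (k - j)\<bar>)" by linarith
        then have "a k powr q \<le> (M * 2 powr (\<gamma> - \<gamma> * \<bar>real_of_int (k - j)\<bar>)) powr q"
          using a(1) q by (intro powr_mono2) auto
        also have "\<dots> = M powr q * 2 powr ((\<gamma> - \<gamma> * \<bar>real_of_int (k - j)\<bar>) * q)"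
          using M by (simp add: powr_mult powr_powr)
        also have "(\<gamma> - \<gamma> * \<bar>real_of_int (k - j)\<bar>) * q = \<gamma> * q + - (\<gamma> * q) * \<bar>real_of_int (k - j)\<bar>"
          by (simp add: algebra_simps)
        also have "M powr q * 2 powr (\<gamma> * q + - (\<gamma> * q) * \<bar>real_of_int (k - j)\<bar>)
            = M powr q * 2 powr (\<gamma> * q) * 2 powr (- (\<gamma> * q) * \<bar>real_of_int (k - j)\<bar>)"
          by (simp only: powr_add mult.assoc)
        finally show ?thesis
          unfolding f_def by (subst ennreal_mult'[symmetric]) (auto intro!: ennreal_leI)
      qed
      have "(\<Sum>\<^sub>\<infinity>k\<in>UNIV. ennreal (a k powr q)) \<le> (\<Sum>\<^sub>\<infinity>k\<in>UNIV. ennreal (M powr q * 2 powr (\<gamma> * q)) * f (k - j))"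
        by (intro infsum_mono nonneg_summable_on_complete term_le) auto
      also have "\<dots> = ennreal (M powr q * 2 powr (\<gamma> * q)) * (\<Sum>\<^sub>\<infinity>k\<in>UNIV. f (k - j))"
        by (rule infsum_cmult_ennreal)
      also have "(\<Sum>\<^sub>\<infinity>k\<in>UNIV. f (k - j)) = (\<Sum>\<^sub>\<infinity>k\<in>UNIV. f k)"
        by (rule infsum_reindex_bij_betw) (auto intro!: bij_betwI[where g = "\<lambda>k. k + j"])
      also have "ennreal (M powr q * 2 powr (\<gamma> * q)) * (\<Sum>\<^sub>\<infinity>k\<in>UNIV. f k) = ennreal (M powr q * 2 powr (\<gamma> * q) * G)"
        unfolding G(2) using G(1) by (simp add: ennreal_mult')
      also have "\<dots> \<le> ennreal (C * M powr q)"
        by (intro ennreal_leI) (simp add: C_def algebra_simps)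
      finally show ?thesis .
    qed
  qed
qed

context littlewood_paley
begin

text \<open>The piece of index \<open>k\<close> has frequencies below \<open>2 powi (k + 2)\<close>,
  and on that ball the transform of the dilated generator equals 1.\<close>

lemma lp_piece_reproducing:
  "conv_fun (dilate (2 powi (k + 2)) \<phi>) (lp_piece \<phi> k) = lp_piece \<phi> k"
proof -
  let ?K = "dilate (2 powi (k + 2)) \<phi>"
  have K: "?K \<in> schwartz" by (intro dilate_schwartz phi_schwartz) simp
  have Ki: "integrable lborel ?K" by (rule schwartz_integrable[OF K])
  obtain B where B: "\<And>x. cmod (conv_fun ?K (lp_piece \<phi> k) x) \<le> B"
    using convolution_bounded[OF Ki lp_piece_schwartz] by blast
  obtain B' where B': "B' > 0" "\<And>x. cmod (lp_piece \<phi> k x) \<le> B'"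
    using schwartz_bounded[OF lp_piece_schwartz] by blast
  show ?thesis
  proof (rule fourier_injective[OF _ _ B _ _ B'(2)])
    fix \<xi>
    show "fourier (conv_fun ?K (lp_piece \<phi> k)) \<xi> = fourier (lp_piece \<phi> k) \<xi>"
    proof (cases "chi ((2 powi (- k)) *\<^sub>R \<xi>) = 0")
      case True
      then show ?thesis
        by (simp add: fourier_convolution[OF Ki lp_piece_schwartz] fourier_lp_piece)
    next
      case False
      then have "norm ((2 powi (- k)) *\<^sub>R \<xi>) < 4" using chi_eq_0 by (meson not_le)
      then have "norm (\<xi> /\<^sub>R 2 powi (k + 2)) \<le> 1"
        by (simp add: power_int_minus power_int_add field_simps)
      then have "fourier ?K \<xi> = 1"
        by (subst fourier_dilate) (simp_all add: fourier_phi_le phi_schwartz schwartz_measurable)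
      then show ?thesis
        by (simp add: fourier_convolution[OF Ki lp_piece_schwartz])
    qed
  qed (intro continuous_on_convolution[OF Ki lp_piece_schwartz] integrable_convolution[OF Ki lp_piece_schwartz]
        schwartz_continuous schwartz_integrable lp_piece_schwartz)+
qed

text \<open>Takes the place of Hoelder's inequality in \<open>bernstein\<close>: applied to a
  suitably normalised quantity, it loses only a constant.\<close>

lemma le_1_plus_powr: "b \<ge> 0 \<Longrightarrow> p \<ge> 1 \<Longrightarrow> b \<le> 1 + b powr p" for b p :: real
  by (cases "b \<le> 1") (use powr_mono[of 1 p b] powr_ge_zero[of b p] in \<open>auto simp: powr_one intro: order_trans\<close>)

text \<open>By the reproducing formula the block is its own average against a kernel
  \<open>K\<close> with integral norm \<open>L\<close> and supremum at most
  \<open>M * 2 powr (k * DIM('a))\<close>. The bound \<open>b \<le> 1 + b powr p\<close> splits the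
  average into a term controlled by \<open>L\<close> and one controlled by \<open>M\<close>. The
  weight \<open>w\<close> travels along so that the constant is independent of it.\<close>

lemma bernstein:
  obtains C where "C > 0"
    "\<And>u p A w k x. \<lbrakk>u \<in> tempered; p \<ge> 1; A > 0; w > 0;
       (\<integral>\<^sup>+x. ennreal ((w * cmod (\<Delta> k u x)) powr p) \<partial>lborel) \<le> ennreal (A powr p)\<rbrakk>
     \<Longrightarrow> w * cmod (\<Delta> k u x) \<le> C * A * 2 powr (k * real DIM('a) / p)"
proof -
  \<comment> \<open>The reproducing kernel is the generator dilated by
    \<open>2 powi (k + 2)\<close>; the factor 4 is stored here, leaving a dilation by
    \<open>2 powi k\<close>.\<close>
  define \<theta> where "\<theta> = dilate 4 \<phi>"
  have \<theta>: "\<theta> \<in> schwartz" unfolding \<theta>_def by (intro dilate_schwartz phi_schwartz) simp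
  have [measurable]: "\<theta> \<in> borel_measurable borel" by (rule schwartz_measurable[OF \<theta>])
  obtain M where M: "M > 0" "\<And>x. cmod (\<theta> x) \<le> M" using schwartz_bounded[OF \<theta>] by blast
  define L where "L = (\<integral>x. cmod (\<theta> x) \<partial>lborel)"
  have L: "L \<ge> 0" by (simp add: L_def)
  show ?thesis
  proof (rule that[of "L + M"])
    show "L + M > 0" using L M by simp
    fix u p A w k and x :: 'a
    assume u: "u \<in> tempered" and p: "p \<ge> 1" and A: "A > 0" and w: "w > 0"
      and int: "(\<integral>\<^sup>+x. ennreal ((w * cmod (\<Delta> k u x)) powr p) \<partial>lborel) \<le> ennreal (A powr p)"
    define v where "v = \<Delta> k u"
    have [measurable]: "v \<in> borel_measurable borel"
      unfolding v_def by (intro borel_measurable_continuous_onI continuous_on_conv_dist u lp_piece_schwartz)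
    define D where "D = ((2::real) powi k) ^ DIM('a)"
    have D: "D > 0" by (simp add: D_def)
    have D_powr: "D = 2 powr (k * real DIM('a))"
      by (simp add: D_def two_powi powr_power mult.commute)
    define K where "K = dilate (2 powi (k + 2)) \<phi>"
    have K: "K \<in> schwartz" unfolding K_def by (intro dilate_schwartz phi_schwartz) simp
    have K_eq: "K z = of_real D * \<theta> ((2 powi k) *\<^sub>R z)" for z
      by (simp add: K_def \<theta>_def dilate_def D_def power_int_add power_mult_distrib mult_ac)
    have K_int: "(\<integral>z. cmod (K z) \<partial>lborel) = L"
    proof -
      have "L = \<bar>2 powi k\<bar> ^ DIM('a) *\<^sub>R (\<integral>z. cmod (\<theta> (0 + (2 powi k) *\<^sub>R z)) \<partial>lborel)"
        unfolding L_def by (rule lborel_integral_affine) auto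
      then show ?thesis using D unfolding K_eq norm_mult norm_of_real by (simp add: D_def)
    qed
    define h where "h y = (w * cmod (v y)) powr p" for y
    have hm [measurable]: "h \<in> borel_measurable borel" unfolding h_def[abs_def] by measurable
    have hi: "integrable lborel h"
    proof (rule integrableI_bounded)
      have "(\<integral>\<^sup>+y. norm (h y) \<partial>lborel) \<le> ennreal (A powr p)"
        using int by (simp add: h_def v_def)
      also have "\<dots> < \<infinity>" by simp
      finally show "(\<integral>\<^sup>+y. norm (h y) \<partial>lborel) < \<infinity>" .
    qed simp
    have hA: "(\<integral>y. h y \<partial>lborel) \<le> A powr p"
    proof -
      have "ennreal (\<integral>y. h y \<partial>lborel) \<le> ennreal (A powr p)"
        using int by (subst nn_integral_eq_integral[OF hi, symmetric]) (auto simp: h_def v_def)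
      then show ?thesis by (simp add: ennreal_le_iff)
    qed
    have h_refl: "(\<integral>z. h (x - z) \<partial>lborel) = (\<integral>y. h y \<partial>lborel)" "integrable lborel (\<lambda>z. h (x - z))"
      using lborel_integral_affine[of h "-1" x] lborel_integrable_affine_iff[of h "-1" x] hi by auto
    \<comment> \<open>The bound aimed at, up to the constant. Dividing by it makes the
      \<open>p\<close>-th power equal to \<open>h / (A powr p * D)\<close>, whose \<open>D\<close>
      cancels against the height of \<open>K\<close>.\<close>
    define Q where "Q = A * D powr (1 / p)"
    have Q: "Q > 0" using A D by (simp add: Q_def)
    have Qp: "Q powr p = A powr p * D" using A D p by (simp add: Q_def powr_mult powr_powr)
    have bound: "w * (cmod (K z) * cmod (v (x - z))) \<le> Q * (cmod (K z) + M / A powr p * h (x - z))" for z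
    proof -
      have "w * cmod (v (x - z)) / Q \<le> 1 + (w * cmod (v (x - z)) / Q) powr p"
        using w Q p by (intro le_1_plus_powr) auto
      also have "(w * cmod (v (x - z)) / Q) powr p = h (x - z) / (A powr p * D)"
        using w Q by (simp add: powr_divide h_def Qp)
      finally have "w * cmod (v (x - z)) \<le> Q * (1 + h (x - z) / (A powr p * D))"
        using Q by (simp add: field_simps)
      then have "cmod (K z) * (w * cmod (v (x - z))) \<le> cmod (K z) * (Q * (1 + h (x - z) / (A powr p * D)))"
        by (rule mult_left_mono) simp
      also have "\<dots> = Q * (cmod (K z) + cmod (K z) * (h (x - z) / (A powr p * D)))"
        by (simp add: algebra_simps)
      also have "cmod (K z) * (h (x - z) / (A powr p * D)) \<le> (D * M) * (h (x - z) / (A powr p * D))"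
        using D M(2) by (intro mult_right_mono) (auto simp: K_eq norm_mult h_def intro!: mult_left_mono)
      also have "(D * M) * (h (x - z) / (A powr p * D)) = M / A powr p * h (x - z)"
        using D by simp
      finally show ?thesis using Q by (simp add: mult_ac)
    qed
    note rep = conv_dist_reproducing[OF u K lp_piece_schwartz lp_piece_reproducing[of k, folded K_def], of x]
    have "w * cmod (v x) = w * cmod (\<integral>z. K z * v (x - z) \<partial>lborel)"
      using rep(1) by (simp add: v_def)
    also have "\<dots> \<le> w * (\<integral>z. cmod (K z * v (x - z)) \<partial>lborel)"
      using w by (intro mult_left_mono integral_norm_bound) auto
    also have "\<dots> = (\<integral>z. w * (cmod (K z) * cmod (v (x - z))) \<partial>lborel)"
      by (simp add: norm_mult)
    also have "\<dots> \<le> (\<integral>z. Q * (cmod (K z) + M / A powr p * h (x - z)) \<partial>lborel)"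
    proof (rule integral_mono[OF _ _ bound])
      show "integrable lborel (\<lambda>z. w * (cmod (K z) * cmod (v (x - z))))"
        using integrable_norm[OF rep(2)] by (simp add: norm_mult v_def)
      show "integrable lborel (\<lambda>z. Q * (cmod (K z) + M / A powr p * h (x - z)))"
        by (intro integrable_mult_right Bochner_Integration.integrable_add h_refl integrable_norm schwartz_integrable K)
    qed
    also have "\<dots> = Q * (L + M / A powr p * (\<integral>y. h y \<partial>lborel))"
      using h_refl schwartz_integrable[OF K] by (simp add: K_int)
    also have "\<dots> \<le> Q * (L + M)"
    proof -
      have "M / A powr p * (\<integral>y. h y \<partial>lborel) \<le> M / A powr p * A powr p"
        using hA M by (intro mult_left_mono) auto
      then show ?thesis using A Q by (intro mult_left_mono) auto
    qed
    finally show "w * cmod (\<Delta> k u x) \<le> (L + M) * A * 2 powr (k * real DIM('a) / p)"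
      unfolding Q_def D_powr v_def by (simp add: powr_powr mult_ac)
  qed
qed

text \<open>The source enters only through an integrable majorant \<open>H\<close> of the individual
  weighted blocks, that is, through the endpoint where the inner norm is a supremum. This serves
  both a Sobolev source, where \<open>H\<close> is its own integrand, and the lacunary element,
  where \<open>H\<close> is an explicit series.\<close>

theorem TL_norm_embedding:
  assumes u: "u \<in> tempered" and p: "p \<ge> 1" and r: "p < r" and q: "q > 0"
    and exponents: "\<sigma> - real DIM('a) / p = s - real DIM('a) / r"
    and H: "\<And>k x. ennreal ((2 powr (k * \<sigma>) * cmod (\<Delta> k u x)) powr p) \<le> H x"
    and H_fin: "(\<integral>\<^sup>+x. H x \<partial>lborel) < \<infinity>"
  shows "TL_norm \<phi> r q s u < \<infinity>"
proof -
  define v where "v k = \<Delta> k u" for k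
  have [measurable]: "v k \<in> borel_measurable borel" for k
    unfolding v_def by (intro borel_measurable_continuous_onI continuous_on_conv_dist u lp_piece_schwartz)
  \<comment> \<open>Measurability of \<open>H\<close> is not among the assumptions; the supremum
    over the countably many blocks is measurable and still lies below \<open>H\<close>.\<close>
  define H' where "H' x = (SUP k. ennreal ((2 powr (k * \<sigma>) * cmod (v k x)) powr p))" for x
  have H'm [measurable]: "H' \<in> borel_measurable borel"
    unfolding H'_def[abs_def] by measurable
  have "(\<integral>\<^sup>+x. H' x \<partial>lborel) \<le> (\<integral>\<^sup>+x. H x \<partial>lborel)"
    unfolding H'_def v_def by (intro nn_integral_mono SUP_least H)
  with H_fin have H'_fin: "(\<integral>\<^sup>+x. H' x \<partial>lborel) < \<infinity>" by (rule le_less_trans[rotated])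
  then obtain J where J: "J \<ge> 0" "(\<integral>\<^sup>+x. H' x \<partial>lborel) = ennreal J"
    by (cases "\<integral>\<^sup>+x. H' x \<partial>lborel") auto
  \<comment> \<open>As \<open>A \<ge> 1\<close> and \<open>p \<ge> 1\<close>,
    \<open>A powr p\<close> is at least \<open>A\<close> and hence at least \<open>J\<close>;
    moreover \<open>A\<close> is positive even if \<open>J = 0\<close>.\<close>
  define A where "A = J + 1"
  have A: "A \<ge> 1" "J \<le> A powr p"
    using J powr_mono[of 1 p A] p by (auto simp: A_def powr_one)
  have H'_ge: "ennreal ((2 powr (k * \<sigma>) * cmod (v k x)) powr p) \<le> H' x" for k x
    unfolding H'_def by (rule SUP_upper) simp
  have int: "(\<integral>\<^sup>+x. ennreal ((2 powr (k * \<sigma>) * cmod (v k x)) powr p) \<partial>lborel) \<le> ennreal (A powr p)" for k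
  proof -
    have "(\<integral>\<^sup>+x. ennreal ((2 powr (k * \<sigma>) * cmod (v k x)) powr p) \<partial>lborel) \<le> ennreal J"
      unfolding J(2)[symmetric] by (intro nn_integral_mono H'_ge)
    also have "\<dots> \<le> ennreal (A powr p)" by (intro ennreal_leI A)
    finally show ?thesis .
  qed
  obtain C1 where C1: "C1 > 0"
    "\<And>k x. 2 powr (k * \<sigma>) * cmod (v k x) \<le> C1 * A * 2 powr (k * real DIM('a) / p)"
  proof (rule bernstein)
    fix C assume "C > 0" and *: "\<And>u p A w k x. \<lbrakk>u \<in> tempered; p \<ge> 1; A > 0; w > 0;
       (\<integral>\<^sup>+x. ennreal ((w * cmod (\<Delta> k u x)) powr p) \<partial>lborel) \<le> ennreal (A powr p)\<rbrakk>
     \<Longrightarrow> w * cmod (\<Delta> k u x) \<le> C * A * 2 powr (k * real DIM('a) / p)"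
    show thesis
      by (rule that[OF \<open>C > 0\<close>], unfold v_def, rule *[OF u p]) (use A int in \<open>auto simp: v_def\<close>)
  qed
  \<comment> \<open>Changing the weight from \<open>\<sigma>\<close> to \<open>s\<close> costs
    \<open>2 powr (- (k * \<beta>))\<close>; combined with Bernstein's growth \<open>d / p\<close>
    it leaves growth \<open>\<alpha> = d / r\<close>. The interpolated power of \<open>h\<close> is
    \<open>\<alpha> / (\<alpha> + \<beta>) = p / r\<close>, whose \<open>r\<close>-th power is
    \<open>h powr p\<close>, that is \<open>H'\<close>.\<close>
  define \<alpha> where "\<alpha> = real DIM('a) / r"
  define \<beta> where "\<beta> = real DIM('a) / p - real DIM('a) / r"
  have \<alpha>: "\<alpha> > 0" using p r by (simp add: \<alpha>_def)
  have \<beta>: "\<beta> > 0" using p r by (simp add: \<beta>_def divide_strict_left_mono)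
  have ratio: "\<alpha> / (\<alpha> + \<beta>) = p / r" using p r by (simp add: \<alpha>_def \<beta>_def)
  define E where "E = (C1 * A) powr (\<beta> / (\<alpha> + \<beta>))"
  have E: "E > 0" using A C1 by (simp add: E_def)
  obtain C2 where C2: "C2 > 0" and sum_bound:
    "\<And>a h B. \<lbrakk>h \<ge> 0; B > 0; \<And>k::int. 0 \<le> a k; \<And>k. a k \<le> 2 powr (- (k * \<beta>)) * h;
        \<And>k. a k \<le> 2 powr (k * \<alpha>) * B\<rbrakk> \<Longrightarrow>
      (\<Sum>\<^sub>\<infinity>k\<in>UNIV. ennreal (a k powr q))
        \<le> ennreal (C2 * (B powr (\<beta> / (\<alpha> + \<beta>)) * h powr (\<alpha> / (\<alpha> + \<beta>))) powr q)"
    using infsum_two_sided_decay[OF \<alpha> \<beta> q] by blast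
  define P where "P = C2 powr (r / q) * E powr r"
  have P: "P > 0" using C2 E by (simp add: P_def)
  define F where "F x = epowr (epowr (\<Sum>\<^sub>\<infinity>k\<in>UNIV. ennreal (cmod (of_real (2 powr (k * s)) * v k x) powr q)) (1 / q)) r" for x
  have F: "F x \<le> ennreal P * H' x" for x
  proof (cases "H' x = \<infinity>")
    case True
    then show ?thesis using P by (simp add: ennreal_mult_top)
  next
    case False
    then obtain t where t: "t \<ge> 0" "H' x = ennreal t" by (cases "H' x") auto
    define h where "h = t powr (1 / p)"
    have h: "h \<ge> 0" "h powr p = t" using t p by (auto simp: h_def powr_powr)
    define a where "a k = cmod (of_real (2 powr (k * s)) * v k x)" for k
    have a_eq: "a k = 2 powr (- (k * \<beta>)) * (2 powr (k * \<sigma>) * cmod (v k x))" for k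
    proof -
      have "s = - \<beta> + \<sigma>" using exponents by (simp add: \<beta>_def)
      then have "real_of_int k * s = - (real_of_int k * \<beta>) + real_of_int k * \<sigma>"
        by (simp only: distrib_left mult_minus_right)
      then have "2 powr (k * s) = 2 powr (- (k * \<beta>)) * 2 powr (k * \<sigma>)"
        by (simp only: powr_add)
      then show ?thesis by (simp add: a_def norm_mult)
    qed
    have "(\<Sum>\<^sub>\<infinity>k\<in>UNIV. ennreal (a k powr q))
        \<le> ennreal (C2 * ((C1 * A) powr (\<beta> / (\<alpha> + \<beta>)) * h powr (\<alpha> / (\<alpha> + \<beta>))) powr q)"
    proof (rule sum_bound)
      show "C1 * A > 0" using C1 A by simp
      show "0 \<le> a k" for k by (simp add: a_def)
      fix k :: int
      have "(2 powr (k * \<sigma>) * cmod (v k x)) powr p \<le> t"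
        using H'_ge[of k x] t by simp
      then have "((2 powr (k * \<sigma>) * cmod (v k x)) powr p) powr (1 / p) \<le> h"
        unfolding h_def using p by (intro powr_mono2) auto
      then have "2 powr (k * \<sigma>) * cmod (v k x) \<le> h" using p by (simp add: powr_powr)
      then show "a k \<le> 2 powr (- (k * \<beta>)) * h"
        unfolding a_eq by (intro mult_left_mono) auto
      have "a k \<le> 2 powr (- (k * \<beta>)) * (C1 * A * 2 powr (k * real DIM('a) / p))"
        unfolding a_eq by (intro mult_left_mono C1) auto
      also have "\<dots> = 2 powr (k * \<alpha>) * (C1 * A)"
        by (simp add: \<alpha>_def \<beta>_def powr_add[symmetric] right_diff_distrib mult_ac)
      finally show "a k \<le> 2 powr (k * \<alpha>) * (C1 * A)" .
    qed (use h in auto)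
    then have "F x \<le> epowr (epowr (ennreal (C2 * (E * h powr (p / r)) powr q)) (1 / q)) r"
      unfolding F_def a_def E_def ratio using q p r by (intro epowr_mono) auto
    also have "\<dots> = ennreal (P * t)"
      using C2 E q p r h by (simp add: epowr_ennreal P_def powr_mult powr_powr mult_ac)
    finally show ?thesis using P t by (simp add: ennreal_mult')
  qed
  have "(\<integral>\<^sup>+x. F x \<partial>lborel) \<le> (\<integral>\<^sup>+x. ennreal P * H' x \<partial>lborel)"
    by (intro nn_integral_mono F)
  also have "\<dots> = ennreal P * ennreal J"
    by (subst nn_integral_cmult) (auto simp: J)
  also have "\<dots> < \<infinity>" by (simp add: ennreal_mult_less_top)
  finally have "(\<integral>\<^sup>+x. F x \<partial>lborel) < \<infinity>" .
  then have "epowr (\<integral>\<^sup>+x. F x \<partial>lborel) (1 / r) < \<infinity>"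
    using epowr_eq_top_iff[of "\<integral>\<^sup>+x. F x \<partial>lborel" "1 / r"] by (auto simp: less_top)
  then show ?thesis
    by (simp add: TL_norm_def F_def v_def nn_integral_completion)
qed

end

section \<open>Strictness of the embedding\<close>

context littlewood_paley
begin

text \<open>The frequency annuli run from \<open>2 powi m\<close> to \<open>2 powi (m + 2)\<close>
  and from \<open>2 powi k\<close> to \<open>2 powi (k + 2)\<close>, so they are disjoint and the
  product of the transforms vanishes.\<close>

lemma lp_piece_convolution_eq_0:
  assumes "\<bar>m - k\<bar> \<ge> 2"
  shows "conv_fun (lp_piece \<phi> m) (lp_piece \<phi> k) x = 0"
proof -
  have i: "integrable lborel (lp_piece \<phi> m)" by (rule schwartz_integrable[OF lp_piece_schwartz])
  obtain B where B: "\<And>x. cmod (conv_fun (lp_piece \<phi> m) (lp_piece \<phi> k) x) \<le> B"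
    using convolution_bounded[OF i lp_piece_schwartz] by blast
  show ?thesis
  proof (rule fourier_injective_zero[OF continuous_on_convolution[OF i lp_piece_schwartz]
        integrable_convolution[OF i lp_piece_schwartz] B])
    fix \<xi> :: 'a
    have "chi ((2 powi (- m)) *\<^sub>R \<xi>) = 0 \<or> chi ((2 powi (- k)) *\<^sub>R \<xi>) = 0"
    proof (rule ccontr)
      have lt: "2 powi l < norm \<xi> \<and> norm \<xi> < 2 powi (l + 2)" if "chi ((2 powi (- l)) *\<^sub>R \<xi>) \<noteq> 0" for l
      proof -
        have "1 < norm ((2 powi (- l)) *\<^sub>R \<xi>)" "norm ((2 powi (- l)) *\<^sub>R \<xi>) < 4"
          using chi_eq_0 that by (meson not_le)+
        then show ?thesis by (simp add: power_int_minus power_int_add field_simps)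
      qed
      assume "\<not> ?thesis"
      then have "(2::real) powi m < 2 powi (k + 2)" "(2::real) powi k < 2 powi (m + 2)"
        using lt by (meson less_trans)+
      then have "m < k + 2" "k < m + 2"
        by (simp_all add: two_powi)
      with assms show False by linarith
    qed
    then show "fourier (conv_fun (lp_piece \<phi> m) (lp_piece \<phi> k)) \<xi> = 0"
      by (auto simp: fourier_convolution[OF i lp_piece_schwartz] fourier_lp_piece)
  qed
qed

text \<open>Up to dilation only the offset \<open>m - k\<close> matters. Since nonzero interactions
  have offset -1, 0 or 1, three fixed profiles describe all blocks of the lacunary series.\<close>

lemma lp_piece_convolution_scaling:
  "conv_fun (lp_piece \<phi> m) (lp_piece \<phi> k) x
    = of_real ((2 powi k) ^ DIM('a)) * conv_fun (lp_piece \<phi> (m - k)) (lp_base \<phi>) ((2 powi k) *\<^sub>R x)"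
proof -
  have [measurable]: "lp_piece \<phi> l \<in> borel_measurable borel" "lp_base \<phi> \<in> borel_measurable borel" for l
    by (auto intro: schwartz_measurable lp_piece_schwartz lp_base_schwartz)
  let ?h = "\<lambda>y. lp_piece \<phi> (m - k) y * lp_base \<phi> ((2 powi k) *\<^sub>R x - y)"
  have "conv_fun (lp_piece \<phi> (m - k)) (lp_base \<phi>) ((2 powi k) *\<^sub>R x)
      = \<bar>2 powi k\<bar> ^ DIM('a) *\<^sub>R (\<integral>y. ?h (0 + (2 powi k) *\<^sub>R y) \<partial>lborel)"
    unfolding conv_fun_def by (rule lborel_integral_affine) auto
  then have "of_real ((2 powi k) ^ DIM('a)) * conv_fun (lp_piece \<phi> (m - k)) (lp_base \<phi>) ((2 powi k) *\<^sub>R x)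
      = (\<integral>y. of_real ((2 powi k) ^ DIM('a)) * (of_real ((2 powi k) ^ DIM('a)) * ?h ((2 powi k) *\<^sub>R y)) \<partial>lborel)"
    by (simp add: scaleR_conv_of_real)
  also have "(\<lambda>y. of_real ((2 powi k) ^ DIM('a)) * (of_real ((2 powi k) ^ DIM('a)) * ?h ((2 powi k) *\<^sub>R y)))
      = (\<lambda>y. lp_piece \<phi> m y * lp_piece \<phi> k (x - y))"
  proof
    fix y :: 'a
    have powi_eq: "(2::real) powi (m - k) * 2 powi k = 2 powi m" by (simp flip: power_int_add)
    have "(2 powi k) ^ DIM('a) * (2 powi (m - k)) ^ DIM('a) = ((2::real) powi m) ^ DIM('a)"
      by (simp only: power_mult_distrib[symmetric] powi_eq mult.commute[of "2 powi k"])
    then have m: "(of_real ((2 powi m) ^ DIM('a)) :: complex) = of_real ((2 powi k) ^ DIM('a)) * of_real ((2 powi (m - k)) ^ DIM('a))"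
      by (simp only: of_real_mult[symmetric])
    have y: "(2 powi (m - k)) *\<^sub>R (2 powi k) *\<^sub>R y = (2 powi m) *\<^sub>R y"
      by (simp only: scaleR_scaleR powi_eq)
    show "of_real ((2 powi k) ^ DIM('a)) * (of_real ((2 powi k) ^ DIM('a)) * ?h ((2 powi k) *\<^sub>R y))
        = lp_piece \<phi> m y * lp_piece \<phi> k (x - y)"
      by (simp only: lp_piece_eq dilate_def scaleR_diff_right[symmetric] m y mult_ac)
  qed
  finally show ?thesis by (simp add: conv_fun_def)
qed

lemma integral_norm_lp_piece: "(\<integral>y. cmod (lp_piece \<phi> k y) \<partial>lborel) = (\<integral>y. cmod (lp_base \<phi> y) \<partial>lborel)"
proof -
  have [measurable]: "lp_base \<phi> \<in> borel_measurable borel"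
    by (rule schwartz_measurable[OF lp_base_schwartz])
  have "(\<integral>y. cmod (lp_base \<phi> y) \<partial>lborel)
      = \<bar>2 powi k\<bar> ^ DIM('a) *\<^sub>R (\<integral>y. cmod (lp_base \<phi> (0 + (2 powi k) *\<^sub>R y)) \<partial>lborel)"
    by (rule lborel_integral_affine) auto
  then show ?thesis unfolding lp_piece_eq dilate_def norm_mult norm_of_real by simp
qed

text \<open>The frequencies \<open>2 ^ (3j)\<close> are so far apart that every Littlewood-Paley piece meets at most one
  summand. The second factor of the coefficients makes the series converge absolutely.\<close>

definition lacunary_coeff :: "real \<Rightarrow> nat \<Rightarrow> real" where
  "lacunary_coeff p j = real (Suc j) powr (- (1 / p)) * 2 powr (- (3 * real j * real DIM('a) / p))"

definition lacunary_dist :: "real \<Rightarrow> ('a \<Rightarrow> complex) \<Rightarrow> complex" where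
  "lacunary_dist p g = (if g \<in> schwartz
     then (\<Sum>j. of_real (lacunary_coeff p j) * (\<integral>y. lp_piece \<phi> (3 * int j) y * g y \<partial>lborel)) else 0)"

lemma lacunary_coeff_nonneg: "lacunary_coeff p j \<ge> 0"
  by (simp add: lacunary_coeff_def)

lemma summable_lacunary_coeff:
  assumes "p > 0" shows "summable (lacunary_coeff p)"
proof (rule summable_comparison_test')
  define \<rho> where "\<rho> = 2 powr (- (3 * real DIM('a) / p))"
  have \<rho>: "0 \<le> \<rho>" "\<rho> < 1" using assms by (auto simp: \<rho>_def powr_less_one)
  then show "summable (\<lambda>j. \<rho> ^ j)" by (intro summable_geometric) auto
  fix j :: nat
  have "real (Suc j) powr (- (1 / p)) \<le> real (Suc j) powr 0"
    using assms by (intro powr_mono) auto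
  then have "lacunary_coeff p j \<le> 1 * 2 powr (- (3 * real j * real DIM('a) / p))"
    unfolding lacunary_coeff_def by (intro mult_right_mono) auto
  also have "\<dots> = \<rho> ^ j"
    by (simp add: \<rho>_def powr_power mult_ac)
  finally show "norm (lacunary_coeff p j) \<le> \<rho> ^ j"
    using lacunary_coeff_nonneg by simp
qed

text \<open>All pieces have the same integral norm \<open>L\<close>, so each pairing with
  \<open>g\<close> is at most \<open>L\<close> times the supremum of \<open>g\<close>. With summable
  coefficients the seminorm of order 0 alone controls the series.\<close>

lemma lacunary_dist_tempered:
  assumes p: "p > 0" shows "lacunary_dist p \<in> tempered"
proof -
  define L where "L = (\<integral>y. cmod (lp_base \<phi> y) \<partial>lborel)"
  define T where "T j g = of_real (lacunary_coeff p j) * (\<integral>y. lp_piece \<phi> (3 * int j) y * g y \<partial>lborel)"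
    for j and g :: "'a \<Rightarrow> complex"
  have int: "integrable lborel (\<lambda>y. lp_piece \<phi> k y * g y)" if "g \<in> schwartz" for k g
    using convolution_integrand_integrable[OF schwartz_integrable[OF lp_piece_schwartz[of k]] schwartz_reflect[OF that, of 0], of 0]
    by simp
  have T_bound: "cmod (T j g) \<le> lacunary_coeff p j * (L * C)" if g: "g \<in> schwartz" and C: "\<And>y. cmod (g y) \<le> C" for j g C
  proof -
    have "cmod (\<integral>y. lp_piece \<phi> (3 * int j) y * g y \<partial>lborel) \<le> (\<integral>y. cmod (lp_piece \<phi> (3 * int j) y) * C \<partial>lborel)"
    proof (rule Bochner_Integration.integral_norm_bound_integral[OF int[OF g]])
      show "integrable lborel (\<lambda>y. cmod (lp_piece \<phi> (3 * int j) y) * C)"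
        by (intro integrable_mult_left integrable_norm schwartz_integrable lp_piece_schwartz)
    qed (auto simp: norm_mult intro!: mult_left_mono C)
    also have "\<dots> = L * C" by (simp add: integral_norm_lp_piece L_def)
    finally show ?thesis
      unfolding T_def norm_mult norm_of_real abs_of_nonneg[OF lacunary_coeff_nonneg]
      by (rule mult_left_mono) (rule lacunary_coeff_nonneg)
  qed
  have T_summable: "summable (\<lambda>j. T j g)" "summable (\<lambda>j. cmod (T j g))" if g: "g \<in> schwartz" for g
  proof -
    obtain C where C: "C > 0" "\<And>y. cmod (g y) \<le> C" using schwartz_bounded[OF g] by blast
    show "summable (\<lambda>j. cmod (T j g))"
      by (rule summable_comparison_test'[OF summable_mult2[OF summable_lacunary_coeff[OF p], of "L * C"]])
         (use T_bound[OF g C(2)] in simp)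
    then show "summable (\<lambda>j. T j g)" by (rule summable_norm_cancel)
  qed
  have eq: "lacunary_dist p g = (\<Sum>j. T j g)" if "g \<in> schwartz" for g
    using that by (simp add: lacunary_dist_def T_def)
  show ?thesis
    unfolding tempered_def
  proof (intro CollectI conjI ballI allI impI)
    fix g h :: "'a \<Rightarrow> complex" assume gh: "g \<in> schwartz" "h \<in> schwartz"
    have "T j (\<lambda>x. g x + h x) = T j g + T j h" for j
      using int[OF gh(1)] int[OF gh(2)] by (simp add: T_def ring_distribs)
    then show "lacunary_dist p (\<lambda>x. g x + h x) = lacunary_dist p g + lacunary_dist p h"
      using gh schwartz_lincomb[OF gh, of 1 1] by (simp add: eq suminf_add[OF T_summable(1) T_summable(1)])
  next
    fix g :: "'a \<Rightarrow> complex" and a assume g: "g \<in> schwartz"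
    have "T j (\<lambda>x. a * g x) = a * T j g" for j
      by (simp add: T_def mult.left_commute[of _ a])
    then show "lacunary_dist p (\<lambda>x. a * g x) = a * lacunary_dist p g"
      using g schwartz_cmult[OF g, of a] by (simp add: eq suminf_mult[OF T_summable(1)])
  next
    show "\<exists>C N. \<forall>g\<in>schwartz. cmod (lacunary_dist p g)
        \<le> C * (\<Sum>bs\<in>{bs::'a list. set bs \<subseteq> Basis \<and> length bs \<le> N}. schwartz_seminorm N bs g)"
    proof (intro exI ballI)
      fix g :: "'a \<Rightarrow> complex" assume g: "g \<in> schwartz"
      define C where "C = schwartz_seminorm 0 [] g"
      obtain B where "B > 0" "\<And>y. cmod (g y) \<le> B" using schwartz_bounded[OF g] by blast
      then have C: "cmod (g y) \<le> C" for y
        unfolding C_def schwartz_seminorm_def by (auto intro!: cSUP_upper bdd_aboveI2)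
      have "cmod (\<Sum>j. T j g) \<le> (\<Sum>j. cmod (T j g))"
        by (rule summable_norm[OF T_summable(2)[OF g]])
      also have "\<dots> \<le> (\<Sum>j. lacunary_coeff p j * (L * C))"
        by (rule suminf_le[OF T_bound[OF g C] T_summable(2)[OF g] summable_mult2[OF summable_lacunary_coeff[OF p]]])
      also have "\<dots> = (\<Sum>j. lacunary_coeff p j) * (L * C)"
        by (rule suminf_mult2[symmetric, OF summable_lacunary_coeff[OF p]])
      also have "\<dots> = ((\<Sum>j. lacunary_coeff p j) * L) *
          (\<Sum>bs\<in>{bs::'a list. set bs \<subseteq> Basis \<and> length bs \<le> 0}. schwartz_seminorm 0 bs g)"
      proof -
        have "{bs::'a list. set bs \<subseteq> Basis \<and> length bs \<le> 0} = {[]}" by auto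
        then show ?thesis by (simp add: C_def)
      qed
      finally show "cmod (lacunary_dist p g) \<le> ((\<Sum>j. lacunary_coeff p j) * L) *
          (\<Sum>bs\<in>{bs::'a list. set bs \<subseteq> Basis \<and> length bs \<le> 0}. schwartz_seminorm 0 bs g)"
        using g by (simp add: eq)
    qed
  qed (simp add: lacunary_dist_def)
qed

abbreviation conv_block :: "int \<Rightarrow> 'a \<Rightarrow> complex" where
  "conv_block i \<equiv> conv_fun (lp_piece \<phi> i) (lp_base \<phi>)"

text \<open>The only multiple \<open>3 * j\<close> within distance 1 of \<open>k\<close> has
  \<open>j = (k + 1) div 3\<close>, and this \<open>j\<close> is a legitimate index exactly when
  \<open>k \<ge> -1\<close>.\<close>

lemma conv_dist_lacunary:
  "\<Delta> k (lacunary_dist p) x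
    = (if k \<ge> -1 then of_real (lacunary_coeff p (nat ((k + 1) div 3)) * (2 powi k) ^ DIM('a))
         * conv_block (3 * ((k + 1) div 3) - k) ((2 powi k) *\<^sub>R x) else 0)"
proof -
  define T where "T j = of_real (lacunary_coeff p j) * conv_fun (lp_piece \<phi> (3 * int j)) (lp_piece \<phi> k) x" for j
  have "\<Delta> k (lacunary_dist p) x = (\<Sum>j. T j)"
    using schwartz_reflect[OF lp_piece_schwartz[of k], of x]
    by (simp add: conv_dist_def lacunary_dist_def T_def conv_fun_def)
  also have "\<dots> = (\<Sum>j\<in>(if k \<ge> -1 then {nat ((k + 1) div 3)} else {}). T j)"
  proof (rule suminf_finite)
    fix j assume j: "j \<notin> (if k \<ge> -1 then {nat ((k + 1) div 3)} else {})"
    have "\<bar>3 * int j - k\<bar> \<ge> 2" using j by (auto split: if_splits)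
    then show "T j = 0" by (simp add: T_def lp_piece_convolution_eq_0)
  qed simp
  also have "\<dots> = (if k \<ge> -1 then of_real (lacunary_coeff p (nat ((k + 1) div 3)) * (2 powi k) ^ DIM('a))
         * conv_block (3 * ((k + 1) div 3) - k) ((2 powi k) *\<^sub>R x) else 0)"
    by (simp add: T_def lp_piece_convolution_scaling[of _ k] mult.assoc)
  finally show ?thesis .
qed

lemma norm_conv_dist_lacunary:
  assumes "k \<ge> -1"
  shows "cmod (\<Delta> k (lacunary_dist p) x)
    = lacunary_coeff p (nat ((k + 1) div 3)) * (2 powi k) ^ DIM('a)
      * cmod (conv_block (3 * ((k + 1) div 3) - k) ((2 powi k) *\<^sub>R x))"
proof -
  have "\<bar>lacunary_coeff p j * (2 powi k) ^ DIM('a)\<bar> = lacunary_coeff p j * (2 powi k) ^ DIM('a)" for j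
    using lacunary_coeff_nonneg by (intro abs_of_nonneg mult_nonneg_nonneg) auto
  with assms show ?thesis
    by (simp only: conv_dist_lacunary if_True norm_mult norm_of_real)
qed

lemma conv_block_continuous: "continuous_on A (conv_block i)"
  by (rule continuous_on_convolution[OF schwartz_integrable[OF lp_piece_schwartz] lp_base_schwartz])

text \<open>Its Fourier transform is the square of \<open>chi\<close>, which is 1 on the sphere of
  radius 2.\<close>

lemma conv_block_0_nonzero: "\<exists>x. conv_block 0 x \<noteq> 0"
proof (rule ccontr)
  assume "\<not> ?thesis"
  then have 0: "conv_block 0 = (\<lambda>x. 0)" by auto
  obtain e :: 'a where e: "norm e = 1" using norm_Basis nonempty_Basis by blast
  have "fourier (conv_block 0) (2 *\<^sub>R e) = of_real (chi (2 *\<^sub>R e)) * of_real (chi (2 *\<^sub>R e))"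
    by (simp add: fourier_convolution[OF schwartz_integrable[OF lp_piece_schwartz] lp_base_schwartz]
        fourier_lp_piece fourier_lp_base_chi)
  then show False
    using e chi_eq_1[of "2 *\<^sub>R e"] unfolding 0 by (simp add: fourier_lborel)
qed

text \<open>The profile is bounded and integrable, so \<open>t - 1\<close> of the powers are taken
  out at the supremum.\<close>

lemma integrable_conv_block_powr:
  assumes "t \<ge> 1" shows "integrable lborel (\<lambda>x. cmod (conv_block i x) powr t)"
proof -
  have [measurable]: "conv_block i \<in> borel_measurable borel"
    by (intro borel_measurable_continuous_onI conv_block_continuous)
  note block = schwartz_integrable[OF lp_piece_schwartz] lp_base_schwartz
  obtain B where B: "\<And>x. cmod (conv_block i x) \<le> B"
    using convolution_bounded[OF block] by blast
  have "integrable lborel (\<lambda>x. B powr (t - 1) * cmod (conv_block i x))"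
    by (intro integrable_mult_right integrable_norm integrable_convolution[OF block])
  then show ?thesis
  proof (rule Bochner_Integration.integrable_bound)
    show "AE x in lborel. norm (cmod (conv_block i x) powr t) \<le> norm (B powr (t - 1) * cmod (conv_block i x))"
    proof (rule AE_I2)
      fix x
      have "cmod (conv_block i x) powr t = cmod (conv_block i x) powr (t - 1) * cmod (conv_block i x)"
        by (cases "conv_block i x = 0") (auto simp: powr_diff)
      also have "\<dots> \<le> B powr (t - 1) * cmod (conv_block i x)"
        using B[of x] assms by (intro mult_right_mono powr_mono2) auto
      finally show "norm (cmod (conv_block i x) powr t) \<le> norm (B powr (t - 1) * cmod (conv_block i x))"
        by simp
    qed
  qed simp
qed

text \<open>The embedding is applied from an exponent \<open>t\<close> strictly between
  \<open>p\<close> and \<open>r\<close>. There the \<open>t\<close>-th powers of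
  \<open>Suc j powr (- (1 / p))\<close> are summable, whereas at \<open>p\<close> itself they form
  the harmonic series.\<close>

lemma TL_norm_lacunary_finite:
  assumes p: "p \<ge> 1" and r: "p < r" and q: "q > 0" and s: "s = real DIM('a) * (1 / p + 1 / r - 1)"
  shows "TL_norm \<phi> r q s (lacunary_dist p) < \<infinity>"
proof -
  define d where "d = real DIM('a)"
  define t where "t = (p + r) / 2"
  have t: "p < t" "t < r" "t \<ge> 1" using p r by (auto simp: t_def)
  \<comment> \<open>Chosen so that \<open>\<sigma> - d / t = s - d / r\<close>, as the embedding
    demands.\<close>
  define \<sigma> where "\<sigma> = d / t + d / p - d"
  \<comment> \<open>Summing over the three possible offsets gives one profile that dominates every
    block after rescaling.\<close>
  define \<Psi> where "\<Psi> x = cmod (conv_block (-1) x) powr t + cmod (conv_block 0 x) powr t + cmod (conv_block 1 x) powr t" for x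
  have [measurable]: "conv_block i \<in> borel_measurable borel" for i
    by (intro borel_measurable_continuous_onI conv_block_continuous)
  have \<Psi>m [measurable]: "\<Psi> \<in> borel_measurable borel" unfolding \<Psi>_def[abs_def] by measurable
  have \<Psi>i: "integrable lborel \<Psi>"
    unfolding \<Psi>_def[abs_def] by (intro Bochner_Integration.integrable_add integrable_conv_block_powr t)
  have \<Psi>0: "\<Psi> x \<ge> 0" for x by (simp add: \<Psi>_def)
  \<comment> \<open>The index is shifted by \<open>k = n - 1\<close> so that the nonzero blocks
    start at \<open>n = 0\<close>; then \<open>n div 3\<close> is the index of the active
    coefficient. The factor \<open>2 powr (d / p)\<close> covers the worst offset, -1.\<close>
  define a where "a n = (real (Suc (n div 3)) powr (- (1 / p)) * 2 powr (d / p)) powr t" for n :: nat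
  define h where "h n x = ennreal (a n * 2 powr ((real n - 1) * d)) * ennreal (\<Psi> ((2 powi (int n - 1)) *\<^sub>R x))" for n x
  define H where "H x = (\<Sum>n. h n x)" for x
  show ?thesis
  proof (rule TL_norm_embedding[where \<sigma> = \<sigma> and p = t and H = H])
    show "lacunary_dist p \<in> tempered" using p by (intro lacunary_dist_tempered) simp
    show "\<sigma> - real DIM('a) / t = s - real DIM('a) / r"
      by (simp add: \<sigma>_def s d_def algebra_simps)
    show "ennreal ((2 powr (k * \<sigma>) * cmod (\<Delta> k (lacunary_dist p) x)) powr t) \<le> H x" for k x
    proof (cases "k \<ge> -1")
      case True
      define n where "n = nat (k + 1)"
      have "0 \<le> a n" by (simp add: a_def)
      have k: "k = int n - 1" using True by (simp add: n_def)
      have div: "nat ((k + 1) div 3) = n div 3" by (simp add: k nat_div_distrib)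
      define i where "i = 3 * ((k + 1) div 3) - k"
      have i: "i = -1 \<or> i = 0 \<or> i = 1" unfolding i_def by auto
      have 3: "3 * real (n div 3) = real_of_int k + real_of_int i"
      proof -
        have "3 * int (n div 3) = k + i" by (simp add: i_def k zdiv_int)
        then show ?thesis by (metis of_int_add of_int_mult of_int_numeral of_int_of_nat_eq)
      qed
      have "2 powr (k * \<sigma>) * cmod (\<Delta> k (lacunary_dist p) x)
          = 2 powr (k * \<sigma>) * (lacunary_coeff p (n div 3) * (2 powi k) ^ DIM('a)) * cmod (conv_block i ((2 powi k) *\<^sub>R x))"
        unfolding norm_conv_dist_lacunary[OF True] div i_def by simp
      also have "(2 powi k) ^ DIM('a) = 2 powr (k * d)"
        by (simp add: two_powi powr_power d_def mult.commute)
      also have "2 powr (k * \<sigma>) * (lacunary_coeff p (n div 3) * 2 powr (k * d))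
          = real (Suc (n div 3)) powr (- (1 / p)) * 2 powr (k * d / t - real_of_int i * d / p)"
      proof -
        have "real_of_int k * \<sigma> + - (3 * real (n div 3) * d / p) + real_of_int k * d = real_of_int k * d / t - real_of_int i * d / p"
          unfolding 3 \<sigma>_def by (simp add: algebra_simps add_divide_distrib diff_divide_distrib)
        then have "2 powr (k * \<sigma>) * 2 powr (- (3 * real (n div 3) * d / p)) * 2 powr (k * d)
            = 2 powr (k * d / t - real_of_int i * d / p)"
          by (simp only: powr_add[symmetric])
        then show ?thesis by (simp add: lacunary_coeff_def d_def[symmetric] mult_ac)
      qed
      also have "\<dots> \<le> real (Suc (n div 3)) powr (- (1 / p)) * (2 powr (d / p) * 2 powr (k * d / t))"
      proof (rule mult_left_mono)
        have "- real_of_int i * (d / p) \<le> 1 * (d / p)"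
          using i p by (intro mult_right_mono) (auto simp: d_def)
        then show "2 powr (k * d / t - real_of_int i * d / p) \<le> 2 powr (d / p) * 2 powr (k * d / t)"
          by (simp add: powr_add[symmetric])
      qed simp
      finally have "2 powr (k * \<sigma>) * cmod (\<Delta> k (lacunary_dist p) x)
          \<le> real (Suc (n div 3)) powr (- (1 / p)) * (2 powr (d / p) * 2 powr (k * d / t)) * cmod (conv_block i ((2 powi k) *\<^sub>R x))"
        by (simp add: mult_right_mono)
      then have "(2 powr (k * \<sigma>) * cmod (\<Delta> k (lacunary_dist p) x)) powr t
          \<le> (real (Suc (n div 3)) powr (- (1 / p)) * (2 powr (d / p) * 2 powr (k * d / t)) * cmod (conv_block i ((2 powi k) *\<^sub>R x))) powr t"
        using t by (intro powr_mono2) auto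
      also have "\<dots> = a n * 2 powr (k * d) * cmod (conv_block i ((2 powi k) *\<^sub>R x)) powr t"
        using t p by (simp add: a_def powr_mult powr_powr)
      also have "\<dots> \<le> a n * 2 powr (k * d) * \<Psi> ((2 powi k) *\<^sub>R x)"
        using i \<open>0 \<le> a n\<close> by (intro mult_left_mono) (auto simp: \<Psi>_def)
      finally have "ennreal ((2 powr (k * \<sigma>) * cmod (\<Delta> k (lacunary_dist p) x)) powr t) \<le> h n x"
        unfolding h_def k using \<open>0 \<le> a n\<close>
        by (subst ennreal_mult'[symmetric]) (auto simp: \<Psi>0 intro!: ennreal_leI)
      also have "h n x \<le> H x"
        unfolding H_def using sum_le_suminf[of "\<lambda>n. h n x" "{n}"] by simp
      finally show ?thesis .
    next
      case False
      then show ?thesis using t by (simp add: conv_dist_lacunary)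
    qed
    have "(\<integral>\<^sup>+x. H x \<partial>lborel) = (\<Sum>n. \<integral>\<^sup>+x. h n x \<partial>lborel)"
      unfolding H_def[abs_def] by (rule nn_integral_suminf) (simp add: h_def)
    also have "(\<lambda>n. \<integral>\<^sup>+x. h n x \<partial>lborel) = (\<lambda>n. ennreal (a n * (\<integral>x. \<Psi> x \<partial>lborel)))"
    proof
      fix n
      have "ennreal (\<integral>x. \<Psi> x \<partial>lborel) = (\<integral>\<^sup>+x. ennreal (\<Psi> x) \<partial>lborel)"
        using \<Psi>0 by (simp add: nn_integral_eq_integral[OF \<Psi>i])
      also have "\<dots> = ennreal (\<bar>2 powi (int n - 1)\<bar> ^ DIM('a)) * (\<integral>\<^sup>+x. ennreal (\<Psi> (0 + (2 powi (int n - 1)) *\<^sub>R x)) \<partial>lborel)"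
        by (rule nn_integral_lborel_affine) auto
      also have "\<bar>2 powi (int n - 1)\<bar> ^ DIM('a) = 2 powr ((real n - 1) * d)"
        by (simp add: two_powi powr_power d_def mult.commute)
      finally have *: "ennreal (\<integral>x. \<Psi> x \<partial>lborel) = ennreal (2 powr ((real n - 1) * d)) * (\<integral>\<^sup>+x. ennreal (\<Psi> ((2 powi (int n - 1)) *\<^sub>R x)) \<partial>lborel)"
        by simp
      have "a n \<ge> 0" by (simp add: a_def)
      then show "(\<integral>\<^sup>+x. h n x \<partial>lborel) = ennreal (a n * (\<integral>x. \<Psi> x \<partial>lborel))"
        unfolding h_def by (subst nn_integral_cmult) (simp_all add: ennreal_mult' * mult.assoc)
    qed
    also have "(\<Sum>n. ennreal (a n * (\<integral>x. \<Psi> x \<partial>lborel))) < \<infinity>"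
    proof -
      have "summable a"
      proof (rule summable_comparison_test')
        \<comment> \<open>The exponent \<open>e = t / p\<close> exceeds 1 by the choice of
          \<open>t\<close>. Each coefficient occurs for three values of \<open>n\<close>, and
          comparing \<open>n div 3\<close> with \<open>n\<close> costs the factor
          \<open>3 powr e\<close>.\<close>
        define e where "e = t / p"
        have e: "e > 1" using t p by (simp add: e_def)
        show "summable (\<lambda>n. 2 powr (d * e) * 3 powr e * real (Suc n) powr (- e))"
          using e by (intro summable_mult) (subst summable_Suc_iff[of "\<lambda>n. real n powr (- e)"], simp add: summable_real_powr_iff)
        fix n :: nat
        have "real (Suc n) / 3 \<le> real (Suc (n div 3))"
        proof -
          have "Suc n \<le> 3 * Suc (n div 3)" by presburger
          then have "real (Suc n) \<le> real (3 * Suc (n div 3))" by (simp only: of_nat_le_iff)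
          then show ?thesis by simp
        qed
        then have "real (Suc (n div 3)) powr (- e) \<le> (real (Suc n) / 3) powr (- e)"
          using e by (intro powr_mono2') auto
        also have "\<dots> = 3 powr e * real (Suc n) powr (- e)"
          by (simp add: powr_divide powr_minus field_simps)
        finally have "2 powr (d * e) * real (Suc (n div 3)) powr (- e) \<le> 2 powr (d * e) * (3 powr e * real (Suc n) powr (- e))"
          by (rule mult_left_mono) simp
        moreover have "a n = 2 powr (d * e) * real (Suc (n div 3)) powr (- e)"
          using p by (simp add: a_def e_def powr_mult powr_powr mult_ac)
        ultimately show "norm (a n) \<le> 2 powr (d * e) * 3 powr e * real (Suc n) powr (- e)"
          by (simp add: mult.assoc)
      qed
      then have "summable (\<lambda>n. a n * (\<integral>x. \<Psi> x \<partial>lborel))" by (rule summable_mult2)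
      then have "(\<Sum>n. ennreal (a n * (\<integral>x. \<Psi> x \<partial>lborel))) = ennreal (\<Sum>n. a n * (\<integral>x. \<Psi> x \<partial>lborel))"
        using \<Psi>0 by (intro suminf_ennreal2) (auto simp: a_def intro!: mult_nonneg_nonneg integral_nonneg_AE)
      then show ?thesis by simp
    qed
    finally show "(\<integral>\<^sup>+x. H x \<partial>lborel) < \<infinity>" .
  qed (use t q in auto)
qed

text \<open>At the frequencies \<open>3 * j\<close> the block is an L^p-normalised dilate of
  \<open>conv_block 0\<close> with amplitude \<open>Suc j powr (- (1 / p))\<close>. Finiteness of
  the norm would therefore bound the partial sums of the harmonic series.\<close>

lemma TL_norm_lacunary_infinite:
  assumes p: "p \<ge> 1" and q: "q > 0"
  shows "TL_norm \<phi> p q (real DIM('a) * (2 / p - 1)) (lacunary_dist p) = \<infinity>"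
proof (rule ccontr)
  define d where "d = real DIM('a)"
  let ?\<sigma> = "real DIM('a) * (2 / p - 1)"
  assume "\<not> ?thesis"
  then obtain B where B: "B \<ge> 0" "TL_norm \<phi> p q ?\<sigma> (lacunary_dist p) = ennreal B"
    by (cases "TL_norm \<phi> p q ?\<sigma> (lacunary_dist p)") auto
  obtain x1 where x1: "conv_block 0 x1 \<noteq> 0" using conv_block_0_nonzero by blast
  have "p > 0" using p by simp
  obtain c where c: "c > 0" "dyadic_lower_bound (conv_block 0) p c"
    using TL_norm_lower_dyadic[OF conv_block_continuous x1 \<open>p > 0\<close>] by blast
  have bound: "(\<Sum>j<n. 1 / real (Suc j)) \<le> B powr p / c" for n
  proof -
    \<comment> \<open>Restricting to these indices keeps the offset equal to 0, so that a single
      profile \<open>g\<close> fits \<open>dyadic_lower_bound\<close>.\<close>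
    define I where "I = (\<lambda>j. 3 * int j) ` {..<n}"
    define b where "b k = real (Suc (nat (k div 3))) powr (- (1 / p))" for k :: int
    have "c * (\<Sum>k\<in>I. b k powr p) \<le> B powr p"
    proof (rule dyadic_lower_boundD[OF c(2), where u = "lacunary_dist p"])
      show "TL_norm \<phi> p q ?\<sigma> (lacunary_dist p) \<le> ennreal B" using B by simp
      fix k and x :: 'a assume "k \<in> I"
      then obtain j where k: "k = 3 * int j" by (auto simp: I_def)
      have div: "(k + 1) div 3 = int j" "k div 3 = int j" by (auto simp: k)
      have "cmod (of_real (2 powr (k * ?\<sigma>)) * \<Delta> k (lacunary_dist p) x)
          = 2 powr (k * ?\<sigma>) * (lacunary_coeff p j * (2 powi k) ^ DIM('a)) * cmod (conv_block 0 ((2 powi k) *\<^sub>R x))"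
      proof -
        have "k \<ge> -1" by (simp add: k)
        then show ?thesis unfolding norm_mult norm_conv_dist_lacunary[OF \<open>k \<ge> -1\<close>] div by (simp add: k)
      qed
      also have "(2 powi k) ^ DIM('a) = 2 powr (k * d)"
        by (simp add: two_powi powr_power d_def mult.commute)
      also have "2 powr (k * ?\<sigma>) * (lacunary_coeff p j * 2 powr (k * d))
          = b k * 2 powr (k * d / p)"
      proof -
        have "real_of_int k * ?\<sigma> + - (3 * real j * d / p) + real_of_int k * d = real_of_int k * d / p"
          by (simp add: k d_def algebra_simps)
        then have "2 powr (k * ?\<sigma>) * 2 powr (- (3 * real j * d / p)) * 2 powr (k * d)
            = 2 powr (k * d / p)"
          by (simp only: powr_add[symmetric])
        then show ?thesis by (simp add: lacunary_coeff_def b_def div d_def[symmetric] mult_ac)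
      qed
      finally show "cmod (of_real (2 powr (k * ?\<sigma>)) * \<Delta> k (lacunary_dist p) x)
          = b k * 2 powr (k * real DIM('a) / p) * cmod (conv_block 0 ((2 powi k) *\<^sub>R x))"
        by (simp add: d_def)
    qed (use B q in \<open>auto simp: I_def b_def\<close>)
    moreover have "(\<Sum>k\<in>I. b k powr p) = (\<Sum>j<n. 1 / real (Suc j))"
    proof -
      have "b (3 * int j) powr p = 1 / real (Suc j)" for j
        using \<open>p > 0\<close> by (simp add: b_def powr_powr)
      then show ?thesis
        unfolding I_def by (subst sum.reindex) (auto simp: inj_on_def)
    qed
    ultimately show ?thesis using c by (simp add: field_simps)
  qed
  have "summable (\<lambda>j. 1 / real (Suc j))"
    by (rule bounded_imp_summable[where B = "B powr p / c"]) (use bound[of "Suc n" for n] in \<open>auto simp: lessThan_Suc_atMost\<close>)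
  then have "summable (\<lambda>j. 1 / real j)"
    by (subst (asm) summable_Suc_iff[of "\<lambda>j. 1 / real j"])
  then show False
    using not_summable_harmonic[where 'a = real] by (simp add: inverse_eq_divide)
qed

section \<open>Classes modulo polynomials and the final inclusion\<close>

text \<open>The blocks test \<open>u\<close> only against flat functions, on which \<open>u\<close>
  and \<open>v\<close> agree.\<close>

lemma TL_norm_poly_rel:
  assumes "(u, v) \<in> poly_rel" shows "TL_norm \<phi> r q s u = TL_norm \<phi> r q s v"
proof -
  obtain P where P: "polynomial_function P" "(\<lambda>g. u g - v g) = dist_of_fun P"
    using assms by (auto simp: poly_rel_def)
  have "u (\<lambda>y. lp_piece \<phi> k (x - y)) = v (\<lambda>y. lp_piece \<phi> k (x - y))" for k x
  proof -
    have "u (\<lambda>y. lp_piece \<phi> k (x - y)) - v (\<lambda>y. lp_piece \<phi> k (x - y)) = dist_of_fun P (\<lambda>y. lp_piece \<phi> k (x - y))"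
      using P(2) by (rule fun_cong)
    also have "\<dots> = 0"
      using integral_polynomial_schwartz_flat[OF P(1) lp_piece_reflect_flat] by (simp add: dist_of_fun_def)
    finally show ?thesis by simp
  qed
  then show ?thesis by (simp add: TL_norm_def conv_dist_def)
qed

lemma poly_class_self: "u \<in> tempered \<Longrightarrow> u \<in> poly_class u"
  by (auto simp: poly_class_def poly_rel_def dist_of_fun_def fun_eq_iff intro!: exI[of _ "\<lambda>_. 0"])

text \<open>Membership of a class only provides some representative of finite norm; nonmembership of
  the lacunary class requires the conclusion for the given one.\<close>

lemma TL_norm_if_mem_TL_space:
  assumes "u \<in> tempered" "poly_class u \<in> TL_space \<phi> r q s"
  shows "TL_norm \<phi> r q s u < \<infinity>"
proof -
  obtain v where v: "poly_class u = poly_class v" "v \<in> tempered" "TL_norm \<phi> r q s v < \<infinity>"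
    using assms by (auto simp: TL_space_def)
  then have "(u, v) \<in> poly_rel"
    using poly_class_self[OF v(2)] by (auto simp: poly_class_def)
  with v show ?thesis by (simp add: TL_norm_poly_rel)
qed

lemma Sobolev_space_subset_TL_space:
  assumes p: "p \<ge> 1" and r: "p < r" and q: "q > 0" and s: "s = real DIM('a) * (1 / p + 1 / r - 1)"
  shows "Sobolev_space \<phi> p (real DIM('a) * (2 / p - 1)) \<subset> TL_space \<phi> r q s"
proof
  let ?\<sigma> = "real DIM('a) * (2 / p - 1)"
  show "Sobolev_space \<phi> p ?\<sigma> \<subseteq> TL_space \<phi> r q s"
  proof
    fix X assume "X \<in> Sobolev_space \<phi> p ?\<sigma>"
    then obtain u where u: "X = poly_class u" "u \<in> tempered" "TL_norm \<phi> p 2 ?\<sigma> u < \<infinity>"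
      by (auto simp: Sobolev_space_def TL_space_def)
    \<comment> \<open>The integrand of the Sobolev norm itself: each single weighted block lies
      below the inner sum, so it is an admissible majorant.\<close>
    define H where "H x = epowr (epowr (\<Sum>\<^sub>\<infinity>k\<in>UNIV.
        ennreal (cmod (of_real (2 powr (k * ?\<sigma>)) * \<Delta> k u x) powr 2)) (1 / 2)) p" for x
    have "TL_norm \<phi> r q s u < \<infinity>"
    proof (rule TL_norm_embedding[OF u(2) p r q, where H = H])
      show "?\<sigma> - real DIM('a) / p = s - real DIM('a) / r" by (simp add: s algebra_simps)
      show "ennreal ((2 powr (k * ?\<sigma>) * cmod (\<Delta> k u x)) powr p) \<le> H x" for k x
      proof -
        have "ennreal (cmod (of_real (2 powr (k * ?\<sigma>)) * \<Delta> k u x) powr p) \<le> H x"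
          unfolding H_def using p
          by (intro epowr_lower_bound infsum_ennreal_ge[of "\<lambda>k. ennreal (cmod (of_real (2 powr (k * ?\<sigma>)) * \<Delta> k u x) powr 2)"]) auto
        then show ?thesis by (simp add: norm_mult)
      qed
      have "epowr (\<integral>\<^sup>+x. H x \<partial>lborel) (1 / p) < \<infinity>"
        using u(3) by (simp add: TL_norm_def H_def nn_integral_completion)
      then show "(\<integral>\<^sup>+x. H x \<partial>lborel) < \<infinity>"
        using epowr_eq_top_iff[of "\<integral>\<^sup>+x. H x \<partial>lborel" "1 / p"] by (auto simp: less_top)
    qed
    with u show "X \<in> TL_space \<phi> r q s" by (auto simp: TL_space_def)
  qed
  have v: "lacunary_dist p \<in> tempered" using p by (intro lacunary_dist_tempered) simp
  then have "poly_class (lacunary_dist p) \<in> TL_space \<phi> r q s"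
    using TL_norm_lacunary_finite[OF assms] by (auto simp: TL_space_def)
  moreover have "poly_class (lacunary_dist p) \<notin> Sobolev_space \<phi> p ?\<sigma>"
    using TL_norm_if_mem_TL_space[OF v, of p 2 ?\<sigma>] TL_norm_lacunary_infinite[OF p, of 2]
    by (auto simp: Sobolev_space_def)
  ultimately show "Sobolev_space \<phi> p ?\<sigma> \<noteq> TL_space \<phi> r q s" by blast
qed

end

theorem theorem1p13:
  fixes \<phi> :: "'a::euclidean_space \<Rightarrow> complex" and p r q s :: real
  assumes "lp_generator \<phi>" and "2 < p" and "1 < r" and "1 < q"
  shows "(fourier_bounded \<phi> p r q s \<longrightarrow>
            s = real DIM('a) * (1 / p - 1 / conj_exponent r) \<and>
            r \<ge> p \<and>
            (r > p \<longrightarrow>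
               Sobolev_space \<phi> p (real DIM('a) * (2 / p - 1)) \<subset> TL_space \<phi> r q s)) \<and>
         (fourier_bounded \<phi> p r 2 s \<longrightarrow>
            Sobolev_space \<phi> p (real DIM('a) * (2 / p - 1)) \<subseteq> Sobolev_space \<phi> r s \<and>
            (Sobolev_space \<phi> p (real DIM('a) * (2 / p - 1)) = Sobolev_space \<phi> r s \<longleftrightarrow>
               r = p \<and> s = real DIM('a) * (2 / p - 1)))"
proof -
  interpret littlewood_paley \<phi> by unfold_locales (rule assms(1))
  have conj: "1 / conj_exponent r = 1 - 1 / r"
    using assms(3) by (simp add: conj_exponent_def field_simps)
  have nec: "s = real DIM('a) * (1 / p + 1 / r - 1)" "p \<le> r"
    if "fourier_bounded \<phi> p r q' s" "q' > 1" for q'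
    using that assms(2,3)
    by (auto intro!: fourier_bounded_imp_scaling[of p r q' s] fourier_bounded_imp_exponent_le[of p r q' s])
  have strict: "Sobolev_space \<phi> p (real DIM('a) * (2 / p - 1)) \<subset> TL_space \<phi> r q' s"
    if "fourier_bounded \<phi> p r q' s" "q' > 1" "p < r" for q'
    using that assms(2) nec[OF that(1,2)] by (intro Sobolev_space_subset_TL_space) auto
  \<comment> \<open>When \<open>r = p\<close> the scaling relation leaves only this
    \<open>s\<close>, and the two Sobolev spaces are then literally the same set. For
    \<open>p < r\<close> strictness excludes equality, which settles the equivalence.\<close>
  have eq: "s = real DIM('a) * (2 / p - 1)" if "fourier_bounded \<phi> p r 2 s" "r = p"
    using nec(1)[OF that(1)] that(2) by simp
  show ?thesis
  proof (intro conjI impI)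
    assume b: "fourier_bounded \<phi> p r q s"
    show "s = real DIM('a) * (1 / p - 1 / conj_exponent r)"
      unfolding conj using nec(1)[OF b assms(4)] by (simp add: algebra_simps)
    show "r \<ge> p" by (rule nec(2)[OF b assms(4)])
    show "Sobolev_space \<phi> p (real DIM('a) * (2 / p - 1)) \<subset> TL_space \<phi> r q s" if "r > p"
      by (rule strict[OF b assms(4) that])
  next
    assume b: "fourier_bounded \<phi> p r 2 s"
    have cases: "p < r \<or> r = p" using nec(2)[OF b] by auto
    have strict': "Sobolev_space \<phi> p (real DIM('a) * (2 / p - 1)) \<subset> Sobolev_space \<phi> r s" if "p < r"
      using strict[OF b _ that] by (simp add: Sobolev_space_def)
    show "Sobolev_space \<phi> p (real DIM('a) * (2 / p - 1)) \<subseteq> Sobolev_space \<phi> r s"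
      using cases strict' eq[OF b] by auto
    show "Sobolev_space \<phi> p (real DIM('a) * (2 / p - 1)) = Sobolev_space \<phi> r s \<longleftrightarrow>
        r = p \<and> s = real DIM('a) * (2 / p - 1)"
      using cases strict' eq[OF b] by auto
  qed
qed

end
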